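(* Consider the DSCMD-N iteration described in the context, and suppose that the network, stochastic-subgradient, noise and mirror-map assumptions listed in the context hold. Assume in addition that $\|\tilde g_i^t\|\le G_f$ and $\|\xi_{ij}^t\|^2\le\nu$ for all $i,j\in\mathcal V$ and all $t$. Let $\alpha_t=\frac1{\sqrt{t+1}}$ and $r_t=\frac1{t+1}$ for all $t\ge0$. For $\delta\in(0,1)$ set $$C_\delta=\max\{C_1+3C_6,\ 4C_4,\ \sqrt2C_2+2\sqrt2C_3+2\sqrt2C_5+2\sqrt2\,G_fD_{\mathcal X}N\sqrt{\log(1/\delta)}\},$$ where $C_1,\dots,C_6$ are the constants defined in the context. Then for every $l\in\mathcal V$, every integer $T\ge3$ and every $\delta\in(0,1)$, with probability at least $1-\delta$, the average $\hat x_l^T=\frac1T\sum_{t=1}^Tx_l^t$ satisfies $$F(\hat x_l^T)-F(x^* )\le\frac{3C_\delta}{\sqrt T}.$$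
   Context: Problem. $\mathcal V=\{1,\dots,N\}$ is a set of agents; $\mathcal X\subseteq\mathbb R^n$ is nonempty, convex and compact; $f_i,\chi_i:\mathbb R^n\to\mathbb R$ ($i\in\mathcal V$) are convex, possibly nonsmooth; $F_i=f_i+\chi_i$, $F=\sum_{i=1}^N F_i$. The problem is to minimize $F$ over $\mathcal X$; $\mathcal X^*$ is the set of minimizers and $x^*\in\mathcal X^*$. $\|\cdot\|$ is the Euclidean norm. $G_\chi=\max_{i\in\mathcal V}\sup\{\|g\|:g\in\partial\chi_i(x),\,x\in\mathcal X\}$. $D_{\mathcal X}=\sup_{x,y\in\mathcal X}\|x-y\|$. Mirror map. $\Phi:\mathbb R^n\to\mathbb R$ is continuously differentiable and $\sigma_\Phi$-strongly convex ($\sigma_\Phi>0$): $\Phi(x)\ge\Phi(y)+\langle\nabla\Phi(y),x-y\rangle+\frac{\sigma_\Phi}{2}\|x-y\|^2$. Its Bregman divergence is $D_\Phi(x,y)=\Phi(x)-\Phi(y)-\langle\nabla\Phi(y),x-y\rangle$, and $D_{\Phi,\mathcal X}^2=\sup_{x,y\in\mathcal X}D_\Phi(x,y)$ with $D_{\Phi,\mathcal X}\ge 0$. DSCMD-N. Starting from deterministic $x_i^0\in\mathcal X$, with stepsizes $\alpha_t>0$ and noise magnitudes $r_t>0$, for $t=0,1,2,\dots$ and $i\in\mathcal V$: $$y_i^t=\sum_{j=1}^N[P^t]_{ij}(x_j^t+r_t\xi_{ij}^t),\qquad x_i^{t+1}=\arg\min_{x\in\mathcal X}\Big\{\langle\tilde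 g_i^t,x\rangle+\frac1{\alpha_t}D_\Phi(x,y_i^t)+\chi_i(x)\Big\}.$$ Here $P^t$ is an $N\times N$ weight matrix, $\xi_{ij}^t$ is a random vector in $\mathbb R^n$, and $\tilde g_i^t=\tilde g_i(y_i^t)$ is a stochastic subgradient of $f_i$ queried at $y_i^t$. $\mathcal F_t$ is the $\sigma$-algebra of the history up to time $t$ ($\mathcal F_{-1}$ trivial); all processes are adapted, the noises and stochastic subgradients of time $t$ being $\mathcal F_t$-measurable. Network assumption. Each $P^t$ is doubly stochastic with nonnegative entries; $E^t=\{(i,j):[P^t]_{ij}>0\}$; there is an integer $B\ge1$ such that the graph $(\mathcal V,\bigcup_{t=sB+1}^{(s+1)B}E^t)$ is strongly connected for every $s\ge0$; there is $\theta\in(0,1)$ with $[P^t]_{ii}\ge\theta$ for all $i,t$ and $[P^t]_{ij}\ge\theta$ whenever $(j,i)\in E^t$. Stochastic-subgradient assumption. There is $G_f\ge0$ such that at any $x\in\mathcal X$, $\mathbb E[\tilde g_i(x)\mid\mathcal F_{t-1}]=g_i(x)\in\partial f_i(x)$ and $\mathbb E[\|\tilde g_i(x)\|^2\mid\mathcal F_{t-1}]\le G_f^2$; the same holds at the query points: conditionally on $\mathcal F_{t-1}$ and the time-$t$ noises, $\tilde g_i^t$ has mean $g_i(y_i^t)\in\partial f_i(y_i^t)$ and second moment (of the norm) at most $G_f^2$. Noise assumption. At each time $t$, the noise on link $(i,j)$ is independent of the noise on link $(i',j')$ for $i\ne i'$, $j\neq j'$; and $\mathbb E[\|\xi_{ij}^t\|^2\mid\mathcal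 F_{t-1}]\le\nu$ for all $i,j\in\mathcal V$ and $t$. Mirror-map assumption. $\|\nabla\Phi(x)-\nabla\Phi(y)\|\le L_\Phi\|x-y\|$ for all $x,y\in\mathbb R^n$; and $D_\Phi(a,\sum_{i=1}^N\nu_ib_i)\le\sum_{i=1}^N\nu_iD_\Phi(a,b_i)$ for all $a,b_1,\dots,b_N\in\mathbb R^n$ and $\nu_i\in[0,1]$ with $\sum_i\nu_i=1$. Constants. With $\omega=(1-\frac{\theta}{4N^2})^{-2}$ and $\gamma=(1-\frac{\theta}{4N^2})^{1/B}$: $C_1=\frac{2N\omega}{1-\gamma}[(N+1)G_f+NG_\chi]\sum_{j=1}^N\|x_j^0\|$; $C_2=ND_{\Phi,\mathcal X}^2$; $C_3=\big((4N+\frac{2N^2\omega}{1-\gamma})[(N+1)G_f+NG_\chi]+NG_\chi\big)\frac{G_f+G_\chi}{\sigma_\Phi}+\frac{NG_f^2}{2\sigma_\Phi}$; $C_4=(4N+\frac{2N^2\omega}{1-\gamma})[(N+1)G_f+NG_\chi]N\sqrt\nu+(G_f+G_\chi)N^2\sqrt\nu$; $C_5=\sqrt{2/\sigma_\Phi}\,D_{\Phi,\mathcal X}L_\Phi N\sqrt\nu$; $C_6=NL_\Phi\nu$. *)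

theory Defs
  imports "HOL-Probability.Probability" "Graph_Theory.Digraph_Component" "Graph_Theory.Pair_Digraph"
begin

section \<open>Subgradients and mirror maps\<close>

definition subdifferential :: "('b::real_inner \<Rightarrow> real) \<Rightarrow> 'b \<Rightarrow> 'b set" where
  "subdifferential f x = {g. \<forall>y. f y \<ge> f x + g \<bullet> (y - x)}"

text \<open>The agents form the finite type \<open>'v\<close>, so that \<open>N = CARD('v)\<close>.\<close>

definition subgradient_bound ::
  "(real^'n) set \<Rightarrow> ('v::finite \<Rightarrow> real^'n \<Rightarrow> real) \<Rightarrow> real" where
  "subgradient_bound X h =
     Max (range (\<lambda>i. Sup {norm g | g x. x \<in> X \<and> g \<in> subdifferential (h i) x}))"

definition bregman :: "('b::real_inner \<Rightarrow> real) \<Rightarrow> ('b \<Rightarrow> 'b) \<Rightarrow> 'b \<Rightarrow> 'b \<Rightarrow> real" where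
  "bregman \<Phi> grad x y = \<Phi> x - \<Phi> y - grad y \<bullet> (x - y)"

text \<open>The Bregman divergence is not squared, hence the root.\<close>

definition bregman_diameter ::
  "('b::real_inner \<Rightarrow> real) \<Rightarrow> ('b \<Rightarrow> 'b) \<Rightarrow> 'b set \<Rightarrow> real" where
  "bregman_diameter \<Phi> grad X = sqrt (Sup {bregman \<Phi> grad x y | x y. x \<in> X \<and> y \<in> X})"

definition mirror_map :: "('b::real_inner \<Rightarrow> real) \<Rightarrow> ('b \<Rightarrow> 'b) \<Rightarrow> real \<Rightarrow> bool" where
  "mirror_map \<Phi> grad \<sigma> \<longleftrightarrow>
     (\<forall>x. GDERIV \<Phi> x :> grad x) \<and> continuous_on UNIV grad \<and> \<sigma> > 0 \<and>
     (\<forall>x y. \<Phi> x \<ge> \<Phi> y + grad y \<bullet> (x - y) + \<sigma> / 2 * (norm (x - y))\<^sup>2)"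

definition mirror_map_assumption ::
  "(real^'n \<Rightarrow> real) \<Rightarrow> (real^'n \<Rightarrow> real^'n) \<Rightarrow> real \<Rightarrow> 'v::finite itself \<Rightarrow> bool" where
  "mirror_map_assumption \<Phi> grad L (_ :: 'v itself) \<longleftrightarrow>
     (\<forall>x y. norm (grad x - grad y) \<le> L * norm (x - y)) \<and>
     (\<forall>a (b :: 'v \<Rightarrow> real^'n) (w :: 'v \<Rightarrow> real).
        (\<forall>i. 0 \<le> w i \<and> w i \<le> 1) \<and> (\<Sum>i\<in>UNIV. w i) = 1 \<longrightarrow>
        bregman \<Phi> grad a (\<Sum>i\<in>UNIV. w i *\<^sub>R b i) \<le> (\<Sum>i\<in>UNIV. w i * bregman \<Phi> grad a (b i)))"

section \<open>Network\<close>

definition doubly_stochastic :: "real^'v^'v::finite \<Rightarrow> bool" where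
  "doubly_stochastic A \<longleftrightarrow>
     (\<forall>i j. A $ i $ j \<ge> 0) \<and> (\<forall>i. (\<Sum>j\<in>UNIV. A $ i $ j) = 1) \<and> (\<forall>j. (\<Sum>i\<in>UNIV. A $ i $ j) = 1)"

definition edges :: "real^'v^'v::finite \<Rightarrow> ('v \<times> 'v) set" where
  "edges A = {(i, j). A $ i $ j > 0}"

text \<open>The index order in the last conjunct is deliberate: the lower bound on \<open>P t $ i $ j\<close> is
  required when the reversed pair \<open>(j, i)\<close> is an edge.\<close>

definition network_assumption :: "(nat \<Rightarrow> real^'v^'v::finite) \<Rightarrow> nat \<Rightarrow> real \<Rightarrow> bool" where
  "network_assumption P B \<theta> \<longleftrightarrow>
     (\<forall>t. doubly_stochastic (P t)) \<and>
     B \<ge> 1 \<and>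
     (\<forall>s. strongly_connected
            (with_proj \<lparr>pverts = UNIV, parcs = (\<Union>t\<in>{s * B + 1..(s + 1) * B}. edges (P t))\<rparr>)) \<and>
     0 < \<theta> \<and> \<theta> < 1 \<and>
     (\<forall>t i. P t $ i $ i \<ge> \<theta>) \<and>
     (\<forall>t i j. (j, i) \<in> edges (P t) \<longrightarrow> P t $ i $ j \<ge> \<theta>)"

section \<open>Information structure\<close>

text \<open>\<open>past F \<Omega> t\<close> is the \<open>\<sigma>\<close>-algebra of time \<open>t - 1\<close>; it is trivial for \<open>t = 0\<close>.\<close>

definition past :: "(nat \<Rightarrow> 'w measure) \<Rightarrow> 'w set \<Rightarrow> nat \<Rightarrow> 'w measure" where
  "past F \<Omega> t = (case t of 0 \<Rightarrow> sigma \<Omega> {} | Suc s \<Rightarrow> F s)"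

text \<open>\<open>past_and_noise F \<xi> \<Omega> t\<close> is generated by \<open>past F \<Omega> t\<close> and the noises of time \<open>t\<close>.\<close>

definition past_and_noise ::
  "(nat \<Rightarrow> 'w measure) \<Rightarrow> ('v \<Rightarrow> 'v \<Rightarrow> nat \<Rightarrow> 'w \<Rightarrow> real^'n) \<Rightarrow> 'w set \<Rightarrow> nat \<Rightarrow> 'w measure" where
  "past_and_noise F \<xi> \<Omega> t =
     sigma \<Omega> (sets (past F \<Omega> t) \<union> {\<xi> i j t -` A \<inter> \<Omega> | i j A. A \<in> sets borel})"

text \<open>The stochastic subgradient of agent \<open>i\<close> at time \<open>t\<close> is a random field \<open>gt i t u\<close>
  in the query point \<open>u\<close>; the sample used by the method is its value at \<open>u = y i t\<close>.\<close>

definition sample ::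
  "('v \<Rightarrow> nat \<Rightarrow> 'b \<Rightarrow> 'w \<Rightarrow> 'b) \<Rightarrow> ('v \<Rightarrow> nat \<Rightarrow> 'w \<Rightarrow> 'b) \<Rightarrow> 'v \<Rightarrow> nat \<Rightarrow> 'w \<Rightarrow> 'b" where
  "sample gt y i t \<omega> = gt i t (y i t \<omega>) \<omega>"

definition information_structure ::
  "'w measure \<Rightarrow> (nat \<Rightarrow> 'w measure) \<Rightarrow> (real^'n) set \<Rightarrow>
   ('v \<Rightarrow> nat \<Rightarrow> real^'n \<Rightarrow> 'w \<Rightarrow> real^'n) \<Rightarrow> ('v \<Rightarrow> 'v \<Rightarrow> nat \<Rightarrow> 'w \<Rightarrow> real^'n) \<Rightarrow>
   ('v \<Rightarrow> nat \<Rightarrow> 'w \<Rightarrow> real^'n) \<Rightarrow> ('v \<Rightarrow> nat \<Rightarrow> 'w \<Rightarrow> real^'n) \<Rightarrow> bool" where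
  "information_structure M F X gt \<xi> x y \<longleftrightarrow>
     filtration (space M) F \<and> (\<forall>t. subalgebra M (F t)) \<and>
     (\<forall>i j t. \<xi> i j t \<in> borel_measurable (F t)) \<and>
     (\<forall>i t. \<forall>u\<in>X. gt i t u \<in> borel_measurable (F t)) \<and>
     (\<forall>i t. sample gt y i t \<in> borel_measurable (F t)) \<and>
     (\<forall>i t. x i t \<in> borel_measurable (F t)) \<and>
     (\<forall>i t. y i t \<in> borel_measurable (F t))"

text \<open>Vector-valued conditional expectations are taken componentwise. Second moments use the
  extended nonnegative conditional expectation, so that a bound entails square integrability.\<close>

definition stochastic_subgradient_assumption ::
  "'w measure \<Rightarrow> (nat \<Rightarrow> 'w measure) \<Rightarrow> (real^'n) set \<Rightarrow> ('v \<Rightarrow> real^'n \<Rightarrow> real) \<Rightarrow>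
   ('v \<Rightarrow> real^'n \<Rightarrow> real^'n) \<Rightarrow> ('v \<Rightarrow> nat \<Rightarrow> real^'n \<Rightarrow> 'w \<Rightarrow> real^'n) \<Rightarrow>
   ('v \<Rightarrow> 'v \<Rightarrow> nat \<Rightarrow> 'w \<Rightarrow> real^'n) \<Rightarrow> ('v \<Rightarrow> nat \<Rightarrow> 'w \<Rightarrow> real^'n) \<Rightarrow> real \<Rightarrow> bool" where
  "stochastic_subgradient_assumption M F X f g gt \<xi> y Gf \<longleftrightarrow>
     Gf \<ge> 0 \<and>
     (\<forall>i. \<forall>u\<in>X. g i u \<in> subdifferential (f i) u) \<and>
     (\<forall>i t. \<forall>u\<in>X. AE \<omega> in M.
        (\<forall>k. real_cond_exp M (past F (space M) t) (\<lambda>\<omega>. gt i t u \<omega> $ k) \<omega> = g i u $ k) \<and>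
        nn_cond_exp M (past F (space M) t) (\<lambda>\<omega>. ennreal ((norm (gt i t u \<omega>))\<^sup>2)) \<omega>
          \<le> ennreal (Gf\<^sup>2)) \<and>
     (\<forall>i t. AE \<omega> in M.
        g i (y i t \<omega>) \<in> subdifferential (f i) (y i t \<omega>) \<and>
        (\<forall>k. real_cond_exp M (past_and_noise F \<xi> (space M) t) (\<lambda>\<omega>. sample gt y i t \<omega> $ k) \<omega>
               = g i (y i t \<omega>) $ k) \<and>
        nn_cond_exp M (past_and_noise F \<xi> (space M) t)
            (\<lambda>\<omega>. ennreal ((norm (sample gt y i t \<omega>))\<^sup>2)) \<omega>
          \<le> ennreal (Gf\<^sup>2))"

definition noise_assumption ::
  "'w measure \<Rightarrow> (nat \<Rightarrow> 'w measure) \<Rightarrow> ('v \<Rightarrow> 'v \<Rightarrow> nat \<Rightarrow> 'w \<Rightarrow> real^'n) \<Rightarrow> real \<Rightarrow> bool" where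
  "noise_assumption M F \<xi> \<nu> \<longleftrightarrow>
     (\<forall>t i j i' j'. i \<noteq> i' \<and> j \<noteq> j' \<longrightarrow>
        prob_space.indep_var M borel (\<xi> i j t) borel (\<xi> i' j' t)) \<and>
     (\<forall>i j t. AE \<omega> in M.
        nn_cond_exp M (past F (space M) t) (\<lambda>\<omega>. ennreal ((norm (\<xi> i j t \<omega>))\<^sup>2)) \<omega> \<le> ennreal \<nu>)"

section \<open>The DSCMD-N iteration\<close>

definition dscmd_n ::
  "'w set \<Rightarrow> (real^'n) set \<Rightarrow> ('v::finite \<Rightarrow> real^'n \<Rightarrow> real) \<Rightarrow>
   (real^'n \<Rightarrow> real) \<Rightarrow> (real^'n \<Rightarrow> real^'n) \<Rightarrow> (nat \<Rightarrow> real^'v^'v) \<Rightarrow>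
   (nat \<Rightarrow> real) \<Rightarrow> (nat \<Rightarrow> real) \<Rightarrow>
   ('v \<Rightarrow> nat \<Rightarrow> real^'n \<Rightarrow> 'w \<Rightarrow> real^'n) \<Rightarrow> ('v \<Rightarrow> 'v \<Rightarrow> nat \<Rightarrow> 'w \<Rightarrow> real^'n) \<Rightarrow> ('v \<Rightarrow> real^'n) \<Rightarrow>
   ('v \<Rightarrow> nat \<Rightarrow> 'w \<Rightarrow> real^'n) \<Rightarrow> ('v \<Rightarrow> nat \<Rightarrow> 'w \<Rightarrow> real^'n) \<Rightarrow> bool" where
  "dscmd_n \<Omega> X chi \<Phi> grad P \<alpha> r gt \<xi> x0 x y \<longleftrightarrow>
     (\<forall>i. x0 i \<in> X) \<and>
     (\<forall>i. \<forall>\<omega>\<in>\<Omega>. x i 0 \<omega> = x0 i) \<and>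
     (\<forall>i t. \<forall>\<omega>\<in>\<Omega>. y i t \<omega> = (\<Sum>j\<in>UNIV. (P t $ i $ j) *\<^sub>R (x j t \<omega> + r t *\<^sub>R \<xi> i j t \<omega>))) \<and>
     (\<forall>i t. \<forall>\<omega>\<in>\<Omega>.
        is_arg_min
          (\<lambda>u. sample gt y i t \<omega> \<bullet> u + 1 / \<alpha> t * bregman \<Phi> grad u (y i t \<omega>) + chi i u)
          (\<lambda>u. u \<in> X)
          (x i (Suc t) \<omega>))"

definition objective :: "('v::finite \<Rightarrow> 'b \<Rightarrow> real) \<Rightarrow> ('v \<Rightarrow> 'b \<Rightarrow> real) \<Rightarrow> 'b \<Rightarrow> real" where
  "objective f chi u = (\<Sum>i\<in>UNIV. f i u + chi i u)"

definition time_average ::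
  "('v \<Rightarrow> nat \<Rightarrow> 'w \<Rightarrow> 'b::real_vector) \<Rightarrow> 'v \<Rightarrow> nat \<Rightarrow> 'w \<Rightarrow> 'b" where
  "time_average x l T \<omega> = (1 / real T) *\<^sub>R (\<Sum>t=1..T. x l t \<omega>)"

section \<open>Constants\<close>

definition omega_const :: "nat \<Rightarrow> real \<Rightarrow> real" where
  "omega_const N \<theta> = (1 - \<theta> / (4 * real N ^ 2)) powi (-2)"

definition gamma_const :: "nat \<Rightarrow> real \<Rightarrow> nat \<Rightarrow> real" where
  "gamma_const N \<theta> B = (1 - \<theta> / (4 * real N ^ 2)) powr (1 / real B)"

definition C1 :: "nat \<Rightarrow> real \<Rightarrow> nat \<Rightarrow> real \<Rightarrow> real \<Rightarrow> ('v::finite \<Rightarrow> 'b::real_normed_vector) \<Rightarrow> real" where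
  "C1 N \<theta> B Gf Gchi x0 =
     2 * real N * omega_const N \<theta> / (1 - gamma_const N \<theta> B)
       * ((real N + 1) * Gf + real N * Gchi) * (\<Sum>j\<in>UNIV. norm (x0 j))"

definition C2 :: "nat \<Rightarrow> real \<Rightarrow> real" where
  "C2 N D\<Phi> = real N * D\<Phi>\<^sup>2"

definition C3 :: "nat \<Rightarrow> real \<Rightarrow> nat \<Rightarrow> real \<Rightarrow> real \<Rightarrow> real \<Rightarrow> real" where
  "C3 N \<theta> B Gf Gchi \<sigma> =
     ((4 * real N + 2 * real N ^ 2 * omega_const N \<theta> / (1 - gamma_const N \<theta> B))
        * ((real N + 1) * Gf + real N * Gchi) + real N * Gchi) * ((Gf + Gchi) / \<sigma>)
     + real N * Gf\<^sup>2 / (2 * \<sigma>)"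

definition C4 :: "nat \<Rightarrow> real \<Rightarrow> nat \<Rightarrow> real \<Rightarrow> real \<Rightarrow> real \<Rightarrow> real" where
  "C4 N \<theta> B Gf Gchi \<nu> =
     (4 * real N + 2 * real N ^ 2 * omega_const N \<theta> / (1 - gamma_const N \<theta> B))
       * ((real N + 1) * Gf + real N * Gchi) * real N * sqrt \<nu>
     + (Gf + Gchi) * real N ^ 2 * sqrt \<nu>"

definition C5 :: "nat \<Rightarrow> real \<Rightarrow> real \<Rightarrow> real \<Rightarrow> real \<Rightarrow> real" where
  "C5 N D\<Phi> L \<sigma> \<nu> = sqrt (2 / \<sigma>) * D\<Phi> * L * real N * sqrt \<nu>"

definition C6 :: "nat \<Rightarrow> real \<Rightarrow> real \<Rightarrow> real" where
  "C6 N L \<nu> = real N * L * \<nu>"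

definition C_delta ::
  "nat \<Rightarrow> real \<Rightarrow> nat \<Rightarrow> real \<Rightarrow> real \<Rightarrow> real \<Rightarrow> real \<Rightarrow> real \<Rightarrow> real \<Rightarrow> real \<Rightarrow>
   ('v::finite \<Rightarrow> 'b::real_normed_vector) \<Rightarrow> real \<Rightarrow> real" where
  "C_delta N \<theta> B Gf Gchi \<sigma> L \<nu> D\<Phi> DX x0 \<delta> =
     Max {C1 N \<theta> B Gf Gchi x0 + 3 * C6 N L \<nu>,
          4 * C4 N \<theta> B Gf Gchi \<nu>,
          sqrt 2 * C2 N D\<Phi> + 2 * sqrt 2 * C3 N \<theta> B Gf Gchi \<sigma> + 2 * sqrt 2 * C5 N D\<Phi> L \<sigma> \<nu>
            + 2 * sqrt 2 * Gf * DX * real N * sqrt (ln (1 / \<delta>))}"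

end

theory Submission
  imports Defs
begin

text \<open>
  Everything but the martingale bound is pathwise. Comparing the step \<open>x i (Suc t)\<close> with the
  noise-free average \<open>p i t\<close> through the three-point identity gives a displacement of order
  \<open>\<alpha> t * G / \<sigma> + r t * sqrt (L * \<nu> / \<sigma>)\<close>, where \<open>G\<close> bounds the subgradients of \<open>f + chi\<close>;
  mixing then bounds the total disagreement of the agents, since the variation of the states
  contracts over each window of \<open>B\<close> mixing steps. The mirror-descent inequality with \<open>D u (y i t)\<close>
  compared to \<open>D u (x j t)\<close> controls the regret up to the martingale formed by
  \<open>E[sample] - sample\<close> paired with \<open>p i t - xstar\<close>, which is handled by Azuma's inequality.

  The constants contain no counterpart of the condition number \<open>L / \<sigma>\<close> in the disagreement caused
  by the noise. It is absorbed by a case distinction: if \<open>L * sqrt \<nu>\<close> is at least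
  \<open>G * sqrt T\<close>, then the Lipschitz bound for the objective on \<open>X\<close> is already below
  the \<open>C5\<close>-term; otherwise the arithmetic-geometric mean inequality splits the noise contribution
  between the \<open>C3\<close>- and the \<open>C4\<close>-term.
\<close>

section \<open>Subgradients of convex functions\<close>

text \<open>Two facts shape the argument. First, the query point \<open>y i t\<close> carries
  unprojected noise and may leave \<open>X\<close>. The sample error is therefore paired with
  \<open>p i t - xstar\<close>, where \<open>p i t\<close> lies in \<open>X\<close>: this vector is
  no longer than the diameter and is predictable once \<open>x i t\<close> is known to depend on the
  past alone. Second, \<open>Gf\<close> bounds samples, while the regret needs \<open>f\<close> to
  be \<open>Gf\<close>-Lipschitz on \<open>X\<close>; this comes from the mean subgradients
  \<open>g i u\<close>, whose norms are controlled by the second moment. The network constants arise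
  as follows. With \<open>q = \<theta> / (4 * N\<^sup>2)\<close>, a window multiplies the squared
  disagreement by at most \<open>1 - 2 * q\<close>, and
  \<open>1 - 2 * q \<le> (1 - q)\<^sup>2\<close> gives the factor \<open>\<beta> = 1 - q\<close> for
  its root. Summing over windows produces \<open>B * (2 - \<beta>) / (1 - \<beta>)\<close>, which
  the stated per-step factor \<omega> / (1 - \<gamma>) dominates because
  \<open>\<gamma> ^ B = \<beta>\<close> and \<omega> is the inverse square of \<beta>.\<close>

lemma subdifferential_nonempty:
  fixes f :: "'a::euclidean_space \<Rightarrow> real"
  assumes "convex_on UNIV f"
  obtains g where "g \<in> subdifferential f x"
proof -
  define S where "S = {z :: 'a \<times> real. f (fst z) < snd z}"
  have "convex S"
  proof (rule convexI)
    fix a b :: "'a \<times> real" and u v :: real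
    assume ab: "a \<in> S" "b \<in> S" and uv: "0 \<le> u" "0 \<le> v" "u + v = 1"
    have le: "f (u *\<^sub>R fst a + v *\<^sub>R fst b) \<le> u * f (fst a) + v * f (fst b)"
      using assms uv unfolding convex_on_def by auto
    have "u * f (fst a) + v * f (fst b) < u * snd a + v * snd b"
    proof (cases "u = 0")
      case False
      then show ?thesis using ab uv unfolding S_def
        by (intro add_less_le_mono mult_strict_left_mono mult_left_mono) auto
    qed (use ab uv in \<open>auto simp: S_def\<close>)
    with le show "u *\<^sub>R a + v *\<^sub>R b \<in> S"
      unfolding S_def by auto
  qed
  moreover have "S \<noteq> {}"
    unfolding S_def by (auto intro!: exI[of _ 0] exI[of _ "f 0 + 1"])
  moreover have "S \<inter> {(x, f x)} = {}"
    unfolding S_def by auto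
  ultimately obtain a b where ab: "a \<noteq> 0" "\<forall>z\<in>{(x, f x)}. inner a z \<le> b" "\<forall>z\<in>S. inner a z \<ge> b"
    using separating_hyperplane_sets[of "{(x, f x)}" S] by auto
  obtain v c where a: "a = (v, c)" by (cases a)
  have sep: "v \<bullet> x + c * f x \<le> v \<bullet> y + c * s" if "f y < s" for y s
    using ab(2,3) that unfolding S_def a by (auto simp: inner_prod_def) (smt (verit) fst_conv snd_conv)
  have c0: "c \<ge> 0"
    using sep[of x "f x + 1"] by (simp add: algebra_simps)
  \<comment> \<open>A vertical hyperplane is impossible because \<open>f\<close> is finite
    everywhere: with \<open>c = 0\<close>, testing at \<open>x - v\<close> would give
    \<open>v \<bullet> v \<le> 0\<close>, hence \<open>v = 0\<close>.\<close>
  have "c \<noteq> 0"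
  proof
    assume "c = 0"
    have "v \<bullet> v \<le> 0"
      using sep[of "x - v" "f (x - v) + 1"] \<open>c = 0\<close> by (simp add: inner_diff_right)
    then have "v = 0" using inner_gt_zero_iff[of v] by linarith
    with \<open>c = 0\<close> ab(1) a show False by (simp add: zero_prod_def)
  qed
  with c0 have c: "c > 0" by simp
  have "f y \<ge> f x + (- (1 / c)) *\<^sub>R v \<bullet> (y - x)" for y
  proof -
    have "v \<bullet> x + c * f x \<le> v \<bullet> y + c * f y + e" if "e > 0" for e
      using sep[of y "f y + e / c"] that c by (simp add: algebra_simps)
    then have "v \<bullet> x + c * f x \<le> v \<bullet> y + c * f y" by (rule field_le_epsilon)
    moreover have "c * (f x + (- (1 / c)) *\<^sub>R v \<bullet> (y - x)) = c * f x - v \<bullet> (y - x)"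
      using c by (simp add: algebra_simps)
    ultimately have "c * (f x + (- (1 / c)) *\<^sub>R v \<bullet> (y - x)) \<le> c * f y"
      by (simp add: inner_diff_right)
    then show ?thesis using c by (simp only: mult_le_cancel_left_pos)
  qed
  then show thesis
    by (intro that[of "(- (1 / c)) *\<^sub>R v"]) (simp only: subdifferential_def mem_Collect_eq, blast)
qed

lemma convex_on_UNIV_continuous:
  fixes f :: "'a::euclidean_space \<Rightarrow> real"
  assumes "convex_on UNIV f"
  shows "continuous_on S f"
  using convex_on_continuous[OF open_UNIV assms] continuous_on_subset by blast

text \<open>Test \<open>g\<close> at \<open>x + sgn g\<close>: the subgradient inequality reads
  \<open>norm g \<le> f (x + sgn g) - f x\<close>, and both points lie in the compact unit
  neighbourhood \<open>K\<close> of \<open>X\<close>, where \<open>f\<close> is bounded. This makes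
  the suprema in \<open>subgradient_bound\<close> genuine upper bounds.\<close>

lemma subgradient_norms_bdd_above:
  fixes f :: "'a::euclidean_space \<Rightarrow> real"
  assumes "convex_on UNIV f" "compact X"
  shows "bdd_above {norm g | g x. x \<in> X \<and> g \<in> subdifferential f x}"
proof -
  define K where "K = {x + y | x y. x \<in> X \<and> y \<in> cball 0 1}"
  have "compact K"
    unfolding K_def using assms(2) by (intro compact_sums) auto
  then have "bounded (f ` K)"
    by (intro compact_imp_bounded compact_continuous_image convex_on_UNIV_continuous assms)
  then obtain b where b: "\<And>z. z \<in> K \<Longrightarrow> \<bar>f z\<bar> \<le> b"
    unfolding bounded_iff by auto
  have "norm g \<le> 2 * b" if "x \<in> X" "g \<in> subdifferential f x" for g x
  proof -
    have "x \<in> K" "x + sgn g \<in> K"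
      unfolding K_def using that(1) by (force simp: norm_sgn)+
    moreover have "f (x + sgn g) \<ge> f x + g \<bullet> sgn g"
      using that(2) unfolding subdifferential_def by (auto dest: spec[of _ "x + sgn g"])
    moreover have "g \<bullet> sgn g = norm g"
      by (cases "g = 0") (simp_all add: sgn_div_norm power2_norm_eq_inner[symmetric] power2_eq_square)
    ultimately show ?thesis using b[of x] b[of "x + sgn g"] by linarith
  qed
  then show ?thesis unfolding bdd_above_def by blast
qed

text \<open>The subgradient is taken at \<open>x\<close>, so only \<open>x\<close> has to lie in
  \<open>X\<close>; the estimate is one-sided and \<open>z\<close> is free.\<close>

lemma subgradient_bound_Lipschitz:
  fixes h :: "'v::finite \<Rightarrow> real^'n \<Rightarrow> real"
  assumes "\<And>i. convex_on UNIV (h i)" "compact X" "x \<in> X"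
  shows "h i x - h i z \<le> subgradient_bound X h * norm (x - z)"
    and "0 \<le> subgradient_bound X h"
proof -
  obtain g where g: "g \<in> subdifferential (h i) x"
    using subdifferential_nonempty assms(1) by blast
  have "norm g \<le> Sup {norm g | g x. x \<in> X \<and> g \<in> subdifferential (h i) x}"
    by (intro cSup_upper subgradient_norms_bdd_above assms) (use g assms in auto)
  also have "\<dots> \<le> subgradient_bound X h"
    unfolding subgradient_bound_def by (intro Max_ge) auto
  finally have le: "norm g \<le> subgradient_bound X h" .
  then show "0 \<le> subgradient_bound X h" using norm_ge_zero order_trans by blast
  have "h i x - h i z \<le> g \<bullet> (x - z)"
    using g unfolding subdifferential_def by (auto simp: inner_diff_right dest: spec[of _ z])
  also have "\<dots> \<le> norm g * norm (x - z)" by (rule norm_cauchy_schwarz)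
  also have "\<dots> \<le> subgradient_bound X h * norm (x - z)" by (intro mult_right_mono le) auto
  finally show "h i x - h i z \<le> subgradient_bound X h * norm (x - z)" .
qed

section \<open>Mirror maps and proximal steps\<close>

locale smooth_mirror_map =
  fixes \<Phi> :: "'a::euclidean_space \<Rightarrow> real" and grad :: "'a \<Rightarrow> 'a" and \<sigma> L :: real
  assumes mirror: "mirror_map \<Phi> grad \<sigma>"
    and grad_Lipschitz: "norm (grad x - grad y) \<le> L * norm (x - y)"
begin

abbreviation "D \<equiv> bregman \<Phi> grad"

lemma sigma_pos: "\<sigma> > 0"
  using mirror unfolding mirror_map_def by simp

lemma strongly_convex: "\<Phi> y + grad y \<bullet> (x - y) + \<sigma> / 2 * (norm (x - y))\<^sup>2 \<le> \<Phi> x"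
  using mirror unfolding mirror_map_def by simp

lemma bregman_lower: "\<sigma> / 2 * (norm (x - y))\<^sup>2 \<le> D x y"
  using strongly_convex[of y x] unfolding bregman_def by simp

lemma bregman_nonneg: "0 \<le> D x y"
  using bregman_lower[of x y] sigma_pos by (smt (verit) half_gt_zero mult_nonneg_nonneg zero_le_power2)

lemma inner_grad_diff_le: "(grad x - grad y) \<bullet> z \<le> L * norm (x - y) * norm z"
  by (rule order_trans[OF norm_cauchy_schwarz mult_right_mono[OF grad_Lipschitz norm_ge_zero]])

text \<open>Adding \<open>0 \<le> D y x\<close> turns \<open>D x y\<close> into the symmetrised
  divergence \<open>(grad x - grad y) \<bullet> (x - y)\<close>, so no integration along the segment
  is needed. The price is \<open>L\<close> in place of \<open>L / 2\<close>, and \<open>L\<close> is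
  the factor that \<open>C6\<close> carries.\<close>

lemma bregman_upper: "D x y \<le> L * (norm (x - y))\<^sup>2"
proof -
  have "\<Phi> x - \<Phi> y \<le> grad x \<bullet> (x - y)"
    using bregman_nonneg[of y x] unfolding bregman_def by (simp add: inner_diff_right)
  then have "D x y \<le> (grad x - grad y) \<bullet> (x - y)"
    unfolding bregman_def by (simp add: inner_diff_left)
  also have "\<dots> \<le> L * (norm (x - y))\<^sup>2"
    using inner_grad_diff_le[of x y "x - y"] by (simp add: power2_eq_square mult.assoc)
  finally show ?thesis .
qed

lemma three_point: "(grad b - grad z) \<bullet> (z - u) = D u b - D u z - D z b"
  unfolding bregman_def by (simp add: algebra_simps inner_diff_left inner_diff_right)

lemma grad_strongly_monotone: "\<sigma> * (norm (x - y))\<^sup>2 \<le> (grad x - grad y) \<bullet> (x - y)"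
  using bregman_lower[of x y] bregman_lower[of y x] unfolding bregman_def
  by (simp add: algebra_simps inner_diff_left inner_diff_right norm_minus_commute)

lemma sigma_le_L: "\<sigma> \<le> L"
proof -
  obtain b :: 'a where b: "b \<in> Basis" using nonempty_Basis by blast
  have "\<sigma> * (norm (b - 0))\<^sup>2 \<le> L * norm (b - 0) * norm (b - 0)"
    using grad_strongly_monotone[of b 0] inner_grad_diff_le[of b 0 "b - 0"] by linarith
  then show ?thesis using b by simp
qed

text \<open>The three-point identity at base \<open>x\<close> leaves a term linear in
  \<open>w\<close> and the remainder \<open>D x (x + w)\<close>. Summed over the agents, the first
  becomes \<open>C5\<close> and the second \<open>C6\<close>.\<close>

lemma bregman_perturb: "D u (x + w) \<le> D u x + L * norm w * norm (x - u) + L * (norm w)\<^sup>2"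
  using three_point[of "x + w" x u] inner_grad_diff_le[of "x + w" x "x - u"] bregman_upper[of x "x + w"]
  by simp

lemma continuous_Phi: "continuous_on S \<Phi>"
proof (rule continuous_at_imp_continuous_on, rule ballI)
  fix x
  have "GDERIV \<Phi> x :> grad x" using mirror unfolding mirror_map_def by simp
  then show "isCont \<Phi> x" unfolding gderiv_def by (rule has_derivative_continuous)
qed

lemma continuous_grad: "continuous_on S grad"
  using mirror continuous_on_subset unfolding mirror_map_def by blast

lemma bregman_diameter_bound:
  assumes "compact X" "x \<in> X" "y \<in> X"
  shows "D x y \<le> (bregman_diameter \<Phi> grad X)\<^sup>2" and "0 \<le> bregman_diameter \<Phi> grad X"
proof -
  have eq: "{D x y | x y. x \<in> X \<and> y \<in> X} = (\<lambda>z. D (fst z) (snd z)) ` (X \<times> X)" by force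
  have "compact ((\<lambda>z. D (fst z) (snd z)) ` (X \<times> X))"
    unfolding bregman_def
    by (intro compact_continuous_image compact_Times assms continuous_intros
        continuous_on_compose2[OF continuous_Phi[of UNIV]] continuous_on_compose2[OF continuous_grad[of UNIV]]) auto
  then have "bdd_above {D x y | x y. x \<in> X \<and> y \<in> X}"
    unfolding eq by (intro bounded_imp_bdd_above compact_imp_bounded)
  then have "D x y \<le> Sup {D x y | x y. x \<in> X \<and> y \<in> X}"
    using assms by (intro cSup_upper) auto
  moreover from this have "0 \<le> Sup {D x y | x y. x \<in> X \<and> y \<in> X}"
    using bregman_nonneg order_trans by blast
  ultimately show "D x y \<le> (bregman_diameter \<Phi> grad X)\<^sup>2" "0 \<le> bregman_diameter \<Phi> grad X"
    unfolding bregman_diameter_def by simp_all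
qed

lemma norm_le_bregman_diameter:
  assumes "compact X" "x \<in> X" "y \<in> X"
  shows "norm (x - y) \<le> sqrt (2 / \<sigma>) * bregman_diameter \<Phi> grad X"
proof -
  have "(norm (x - y))\<^sup>2 \<le> 2 / \<sigma> * (bregman_diameter \<Phi> grad X)\<^sup>2"
    using bregman_lower[of x y] bregman_diameter_bound(1)[OF assms] sigma_pos by (simp add: field_simps)
  then have "norm (x - y) \<le> sqrt (2 / \<sigma> * (bregman_diameter \<Phi> grad X)\<^sup>2)"
    by (rule real_le_rsqrt)
  then show ?thesis
    using bregman_diameter_bound(2)[OF assms] by (simp only: real_sqrt_mult real_sqrt_abs abs_of_nonneg)
qed

section \<open>Proximal steps: optimality, displacement, stability and measurability\<close>

definition is_prox_step :: "'a set \<Rightarrow> ('a \<Rightarrow> real) \<Rightarrow> real \<Rightarrow> 'a \<Rightarrow> 'a \<Rightarrow> 'a \<Rightarrow> bool" where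
  "is_prox_step X chi \<alpha> a b z \<longleftrightarrow>
     is_arg_min (\<lambda>u. a \<bullet> u + 1 / \<alpha> * D u b + chi u) (\<lambda>u. u \<in> X) z"

context
  fixes X :: "'a set" and chi :: "'a \<Rightarrow> real" and \<alpha> :: real
  assumes X: "convex X" "compact X" and chi: "convex_on UNIV chi" and alpha: "\<alpha> > 0"
begin

text \<open>The first-order condition without subdifferential calculus: along the segment from
  \<open>z\<close> to \<open>u\<close>, \<open>chi\<close> is bounded by convexity and
  \<open>D v z\<close> is of second order in the step, so minimality divided by the step length
  yields the inequality in the limit.\<close>

lemma prox_optimality:
  assumes "is_prox_step X chi \<alpha> a b z" "u \<in> X"
  shows "\<alpha> * (a \<bullet> (z - u) + chi z - chi u) \<le> D u b - D u z - D z b"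
proof -
  define d where "d = u - z"
  define K where "K = L * (norm d)\<^sup>2 / \<alpha>"
  define c where "c = a \<bullet> d + (grad z - grad b) \<bullet> d / \<alpha> + chi u - chi z"
  have K: "K \<ge> 0"
    unfolding K_def using sigma_le_L sigma_pos alpha by (intro divide_nonneg_pos mult_nonneg_nonneg) auto
  have zX: "z \<in> X" and min: "\<And>v. v \<in> X \<Longrightarrow>
      a \<bullet> z + 1 / \<alpha> * D z b + chi z \<le> a \<bullet> v + 1 / \<alpha> * D v b + chi v"
    using assms(1) unfolding is_prox_step_def is_arg_min_linorder by auto
  have le: "0 \<le> c + \<tau> * K" if \<tau>: "0 < \<tau>" "\<tau> \<le> 1" for \<tau>
  proof -
    define v where "v = z + \<tau> *\<^sub>R d"
    have v: "v = (1 - \<tau>) *\<^sub>R z + \<tau> *\<^sub>R u" unfolding v_def d_def by (simp add: algebra_simps)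
    have vX: "v \<in> X" unfolding v using X(1) zX assms(2) \<tau> by (intro convexD) auto
    have "chi v \<le> (1 - \<tau>) * chi z + \<tau> * chi u"
      unfolding v using chi \<tau> unfolding convex_on_def by auto
    moreover have "D v b - D z b = D v z + (grad z - grad b) \<bullet> (v - z)"
      using three_point[of b z v] by (simp add: algebra_simps inner_diff_left inner_diff_right)
    moreover have "D v z \<le> \<tau>\<^sup>2 * (L * (norm d)\<^sup>2)"
      using bregman_upper[of v z] unfolding v_def by (simp add: power_mult_distrib mult_ac)
    ultimately have "0 \<le> \<tau> * (a \<bullet> d) + 1 / \<alpha> * (\<tau>\<^sup>2 * (L * (norm d)\<^sup>2) + \<tau> * ((grad z - grad b) \<bullet> d))
        + \<tau> * (chi u - chi z)"
    proof -
      assume A: "chi v \<le> (1 - \<tau>) * chi z + \<tau> * chi u"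
        "D v b - D z b = D v z + (grad z - grad b) \<bullet> (v - z)" "D v z \<le> \<tau>\<^sup>2 * (L * (norm d)\<^sup>2)"
      have "1 / \<alpha> * (D v b - D z b) \<le> 1 / \<alpha> * (\<tau>\<^sup>2 * (L * (norm d)\<^sup>2) + \<tau> * ((grad z - grad b) \<bullet> d))"
        using A alpha by (intro mult_left_mono) (auto simp: v_def)
      moreover have "a \<bullet> v = a \<bullet> z + \<tau> * (a \<bullet> d)" unfolding v_def by (simp add: inner_add_right)
      ultimately show ?thesis using min[OF vX] A(1) by (simp add: algebra_simps)
    qed
    also have "\<dots> = \<tau> * (c + \<tau> * K)"
      unfolding c_def K_def using alpha by (simp add: field_simps power2_eq_square)
    finally show ?thesis using \<tau> by (simp add: zero_le_mult_iff)
  qed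
  have "c \<ge> 0"
  proof (rule ccontr)
    assume "\<not> c \<ge> 0"
    \<comment> \<open>Small enough that \<open>\<tau> * K \<le> - c / 2\<close>, so that
      \<open>c + \<tau> * K\<close> stays negative; \<open>K + 1\<close> guards against
      \<open>K = 0\<close>.\<close>
    define \<tau> where "\<tau> = min 1 (- c / (2 * (K + 1)))"
    have \<tau>: "0 < \<tau>" "\<tau> \<le> 1" unfolding \<tau>_def using K \<open>\<not> c \<ge> 0\<close> by (auto simp: field_simps)
    have "\<tau> * K \<le> - c / (2 * (K + 1)) * (K + 1)"
      unfolding \<tau>_def using K \<open>\<not> c \<ge> 0\<close> by (intro mult_mono) (auto simp: field_simps)
    also have "\<dots> = - c / 2" using K by (simp add: field_simps)
    finally show False using le[OF \<tau>] \<open>\<not> c \<ge> 0\<close> by simp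
  qed
  then have "0 \<le> \<alpha> * c" using alpha by simp
  also have "\<dots> = \<alpha> * (a \<bullet> d + chi u - chi z) + (grad z - grad b) \<bullet> d"
    unfolding c_def using alpha by (simp add: field_simps)
  also have "(grad z - grad b) \<bullet> d = (grad b - grad z) \<bullet> (z - u)"
    unfolding d_def by (simp add: inner_diff_left inner_diff_right)
  finally show ?thesis
    unfolding three_point d_def by (simp add: algebra_simps inner_diff_right)
qed

text \<open>Optimality speaks of \<open>z\<close>, the regret of the base point \<open>b\<close>.
  The difference \<open>a \<bullet> (b - z)\<close> is absorbed by the spare \<open>- D z b\<close>
  through Young's inequality, which leaves the term quadratic in \<open>norm a\<close>.\<close>

lemma prox_regret:
  assumes "is_prox_step X chi \<alpha> a b z" "u \<in> X"
  shows "a \<bullet> (b - u) + chi z - chi u \<le> 1 / \<alpha> * (D u b - D u z) + \<alpha> * (norm a)\<^sup>2 / (2 * \<sigma>)"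
proof -
  have "\<alpha> * (a \<bullet> (b - z)) \<le> \<alpha> * norm a * norm (z - b)"
    using norm_cauchy_schwarz[of a "b - z"] alpha by (simp add: norm_minus_commute mult.assoc)
  moreover have "\<alpha> * norm a * norm (z - b) \<le> \<sigma> / 2 * (norm (z - b))\<^sup>2 + (\<alpha> * norm a)\<^sup>2 / (2 * \<sigma>)"
    using sum_squares_ge_zero[of "\<sigma> * norm (z - b) - \<alpha> * norm a" 0] sigma_pos
    by (simp add: field_simps power2_eq_square)
  ultimately have "\<alpha> * (a \<bullet> (b - z)) - D z b \<le> (\<alpha> * norm a)\<^sup>2 / (2 * \<sigma>)"
    using bregman_lower[of z b] by linarith
  with prox_optimality[OF assms]
  have "\<alpha> * (a \<bullet> (b - u) + chi z - chi u) \<le> D u b - D u z + (\<alpha> * norm a)\<^sup>2 / (2 * \<sigma>)"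
    by (simp add: algebra_simps inner_diff_right)
  then show ?thesis using alpha sigma_pos by (simp add: field_simps power2_eq_square)
qed

text \<open>Comparing with \<open>p\<close> through the three-point identity keeps the dependence on \<open>norm (b - p)\<close> at
  the square root of the condition number \<open>L / \<sigma>\<close>; strong monotonicity alone would give \<open>L / \<sigma>\<close>.\<close>

lemma prox_displacement:
  assumes "is_prox_step X chi \<alpha> a b z" "p \<in> X" "norm a \<le> Gf"
    and chi_Lip: "chi p - chi z \<le> Gc * norm (p - z)" and G0: "0 \<le> Gf + Gc"
  shows "norm (z - p) \<le> 2 * \<alpha> * (Gf + Gc) / \<sigma> + sqrt (2 * L / \<sigma>) * norm (b - p)"
proof -
  define e where "e = norm (z - p)"
  define w where "w = norm (b - p)"
  define q where "q = \<alpha> * (Gf + Gc) / \<sigma>"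
  have q0: "q \<ge> 0" unfolding q_def using G0 alpha sigma_pos by simp
  have "- (a \<bullet> (z - p)) \<le> Gf * e"
    using norm_cauchy_schwarz[of a "p - z"] mult_right_mono[OF assms(3), of e]
    unfolding e_def by (simp add: norm_minus_commute inner_diff_right)
  then have "- (\<alpha> * (Gf + Gc) * e) \<le> \<alpha> * (a \<bullet> (z - p) + chi z - chi p)"
  proof -
    assume A: "- (a \<bullet> (z - p)) \<le> Gf * e"
    have "- ((Gf + Gc) * e) \<le> a \<bullet> (z - p) + chi z - chi p"
      using A chi_Lip unfolding e_def by (simp add: algebra_simps norm_minus_commute)
    from mult_left_mono[OF this, of \<alpha>] alpha show ?thesis by (simp add: mult_ac)
  qed
  also have "\<dots> \<le> D p b - D p z - D z b" by (rule prox_optimality[OF assms(1,2)])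
  finally have "D p z \<le> D p b + \<alpha> * (Gf + Gc) * e" using bregman_nonneg[of z b] by simp
  then have "\<sigma> / 2 * e\<^sup>2 \<le> L * w\<^sup>2 + \<alpha> * (Gf + Gc) * e"
    using bregman_lower[of p z] bregman_upper[of p b] unfolding e_def w_def
    by (simp add: norm_minus_commute)
  then have "e\<^sup>2 \<le> 2 * L / \<sigma> * w\<^sup>2 + 2 * q * e"
    unfolding q_def using sigma_pos by (simp add: field_simps)
  \<comment> \<open>Complete the square in \<open>e\<close>; on the right the nonnegative cross term
    is added to obtain a full square.\<close>
  then have "(e - q)\<^sup>2 \<le> (q + sqrt (2 * L / \<sigma>) * w)\<^sup>2"
  proof -
    assume A: "e\<^sup>2 \<le> 2 * L / \<sigma> * w\<^sup>2 + 2 * q * e"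
    have L: "2 * L / \<sigma> \<ge> 0" using sigma_le_L sigma_pos by simp
    have "0 \<le> q * (sqrt (2 * L / \<sigma>) * w)" using q0 L unfolding w_def by simp
    moreover have "(sqrt (2 * L / \<sigma>) * w)\<^sup>2 = 2 * L / \<sigma> * w\<^sup>2" using L by (simp add: power_mult_distrib)
    ultimately show ?thesis using A unfolding power2_diff power2_sum by (simp add: mult_ac)
  qed
  then have "e - q \<le> q + sqrt (2 * L / \<sigma>) * w"
    by (rule power2_le_imp_le) (use q0 sigma_le_L sigma_pos in \<open>simp add: w_def\<close>)
  then show ?thesis unfolding e_def w_def q_def by simp
qed

text \<open>Each minimiser is tested in the optimality condition of the other, so \<open>chi\<close>
  cancels and strong monotonicity of \<open>grad\<close> gives the bound. In particular equal inputs
  have equal minimisers, the uniqueness on which measurability rests.\<close>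

lemma prox_Lipschitz:
  assumes "is_prox_step X chi \<alpha> a b z" "is_prox_step X chi \<alpha> a' b' z'"
  shows "\<sigma> * norm (z - z') \<le> \<alpha> * norm (a - a') + L * norm (b - b')"
proof -
  have "z \<in> X" "z' \<in> X"
    using assms unfolding is_prox_step_def is_arg_min_linorder by auto
  then have "\<alpha> * ((a - a') \<bullet> (z - z')) \<le> (grad b - grad z) \<bullet> (z - z') + (grad b' - grad z') \<bullet> (z' - z)"
    using prox_optimality[OF assms(1), of z'] prox_optimality[OF assms(2), of z]
    unfolding three_point by (simp add: algebra_simps inner_diff_left inner_diff_right)
  also have "\<dots> = (grad b - grad b') \<bullet> (z - z') - (grad z - grad z') \<bullet> (z - z')"
    by (simp add: algebra_simps inner_diff_left inner_diff_right)
  finally have "\<sigma> * (norm (z - z'))\<^sup>2 \<le> L * norm (b - b') * norm (z - z') + \<alpha> * ((a' - a) \<bullet> (z - z'))"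
    using grad_strongly_monotone[of z z'] inner_grad_diff_le[of b b' "z - z'"]
    by (simp add: algebra_simps inner_diff_left)
  also have "\<alpha> * ((a' - a) \<bullet> (z - z')) \<le> \<alpha> * (norm (a - a') * norm (z - z'))"
    using norm_cauchy_schwarz[of "a' - a" "z - z'"] alpha by (simp add: norm_minus_commute)
  finally have "norm (z - z') * (\<sigma> * norm (z - z')) \<le> norm (z - z') * (\<alpha> * norm (a - a') + L * norm (b - b'))"
    by (simp add: algebra_simps power2_eq_square)
  moreover have "0 \<le> \<alpha> * norm (a - a') + L * norm (b - b')"
    using alpha sigma_le_L sigma_pos by simp
  ultimately show ?thesis by (cases "z = z'") auto
qed

lemma prox_exists:
  assumes "X \<noteq> {}"
  obtains z where "is_prox_step X chi \<alpha> a b z"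
proof -
  have "continuous_on X (\<lambda>u. a \<bullet> u + 1 / \<alpha> * D u b + chi u)"
    unfolding bregman_def using alpha
    by (intro continuous_intros continuous_Phi convex_on_UNIV_continuous chi) auto
  from continuous_attains_inf[OF X(2) assms this] show thesis
    using that unfolding is_prox_step_def is_arg_min_linorder by blast
qed

text \<open>A proximal step is a Lipschitz function of its two inputs, hence measurable for whatever
  \<sigma>-algebra makes these measurable. This later places the state of time \<open>t + 1\<close>
  in the \<sigma>-algebra of time \<open>t\<close>, one step earlier than adaptedness does.\<close>

lemma prox_measurable:
  assumes "X \<noteq> {}" and meas: "a \<in> borel_measurable N" "b \<in> borel_measurable N"
    and prox: "\<And>\<omega>. \<omega> \<in> space N \<Longrightarrow> is_prox_step X chi \<alpha> (a \<omega>) (b \<omega>) (z \<omega>)"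
  shows "z \<in> borel_measurable N"
proof -
  define h where "h q = (SOME z. is_prox_step X chi \<alpha> (fst q) (snd q) z)" for q
  have h: "is_prox_step X chi \<alpha> (fst q) (snd q) (h q)" for q
    unfolding h_def using prox_exists[OF assms(1)] by (metis someI_ex)
  have "(1 / \<sigma> * (\<alpha> + L))-lipschitz_on UNIV h"
  proof (rule lipschitz_onI)
    fix q q' :: "'a \<times> 'a"
    have "norm (fst q - fst q') \<le> norm (q - q')" "norm (snd q - snd q') \<le> norm (q - q')"
      by (metis fst_diff norm_fst_le prod.collapse, metis snd_diff norm_snd_le prod.collapse)
    then have "\<alpha> * norm (fst q - fst q') \<le> \<alpha> * norm (q - q')" "L * norm (snd q - snd q') \<le> L * norm (q - q')"
      using alpha sigma_le_L sigma_pos by (auto intro!: mult_left_mono)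
    then have "\<sigma> * norm (h q - h q') \<le> \<alpha> * norm (q - q') + L * norm (q - q')"
      using prox_Lipschitz[OF h h, of q q'] by linarith
    then show "dist (h q) (h q') \<le> 1 / \<sigma> * (\<alpha> + L) * dist q q'"
      using sigma_pos by (simp add: dist_norm field_simps)
  qed (use alpha sigma_le_L sigma_pos in auto)
  then have "continuous_on UNIV h" by (rule lipschitz_on_continuous_on)
  then have "h \<in> borel_measurable (borel \<Otimes>\<^sub>M borel)"
    unfolding borel_prod by (rule borel_measurable_continuous_onI)
  with meas have "(\<lambda>\<omega>. h (a \<omega>, b \<omega>)) \<in> borel_measurable N" by measurable
  moreover have "z \<omega> = h (a \<omega>, b \<omega>)" if "\<omega> \<in> space N" for \<omega>
    using prox_Lipschitz[OF prox[OF that] h[of "(a \<omega>, b \<omega>)", unfolded fst_conv snd_conv]] sigma_pos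
    by (simp add: mult_le_0_iff)
  ultimately show ?thesis using measurable_cong[of N z "\<lambda>\<omega>. h (a \<omega>, b \<omega>)" borel] by simp
qed

end

end

section \<open>Consensus over the network\<close>

definition mean :: "('v::finite \<Rightarrow> 'b::real_vector) \<Rightarrow> 'b" where
  "mean z = (1 / real CARD('v)) *\<^sub>R (\<Sum>i\<in>UNIV. z i)"

definition variation :: "('v::finite \<Rightarrow> real) \<Rightarrow> real" where
  "variation z = (\<Sum>i\<in>UNIV. (z i - mean z)\<^sup>2)"

definition mix :: "real^'v^'v::finite \<Rightarrow> ('v \<Rightarrow> 'b::real_vector) \<Rightarrow> 'v \<Rightarrow> 'b" where
  "mix A z i = (\<Sum>j\<in>UNIV. (A $ i $ j) *\<^sub>R z j)"

definition row_variance :: "real^'v^'v::finite \<Rightarrow> ('v \<Rightarrow> real) \<Rightarrow> 'v \<Rightarrow> real" where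
  "row_variance A z k = (\<Sum>i\<in>UNIV. A $ k $ i * (z i - mix A z k)\<^sup>2)"

lemma mean_sum: "real CARD('v) *\<^sub>R mean z = (\<Sum>i\<in>UNIV. z i)" for z :: "'v::finite \<Rightarrow> 'b::real_vector"
  unfolding mean_def by simp

lemma sum_mix:
  assumes "doubly_stochastic A"
  shows "(\<Sum>i\<in>UNIV. mix A z i) = (\<Sum>i\<in>UNIV. z i)"
proof -
  have "(\<Sum>i\<in>UNIV. mix A z i) = (\<Sum>j\<in>UNIV. (\<Sum>i\<in>UNIV. A $ i $ j) *\<^sub>R z j)"
    unfolding mix_def by (subst sum.swap) (simp add: scaleR_sum_left)
  then show ?thesis using assms unfolding doubly_stochastic_def by simp
qed

lemma mean_mix: "doubly_stochastic A \<Longrightarrow> mean (mix A z) = mean z"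
  unfolding mean_def by (simp add: sum_mix)

lemma variation_eq: "variation z = (\<Sum>i\<in>UNIV. (z i)\<^sup>2) - real CARD('v) * (mean z)\<^sup>2"
  for z :: "'v::finite \<Rightarrow> real"
proof -
  have "variation z = (\<Sum>i\<in>UNIV. (z i)\<^sup>2) - 2 * mean z * (\<Sum>i\<in>UNIV. z i) + real CARD('v) * (mean z)\<^sup>2"
  proof -
    have "(\<Sum>i\<in>UNIV. 2 * z i * mean z) = 2 * mean z * (\<Sum>i\<in>UNIV. z i)"
      by (subst sum_distrib_left) (simp add: mult_ac)
    then show ?thesis unfolding variation_def power2_diff by (simp add: sum.distrib sum_subtractf)
  qed
  also have "(\<Sum>i\<in>UNIV. z i) = real CARD('v) * mean z" using mean_sum[of z] by simp
  finally show ?thesis by (simp add: power2_eq_square algebra_simps)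
qed

text \<open>The law of total variance: unit column sums preserve the sum of squares, and each row is
  a probability vector, so what mixing removes is exactly the variance within the rows.\<close>

lemma variation_mix:
  fixes z :: "'v::finite \<Rightarrow> real"
  assumes A: "doubly_stochastic A"
  shows "variation z - variation (mix A z) = (\<Sum>k\<in>UNIV. row_variance A z k)"
proof -
  have rv: "row_variance A z k = (\<Sum>i\<in>UNIV. A $ k $ i * (z i)\<^sup>2) - (mix A z k)\<^sup>2" for k
  proof -
    have "row_variance A z k = (\<Sum>i\<in>UNIV. A $ k $ i * (z i)\<^sup>2)
        - 2 * mix A z k * (\<Sum>i\<in>UNIV. A $ k $ i * z i) + (\<Sum>i\<in>UNIV. A $ k $ i) * (mix A z k)\<^sup>2"
      unfolding row_variance_def power2_diff
      by (simp add: sum.distrib sum_subtractf sum_distrib_left sum_distrib_right algebra_simps)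
    also have "(\<Sum>i\<in>UNIV. A $ k $ i) = 1" using A unfolding doubly_stochastic_def by simp
    also have "(\<Sum>i\<in>UNIV. A $ k $ i * z i) = mix A z k" unfolding mix_def by simp
    finally show ?thesis by (simp add: power2_eq_square)
  qed
  have "(\<Sum>k\<in>UNIV. \<Sum>i\<in>UNIV. A $ k $ i * (z i)\<^sup>2) = (\<Sum>i\<in>UNIV. (z i)\<^sup>2)"
    using sum_mix[OF A, of "\<lambda>i. (z i)\<^sup>2"] unfolding mix_def by simp
  then show ?thesis
    unfolding rv variation_eq mean_mix[OF A] by (simp add: sum_subtractf)
qed

lemma row_variance_nonneg: "doubly_stochastic A \<Longrightarrow> 0 \<le> row_variance A z k"
  unfolding row_variance_def doubly_stochastic_def by (auto intro!: sum_nonneg)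

section \<open>Contraction of one coordinate over a window\<close>

lemma row_variance_lower:
  assumes A: "doubly_stochastic A" and th: "A $ k $ i \<ge> \<theta>" "A $ k $ j \<ge> \<theta>" "\<theta> > 0"
  shows "\<theta> * (z i - z j)\<^sup>2 \<le> 2 * row_variance A z k"
proof (cases "i = j")
  case True
  then show ?thesis using row_variance_nonneg[OF A, of z k] by simp
next
  case False
  let ?m = "mix A z k"
  have "0 \<le> (z i - ?m + (z j - ?m))\<^sup>2" by simp
  then have "(z i - z j)\<^sup>2 \<le> 2 * ((z i - ?m)\<^sup>2 + (z j - ?m)\<^sup>2)"
    by (simp add: power2_eq_square algebra_simps)
  from mult_left_mono[OF this, of \<theta>] th(3)
  have "\<theta> * (z i - z j)\<^sup>2 \<le> 2 * (\<theta> * (z i - ?m)\<^sup>2 + \<theta> * (z j - ?m)\<^sup>2)"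
    by (simp add: algebra_simps)
  also have "\<dots> \<le> 2 * (A $ k $ i * (z i - ?m)\<^sup>2 + A $ k $ j * (z j - ?m)\<^sup>2)"
    using th by (intro mult_left_mono add_mono mult_right_mono) auto
  also have "A $ k $ i * (z i - ?m)\<^sup>2 + A $ k $ j * (z j - ?m)\<^sup>2 = (\<Sum>l\<in>{i, j}. A $ k $ l * (z l - ?m)\<^sup>2)"
    using False by simp
  also have "\<dots> \<le> row_variance A z k"
    unfolding row_variance_def using A unfolding doubly_stochastic_def by (intro sum_mono2) auto
  finally show ?thesis by simp
qed

text \<open>Ordered intervals without overlap are packed by removing the last one and lowering
  \<open>hi\<close> to its left end. This lets one row variance pay for all the gaps that are
  charged to it at once.\<close>

lemma sum_interval_lengths_le:
  fixes a b :: "nat \<Rightarrow> real"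
  assumes "finite C" "lo \<le> hi" "\<And>i. i \<in> C \<Longrightarrow> lo \<le> a i" "\<And>i. i \<in> C \<Longrightarrow> b i \<le> hi"
    and "\<And>i j. i \<in> C \<Longrightarrow> j \<in> C \<Longrightarrow> i < j \<Longrightarrow> b i \<le> a j"
  shows "(\<Sum>i\<in>C. b i - a i) \<le> hi - lo"
  using assms
proof (induction C arbitrary: hi rule: finite_linorder_max_induct)
  case (insert m C)
  have "(\<Sum>i\<in>C. b i - a i) \<le> a m - lo"
    using insert by (intro insert.IH) auto
  moreover have "b m \<le> hi" using insert by simp
  moreover have "m \<notin> C" using insert.hyps by auto
  ultimately show ?case using insert.hyps(1) by simp
qed simp

lemma sum_squares_le_square_sum:
  fixes f :: "'c \<Rightarrow> real"
  assumes "finite C" "\<And>i. i \<in> C \<Longrightarrow> 0 \<le> f i"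
  shows "(\<Sum>i\<in>C. (f i)\<^sup>2) \<le> (\<Sum>i\<in>C. f i)\<^sup>2"
  using assms
proof (induction C)
  case (insert x C)
  have "0 \<le> f x * (\<Sum>i\<in>C. f i)" using insert by (intro mult_nonneg_nonneg sum_nonneg) auto
  then show ?case using insert by (simp add: power2_sum)
qed simp

lemma mix_ge:
  fixes z :: "'v::finite \<Rightarrow> real"
  assumes A: "doubly_stochastic A" and "\<And>j. A $ k $ j > 0 \<Longrightarrow> c \<le> z j"
  shows "c \<le> mix A z k"
proof -
  have "c = (\<Sum>j\<in>UNIV. A $ k $ j * c)"
    using A unfolding doubly_stochastic_def by (simp add: sum_distrib_right[symmetric])
  also have "\<dots> \<le> (\<Sum>j\<in>UNIV. A $ k $ j * z j)"
  proof (rule sum_mono)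
    fix j
    have "0 \<le> A $ k $ j" using A unfolding doubly_stochastic_def by simp
    then show "A $ k $ j * c \<le> A $ k $ j * z j"
      using assms(2)[of j] by (cases "A $ k $ j = 0") (auto intro!: mult_left_mono)
  qed
  finally show ?thesis unfolding mix_def by simp
qed

lemma mix_le:
  fixes z :: "'v::finite \<Rightarrow> real"
  assumes A: "doubly_stochastic A" and "\<And>j. A $ k $ j > 0 \<Longrightarrow> z j \<le> c"
  shows "mix A z k \<le> c"
  using mix_ge[OF A, of k "- c" "\<lambda>j. - z j"] assms(2) unfolding mix_def by (simp add: sum_negf)

text \<open>Sort the initial values and cut the agents at each gap. Until the first time at which an edge
  crosses a cut, the two sides evolve separately and the gap stays open, so at that time the row
  variance of an agent next to the cut pays for the square of the gap.\<close>

lemma gap_squares_le: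
  fixes z :: "nat \<Rightarrow> 'v::finite \<Rightarrow> real"
  assumes A: "\<And>t. t < B \<Longrightarrow> doubly_stochastic (A t)" and th: "0 < \<theta>"
    and diag: "\<And>t i. t < B \<Longrightarrow> A t $ i $ i \<ge> \<theta>"
    and pos: "\<And>t i j. t < B \<Longrightarrow> A t $ i $ j > 0 \<Longrightarrow> A t $ i $ j \<ge> \<theta>"
    and cut: "\<And>S. S \<noteq> {} \<Longrightarrow> S \<noteq> UNIV \<Longrightarrow> \<exists>t<B. \<exists>i j. A t $ i $ j > 0 \<and> (i \<in> S) \<noteq> (j \<in> S)"
    and z: "\<And>t. t < B \<Longrightarrow> z (Suc t) = mix (A t) (z t)"
    and a: "\<And>d. d < n \<Longrightarrow> a d \<le> a (Suc d)" "\<And>d. d \<le> n \<Longrightarrow> a d \<in> range (z 0)"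
    and gap: "\<And>d i. d < n \<Longrightarrow> z 0 i \<le> a d \<or> a (Suc d) \<le> z 0 i" "\<And>d. d < n \<Longrightarrow> a d < a (Suc d)"
  shows "\<theta> * (\<Sum>d<n. (a (Suc d) - a d)\<^sup>2) \<le> 2 * (variation (z 0) - variation (z B))"
proof -
  define S where "S d = {i. z 0 i > a d}" for d
  define cross where "cross d t \<longleftrightarrow> (\<exists>i j. A t $ i $ j > 0 \<and> (i \<in> S d) \<noteq> (j \<in> S d))" for d t
  have S: "i \<in> S d \<longleftrightarrow> a (Suc d) \<le> z 0 i" if "d < n" for d i
    using gap(1)[OF that, of i] gap(2)[OF that] unfolding S_def by auto
  have ex: "\<exists>t. t < B \<and> cross d t" if "d < n" for d
  proof -
    obtain i j where "a d = z 0 i" "a (Suc d) = z 0 j"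
      using a(2)[of d] a(2)[of "Suc d"] \<open>d < n\<close> by (auto simp: image_iff)
    then have "S d \<noteq> {}" "S d \<noteq> UNIV" using gap(2)[OF that] unfolding S_def by auto
    from cut[OF this] show ?thesis unfolding cross_def by blast
  qed
  define \<tau> where "\<tau> d = (LEAST t. t < B \<and> cross d t)" for d
  have \<tau>: "\<tau> d < B" "cross d (\<tau> d)" if "d < n" for d
    using LeastI_ex[OF ex[OF that]] unfolding \<tau>_def by auto
  have before: "\<not> cross d t" if "d < n" "t < \<tau> d" for d t
    using not_less_Least[of t "\<lambda>t. t < B \<and> cross d t"] that \<tau>(1)[OF that(1)] unfolding \<tau>_def by auto
  \<comment> \<open>The values at time \<open>\<tau> d\<close> result from steps before the first
    crossing, so the gap is still open at the crossing time itself, where it is used.\<close>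
  have sep: "(i \<in> S d \<longrightarrow> a (Suc d) \<le> z t i) \<and> (i \<notin> S d \<longrightarrow> z t i \<le> a d)" if "d < n" "t \<le> \<tau> d" for d t i
    using that(2)
  proof (induction t arbitrary: i)
    case 0
    have "z 0 i \<le> a d" if "i \<notin> S d" using that unfolding S_def by simp
    then show ?case using S[OF that(1), of i] by blast
  next
    case (Suc t)
    then have t: "t < \<tau> d" and tB: "t < B" using \<tau>(1)[OF that(1)] by auto
    have nc: "j \<in> S d \<longleftrightarrow> i \<in> S d" if "A t $ i $ j > 0" for j
      using before[OF \<open>d < n\<close> t] that unfolding cross_def by blast
    have IH: "(j \<in> S d \<longrightarrow> a (Suc d) \<le> z t j) \<and> (j \<notin> S d \<longrightarrow> z t j \<le> a d)" for j
      using Suc.IH t by simp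
    have "a (Suc d) \<le> mix (A t) (z t) i" if "i \<in> S d"
      by (rule mix_ge[OF A[OF tB]]) (use IH nc that in blast)
    moreover have "mix (A t) (z t) i \<le> a d" if "i \<notin> S d"
      by (rule mix_le[OF A[OF tB]]) (use IH nc that in blast)
    ultimately show ?case unfolding z[OF tB] by simp
  qed
  have "\<exists>k i. A (\<tau> d) $ k $ i > 0 \<and> (k \<in> S d) \<noteq> (i \<in> S d)" if "d < n" for d
    using \<tau>(2)[OF that] unfolding cross_def by blast
  then obtain \<kappa> where \<kappa>: "\<And>d. d < n \<Longrightarrow> \<exists>i. A (\<tau> d) $ (\<kappa> d) $ i > 0 \<and> (\<kappa> d \<in> S d) \<noteq> (i \<in> S d)"
    by metis
  \<comment> \<open>Several gaps may be crossed first at the same time \<open>t\<close> in the same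
    row \<open>k\<close>. They are disjoint and all lie within the range of the values that row
    \<open>k\<close> averages, so their squares sum to at most the squared range. Its two extremes
    carry weight at least \<theta> in the row, so a single row variance covers the whole
    cell.\<close>
  have cell: "\<theta> * (\<Sum>d\<in>{d \<in> {..<n}. (\<tau> d, \<kappa> d) = tk}. (a (Suc d) - a d)\<^sup>2)
      \<le> 2 * row_variance (A (fst tk)) (z (fst tk)) (snd tk)" if tk: "tk \<in> {..<B} \<times> UNIV" for tk
  proof -
    obtain t k where [simp]: "tk = (t, k)" and tB: "t < B" using tk by auto
    let ?C = "{d \<in> {..<n}. (\<tau> d, \<kappa> d) = tk}"
    let ?V = "z t ` {i. A t $ k $ i > 0}"
    have k: "A t $ k $ k > 0" using diag[OF tB, of k] th by simp
    then have V: "finite ?V" "?V \<noteq> {}" by auto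
    have lohi: "Min ?V \<le> a d" "a (Suc d) \<le> Max ?V" if "d \<in> ?C" for d
    proof -
      have d: "d < n" "\<tau> d = t" "\<kappa> d = k" using that by auto
      obtain i where i: "A t $ k $ i > 0" "(k \<in> S d) \<noteq> (i \<in> S d)" using \<kappa>[OF d(1)] d by auto
      from i(2) obtain u v where uv: "u \<in> {k, i}" "v \<in> {k, i}" "u \<in> S d" "v \<notin> S d" by blast
      then have "Min ?V \<le> z t v" "z t u \<le> Max ?V" using i(1) k V(1) by auto
      moreover have "a (Suc d) \<le> z t u" "z t v \<le> a d" using sep[OF d(1), of t] d(2) uv by auto
      ultimately show "Min ?V \<le> a d" "a (Suc d) \<le> Max ?V" by auto
    qed
    have mono: "a (Suc d) \<le> a e" if "d < e" "e \<le> n" for d e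
      using that
    proof (induction e)
      case (Suc e)
      then show ?case using a(1)[of e] by (cases "d = e") auto
    qed simp
    have "(\<Sum>d\<in>?C. (a (Suc d) - a d)\<^sup>2) \<le> (\<Sum>d\<in>?C. a (Suc d) - a d)\<^sup>2"
      by (rule sum_squares_le_square_sum) (use a(1) in auto)
    also have "\<dots> \<le> (Max ?V - Min ?V)\<^sup>2"
    proof (rule power_mono)
      show "(\<Sum>d\<in>?C. a (Suc d) - a d) \<le> Max ?V - Min ?V"
        by (rule sum_interval_lengths_le) (use V lohi mono in auto)
    qed (use a(1) in \<open>auto intro!: sum_nonneg\<close>)
    finally have *: "(\<Sum>d\<in>?C. (a (Suc d) - a d)\<^sup>2) \<le> (Max ?V - Min ?V)\<^sup>2" .
    obtain i j where ij: "A t $ k $ i > 0" "z t i = Max ?V" "A t $ k $ j > 0" "z t j = Min ?V"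
      using Max_in[OF V] Min_in[OF V] by (auto simp: image_iff)
    have **: "\<theta> * (Max ?V - Min ?V)\<^sup>2 \<le> 2 * row_variance (A t) (z t) k"
      using row_variance_lower[OF A[OF tB] pos[OF tB ij(1)] pos[OF tB ij(3)] th, of "z t"] ij by simp
    show ?thesis using order_trans[OF mult_left_mono[OF *, of \<theta>] **] th by simp
  qed
  have "(\<Sum>d<n. (a (Suc d) - a d)\<^sup>2)
      = (\<Sum>tk\<in>{..<B} \<times> UNIV. \<Sum>d\<in>{d \<in> {..<n}. (\<tau> d, \<kappa> d) = tk}. (a (Suc d) - a d)\<^sup>2)"
    by (rule sum.group[symmetric]) (use \<tau>(1) in auto)
  then have "\<theta> * (\<Sum>d<n. (a (Suc d) - a d)\<^sup>2)
      \<le> (\<Sum>tk\<in>{..<B} \<times> UNIV. 2 * row_variance (A (fst tk)) (z (fst tk)) (snd tk))"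
    using cell by (simp add: sum_distrib_left sum_mono)
  also have "\<dots> = 2 * (\<Sum>t<B. \<Sum>k\<in>UNIV. row_variance (A t) (z t) k)"
    by (simp add: sum.cartesian_product sum_distrib_left case_prod_beta)
  also have "(\<Sum>t<B. \<Sum>k\<in>UNIV. row_variance (A t) (z t) k) = (\<Sum>t<B. variation (z t) - variation (z (Suc t)))"
    by (intro sum.cong refl) (simp add: z variation_mix[OF A])
  also have "\<dots> = variation (z 0) - variation (z B)"
    by (rule sum_lessThan_telescope')
  finally show ?thesis .
qed

lemma variation_le_range:
  fixes z :: "'v::finite \<Rightarrow> real"
  assumes "\<And>i. lo \<le> z i" "\<And>i. z i \<le> hi"
  shows "variation z \<le> real CARD('v) * (hi - lo)\<^sup>2"
proof -
  have "real CARD('v) * lo \<le> (\<Sum>i\<in>UNIV. z i)" "(\<Sum>i\<in>UNIV. z i) \<le> real CARD('v) * hi"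
    using sum_bounded_below[of UNIV lo z] sum_bounded_above[of UNIV z hi] assms by auto
  then have "lo \<le> mean z" "mean z \<le> hi" unfolding mean_def by (simp_all add: field_simps)
  then have "(z i - mean z)\<^sup>2 \<le> (hi - lo)\<^sup>2" for i
    using assms[of i] by (intro power2_le_iff_abs_le[THEN iffD2]) (auto simp: abs_le_iff)
  then show ?thesis
    unfolding variation_def using sum_bounded_above[of UNIV "\<lambda>i. (z i - mean z)\<^sup>2" "(hi - lo)\<^sup>2"] by simp
qed

text \<open>One factor \<open>N\<close> comes from bounding the variation by the squared range, the
  other from Cauchy-Schwarz over at most \<open>N\<close> gaps between sorted values; the 2 is that
  of \<open>gap_squares_le\<close>.\<close>

lemma variation_window_contraction:
  fixes z :: "nat \<Rightarrow> 'v::finite \<Rightarrow> real"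
  assumes A: "\<And>t. t < B \<Longrightarrow> doubly_stochastic (A t)" and th: "0 < \<theta>"
    and diag: "\<And>t i. t < B \<Longrightarrow> A t $ i $ i \<ge> \<theta>"
    and pos: "\<And>t i j. t < B \<Longrightarrow> A t $ i $ j > 0 \<Longrightarrow> A t $ i $ j \<ge> \<theta>"
    and cut: "\<And>S. S \<noteq> {} \<Longrightarrow> S \<noteq> UNIV \<Longrightarrow> \<exists>t<B. \<exists>i j. A t $ i $ j > 0 \<and> (i \<in> S) \<noteq> (j \<in> S)"
    and z: "\<And>t. t < B \<Longrightarrow> z (Suc t) = mix (A t) (z t)"
  shows "variation (z B) \<le> (1 - \<theta> / (2 * (real CARD('v))\<^sup>2)) * variation (z 0)"
proof -
  define N where "N = real CARD('v)"
  have N: "N > 0" unfolding N_def by simp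
  define xs where "xs = sorted_list_of_set (range (z 0))"
  define n where "n = length xs - 1"
  have xs: "set xs = range (z 0)" "sorted xs" "distinct xs" unfolding xs_def by auto
  then have ne: "xs \<noteq> []" by auto
  have len: "length xs = card (range (z 0))" using xs distinct_card by metis
  then have nN: "real n \<le> N" unfolding n_def N_def using card_image_le[of UNIV "z 0"] by simp
  have sn: "Suc n = length xs" unfolding n_def using ne by simp
  have less: "xs ! d < xs ! e" if "d < e" "e \<le> n" for d e
  proof -
    have "xs ! d \<le> xs ! e" by (rule sorted_nth_mono) (use that xs(2) sn in auto)
    moreover have "xs ! d \<noteq> xs ! e" using that xs(3) sn by (simp add: nth_eq_iff_index_eq)
    ultimately show ?thesis by simp
  qed
  have ran: "xs ! d \<in> range (z 0)" if "d \<le> n" for d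
    using that xs(1) sn nth_mem[of d xs] by auto
  have idx: "\<exists>e\<le>n. z 0 i = xs ! e" for i
    using xs(1) sn by (metis in_set_conv_nth less_Suc_eq_le rangeI)
  have gap: "z 0 i \<le> xs ! d \<or> xs ! Suc d \<le> z 0 i" if "d < n" for d i
  proof -
    obtain e where e: "e \<le> n" "z 0 i = xs ! e" using idx by blast
    have "e < d \<or> e = d \<or> e = Suc d \<or> Suc d < e" by linarith
    then show ?thesis using less[of e d] less[of "Suc d" e] e that by fastforce
  qed
  have "\<theta> * (\<Sum>d<n. (xs ! Suc d - xs ! d)\<^sup>2) \<le> 2 * (variation (z 0) - variation (z B))"
    by (rule gap_squares_le[where A = A]) (use A th diag pos cut z gap less ran in \<open>auto simp: less_imp_le\<close>)
  moreover have "(xs ! n - xs ! 0)\<^sup>2 \<le> N * (\<Sum>d<n. (xs ! Suc d - xs ! d)\<^sup>2)"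
  proof -
    have "xs ! n - xs ! 0 = (\<Sum>d<n. xs ! Suc d - xs ! d)" by (simp add: sum_lessThan_telescope)
    also have "\<dots>\<^sup>2 \<le> (\<Sum>d<n. (xs ! Suc d - xs ! d)\<^sup>2) * real (card {..<n})"
      by (rule sum_squared_le_sum_of_squares)
    also have "\<dots> \<le> (\<Sum>d<n. (xs ! Suc d - xs ! d)\<^sup>2) * N"
      using nN by (intro mult_left_mono sum_nonneg) auto
    finally show ?thesis by (simp add: mult.commute)
  qed
  moreover have "variation (z 0) \<le> N * (xs ! n - xs ! 0)\<^sup>2"
    unfolding N_def
  proof (rule variation_le_range)
    fix i
    obtain e where e: "e \<le> n" "z 0 i = xs ! e" using idx by blast
    show "xs ! 0 \<le> z 0 i" "z 0 i \<le> xs ! n"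
      using e less[of 0 e] less[of e n] by (cases "e = 0"; cases "e = n"; force)+
  qed
  ultimately have *: "\<theta> * variation (z 0) \<le> N * N * (2 * (variation (z 0) - variation (z B)))"
  proof -
    assume h: "\<theta> * (\<Sum>d<n. (xs ! Suc d - xs ! d)\<^sup>2) \<le> 2 * (variation (z 0) - variation (z B))"
      "(xs ! n - xs ! 0)\<^sup>2 \<le> N * (\<Sum>d<n. (xs ! Suc d - xs ! d)\<^sup>2)"
      "variation (z 0) \<le> N * (xs ! n - xs ! 0)\<^sup>2"
    have "variation (z 0) \<le> N * (N * (\<Sum>d<n. (xs ! Suc d - xs ! d)\<^sup>2))"
      using order_trans[OF h(3) mult_left_mono[OF h(2)]] N by simp
    then have "\<theta> * variation (z 0) \<le> N * N * (\<theta> * (\<Sum>d<n. (xs ! Suc d - xs ! d)\<^sup>2))"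
      using mult_left_mono[of "variation (z 0)" _ \<theta>] th by (simp add: mult_ac)
    also have "\<dots> \<le> N * N * (2 * (variation (z 0) - variation (z B)))"
      using h(1) N by (intro mult_left_mono) auto
    finally show ?thesis .
  qed
  then show ?thesis
    unfolding N_def[symmetric] using N by (simp add: field_simps power2_eq_square)
qed

section \<open>Vector-valued states and perturbed mixing\<close>

definition deviation :: "('v::finite \<Rightarrow> real^'n) \<Rightarrow> real" where
  "deviation Z = L2_set (\<lambda>i. norm (Z i - mean Z)) UNIV"

lemma deviation_nonneg: "0 \<le> deviation Z"
  unfolding deviation_def by (rule L2_set_nonneg)

lemma deviation_power2: "(deviation Z)\<^sup>2 = (\<Sum>k\<in>UNIV. variation (\<lambda>i. Z i $ k))"
proof -
  have "(deviation Z)\<^sup>2 = (\<Sum>i\<in>UNIV. (norm (Z i - mean Z))\<^sup>2)"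
    unfolding deviation_def L2_set_def by (simp add: sum_nonneg)
  also have "\<dots> = (\<Sum>i\<in>UNIV. \<Sum>k\<in>UNIV. (Z i $ k - mean Z $ k)\<^sup>2)"
    unfolding norm_vec_def L2_set_def by (simp add: sum_nonneg)
  also have "\<dots> = (\<Sum>k\<in>UNIV. \<Sum>i\<in>UNIV. (Z i $ k - mean Z $ k)\<^sup>2)"
    by (rule sum.swap)
  also have "\<dots> = (\<Sum>k\<in>UNIV. variation (\<lambda>i. Z i $ k))"
    unfolding variation_def mean_def by simp
  finally show ?thesis .
qed

lemma norm_diff_mean_le_deviation: "norm (Z i - mean Z) \<le> deviation Z"
  unfolding deviation_def by (rule member_le_L2_set) auto

lemma deviation_le_sum_norm: "deviation Z \<le> (\<Sum>i\<in>UNIV. norm (Z i))"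
proof -
  have "(deviation Z)\<^sup>2 \<le> (\<Sum>k\<in>UNIV. \<Sum>i\<in>UNIV. (Z i $ k)\<^sup>2)"
    unfolding deviation_power2 by (rule sum_mono) (simp add: variation_eq)
  also have "\<dots> = (L2_set (\<lambda>i. norm (Z i)) UNIV)\<^sup>2"
    unfolding norm_vec_def L2_set_def by (subst sum.swap) (simp add: sum_nonneg)
  finally have "deviation Z \<le> L2_set (\<lambda>i. norm (Z i)) UNIV"
    by (rule power2_le_imp_le) (rule L2_set_nonneg)
  also have "\<dots> \<le> (\<Sum>i\<in>UNIV. norm (Z i))" by (rule L2_set_le_sum) auto
  finally show ?thesis .
qed

lemma deviation_triangle: "deviation (\<lambda>i. Z i + E i) \<le> deviation Z + deviation E"
proof -
  have m: "mean (\<lambda>i. Z i + E i) = mean Z + mean E"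
    unfolding mean_def by (simp add: sum.distrib scaleR_add_right)
  have "deviation (\<lambda>i. Z i + E i) \<le> L2_set (\<lambda>i. norm (Z i - mean Z) + norm (E i - mean E)) UNIV"
    unfolding deviation_def m
    by (rule L2_set_mono) (auto intro: order_trans[OF _ norm_triangle_ineq] simp: add_diff_add)
  also have "\<dots> \<le> deviation Z + deviation E"
    unfolding deviation_def by (rule L2_set_triangle_ineq)
  finally show ?thesis .
qed

lemma mix_component: "mix A Z i $ k = mix A (\<lambda>i. Z i $ k) i"
  unfolding mix_def by simp

lemma deviation_mix_le:
  assumes "doubly_stochastic A"
  shows "deviation (mix A Z) \<le> deviation Z"
proof (rule power2_le_imp_le)
  have "variation (mix A z) \<le> variation z" for z
    using variation_mix[OF assms, of z] sum_nonneg[of UNIV "row_variance A z"]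
      row_variance_nonneg[OF assms] by simp
  then show "(deviation (mix A Z))\<^sup>2 \<le> (deviation Z)\<^sup>2"
    unfolding deviation_power2 mix_component by (rule sum_mono)
qed (rule deviation_nonneg)

text \<open>The factor through which \<open>C1\<close>, \<open>C3\<close> and \<open>C4\<close>
  depend on the connectivity of the network.\<close>

definition mixing_const :: "nat \<Rightarrow> real \<Rightarrow> nat \<Rightarrow> real" where
  "mixing_const N \<theta> B = omega_const N \<theta> / (1 - gamma_const N \<theta> B)"

locale mixing_network =
  fixes P :: "nat \<Rightarrow> real^'v^'v::finite" and B :: nat and \<theta> :: real
  assumes net: "network_assumption P B \<theta>"
begin

definition "\<beta> = 1 - \<theta> / (4 * (real CARD('v))\<^sup>2)"

lemma P_stochastic: "doubly_stochastic (P t)"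
  and B_ge_1: "B \<ge> 1" and theta: "0 < \<theta>" "\<theta> < 1"
  and P_diag: "\<theta> \<le> P t $ i $ i"
  using net unfolding network_assumption_def by auto

lemma P_nonneg: "0 \<le> P t $ i $ j" and P_row: "(\<Sum>j\<in>UNIV. P t $ i $ j) = 1"
  and P_col: "(\<Sum>i\<in>UNIV. P t $ i $ j) = 1"
  using P_stochastic[of t] unfolding doubly_stochastic_def by auto

lemma P_le_1: "P t $ i $ j \<le> 1"
  using member_le_sum[of j UNIV "\<lambda>j. P t $ i $ j"] P_nonneg P_row[of t i] by simp

text \<open>The assumption bounds the entry of the reversed pair, so it is applied twice: a positive
  entry at \<open>(i, j)\<close> forces one at \<open>(j, i)\<close>, and this in turn bounds the
  entry at \<open>(i, j)\<close>.\<close>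

lemma P_positive: "P t $ i $ j > 0 \<Longrightarrow> \<theta> \<le> P t $ i $ j"
proof -
  assume "P t $ i $ j > 0"
  then have "\<theta> \<le> P t $ j $ i" using net unfolding network_assumption_def edges_def by auto
  then have "P t $ j $ i > 0" using theta by simp
  then show ?thesis using net unfolding network_assumption_def edges_def by auto
qed

text \<open>A path from inside \<open>S\<close> to outside must leave \<open>S\<close> along some
  edge of the window. Windows start at \<open>s * B + 1\<close>, so time 0 belongs to none of them
  and its step is treated as merely nonexpansive.\<close>

lemma window_cut:
  assumes "S \<noteq> {}" "S \<noteq> UNIV"
  shows "\<exists>t<B. \<exists>i j. P (s * B + 1 + t) $ i $ j > 0 \<and> (i \<in> S) \<noteq> (j \<in> S)"
proof -
  define Es where "Es = (\<Union>t\<in>{s * B + 1..(s + 1) * B}. edges (P t))"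
  have "strongly_connected (with_proj \<lparr>pverts = UNIV, parcs = Es\<rparr>)"
    using net unfolding network_assumption_def Es_def by blast
  moreover obtain u v where uv: "u \<in> S" "v \<notin> S" using assms by auto
  ultimately have "(u, v) \<in> rtrancl_on UNIV Es"
    unfolding strongly_connected_def reachable_def by (simp add: arcs_ends_conv)
  then have "v \<notin> S \<longrightarrow> (\<exists>i j. (i, j) \<in> Es \<and> i \<in> S \<and> j \<notin> S)"
    by (induction rule: rtrancl_on_induct) (use uv(1) in blast)+
  then obtain i j t where ij: "i \<in> S" "j \<notin> S" "t \<in> {s * B + 1..(s + 1) * B}" "P t $ i $ j > 0"
    using uv(2) unfolding Es_def edges_def by auto
  then have "t - (s * B + 1) < B" "s * B + 1 + (t - (s * B + 1)) = t" using B_ge_1 by auto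
  with ij show ?thesis by metis
qed

lemma N_pos: "real CARD('v) \<ge> 1"
  by (simp add: Suc_leI)

lemma beta: "3 / 4 \<le> \<beta>" "\<beta> < 1"
proof -
  have "1 \<le> (real CARD('v))\<^sup>2" using N_pos by (rule one_le_power)
  then have "\<theta> / (4 * (real CARD('v))\<^sup>2) \<le> 1 / 4"
    using theta by (intro frac_le[of 1 \<theta> 4, THEN order_trans]) auto
  moreover have "0 < \<theta> / (4 * (real CARD('v))\<^sup>2)"
    using theta \<open>1 \<le> _\<close> by (intro divide_pos_pos) auto
  ultimately show "3 / 4 \<le> \<beta>" "\<beta> < 1"
    unfolding \<beta>_def by linarith+
qed

lemma deviation_window_contraction:
  assumes Z: "\<And>t. t < B \<Longrightarrow> Z (Suc t) = mix (P (s * B + 1 + t)) (Z t)"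
  shows "deviation (Z B) \<le> \<beta> * deviation (Z 0)"
proof (rule power2_le_imp_le)
  let ?q = "1 - \<theta> / (2 * (real CARD('v))\<^sup>2)"
  have "variation (\<lambda>i. Z B i $ k) \<le> ?q * variation (\<lambda>i. Z 0 i $ k)" for k
    by (rule variation_window_contraction[where A = "\<lambda>t. P (s * B + 1 + t)" and z = "\<lambda>t i. Z t i $ k"])
      (use P_stochastic theta P_diag P_positive window_cut Z in \<open>auto simp: mix_component\<close>)
  then have "(deviation (Z B))\<^sup>2 \<le> ?q * (deviation (Z 0))\<^sup>2"
    unfolding deviation_power2 sum_distrib_left by (rule sum_mono)
  also have "\<dots> \<le> \<beta>\<^sup>2 * (deviation (Z 0))\<^sup>2"
  proof (rule mult_right_mono)
    \<comment> \<open>Passing from the squared deviation to the deviation halves the subtracted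
      fraction; this is the 4 in \<beta>, against the 2 in \<open>?q\<close>.\<close>
    have "\<beta>\<^sup>2 = ?q + (\<theta> / (4 * (real CARD('v))\<^sup>2))\<^sup>2"
      unfolding \<beta>_def by (simp add: power2_eq_square field_simps)
    then show "?q \<le> \<beta>\<^sup>2" by simp
  qed simp
  finally show "(deviation (Z B))\<^sup>2 \<le> (\<beta> * deviation (Z 0))\<^sup>2" by (simp add: power_mult_distrib)
  show "0 \<le> \<beta> * deviation (Z 0)" using beta by (intro mult_nonneg_nonneg deviation_nonneg) auto
qed

context
  fixes Z E :: "nat \<Rightarrow> 'v \<Rightarrow> real^'n"
  assumes Z: "\<And>t i. Z (Suc t) i = mix (P t) (Z t) i + E t i"
begin

lemma deviation_step: "deviation (Z (Suc t)) \<le> deviation (Z t) + (\<Sum>i\<in>UNIV. norm (E t i))"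
proof -
  have "Z (Suc t) = (\<lambda>i. mix (P t) (Z t) i + E t i)" using Z by auto
  then have "deviation (Z (Suc t)) \<le> deviation (mix (P t) (Z t)) + deviation (E t)"
    using deviation_triangle[of "mix (P t) (Z t)" "E t"] by simp
  then show ?thesis
    using deviation_mix_le[OF P_stochastic, of t "Z t"] deviation_le_sum_norm[of "E t"] by linarith
qed

text \<open>\<open>Y\<close> is the unperturbed evolution from the state at the start of the window.
  It contracts by \<beta>, and since mixing is nonexpansive the difference to \<open>Z\<close> is at
  most the accumulated errors.\<close>

lemma deviation_window:
  "deviation (Z (s * B + 1 + B)) \<le> \<beta> * deviation (Z (s * B + 1))
     + (\<Sum>t<B. \<Sum>i\<in>UNIV. norm (E (s * B + 1 + t) i))"
proof -
  let ?a = "s * B + 1"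
  define Y where "Y = rec_nat (Z ?a) (\<lambda>t W. mix (P (?a + t)) W)"
  have Y: "Y 0 = Z ?a" "Y (Suc t) = mix (P (?a + t)) (Y t)" for t unfolding Y_def by auto
  have err: "deviation (\<lambda>i. Z (?a + n) i - Y n i) \<le> (\<Sum>t<n. \<Sum>i\<in>UNIV. norm (E (?a + t) i))" for n
  proof (induction n)
    case 0
    show ?case unfolding deviation_def mean_def L2_set_def Y by simp
  next
    case (Suc n)
    have eq: "(\<lambda>i. Z (?a + Suc n) i - Y (Suc n) i)
        = (\<lambda>i. mix (P (?a + n)) (\<lambda>i. Z (?a + n) i - Y n i) i + E (?a + n) i)"
      using Z[of "?a + n"] Y(2)[of n] by (auto simp: mix_def sum_subtractf scaleR_diff_right)
    have "deviation (\<lambda>i. Z (?a + Suc n) i - Y (Suc n) i)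
        \<le> deviation (mix (P (?a + n)) (\<lambda>i. Z (?a + n) i - Y n i)) + deviation (E (?a + n))"
      unfolding eq by (rule deviation_triangle)
    with Suc deviation_mix_le[OF P_stochastic, of "?a + n" "\<lambda>i. Z (?a + n) i - Y n i"]
      deviation_le_sum_norm[of "E (?a + n)"] show ?case by simp
  qed
  have "deviation (Z (?a + B)) \<le> deviation (Y B) + deviation (\<lambda>i. Z (?a + B) i - Y B i)"
    using deviation_triangle[of "Y B" "\<lambda>i. Z (?a + B) i - Y B i"] by simp
  moreover have "deviation (Y B) \<le> \<beta> * deviation (Y 0)"
    by (rule deviation_window_contraction) (rule Y(2))
  ultimately show ?thesis using err[of B] unfolding Y(1) by linarith
qed

end

end

section \<open>Summing the window contraction over time\<close>

lemma sum_windows: "(\<Sum>t=1..<Suc (S * B). f t) = (\<Sum>s<S. \<Sum>t<B. f (s * B + 1 + t))"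
  for f :: "nat \<Rightarrow> real"
proof (induction S)
  case (Suc S)
  have "(\<Sum>t=1..<Suc (Suc S * B). f t)
      = (\<Sum>t=1..<Suc (S * B). f t) + (\<Sum>t=Suc (S * B)..<Suc (Suc S * B). f t)"
    by (rule sum.atLeastLessThan_concat[symmetric]) auto
  also have "(\<Sum>t=Suc (S * B)..<Suc (Suc S * B). f t) = (\<Sum>t<B. f (S * B + 1 + t))"
    using sum.shift_bounds_nat_ivl[of f 0 "Suc (S * B)" B] by (simp add: lessThan_atLeast0 add.commute)
  finally show ?case using Suc by simp
qed simp

text \<open>Inside a window every \<open>D\<close> is at most its initial value \<open>W s\<close>
  plus the window's errors \<open>E s\<close>, which costs the factor \<open>B\<close>; the
  recursion for \<open>W\<close> from window to window is summed as a geometric series.\<close>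

lemma sum_windowed_contraction_le:
  fixes D \<epsilon> :: "nat \<Rightarrow> real"
  assumes \<beta>: "0 \<le> \<beta>" "\<beta> < 1" and nonneg: "\<And>t. 0 \<le> D t" "\<And>t. 0 \<le> \<epsilon> t"
    and step: "\<And>t. D (Suc t) \<le> D t + \<epsilon> t"
    and window: "\<And>s. D (s * B + 1 + B) \<le> \<beta> * D (s * B + 1) + (\<Sum>t<B. \<epsilon> (s * B + 1 + t))"
  shows "(1 - \<beta>) * (\<Sum>t=1..<Suc (S * B). D t) \<le> B * (2 - \<beta>) * (D 1 + (\<Sum>t=1..<Suc (S * B). \<epsilon> t))"
proof -
  define W E where "W s = D (s * B + 1)" and "E s = (\<Sum>t<B. \<epsilon> (s * B + 1 + t))" for s
  have inner: "D (s * B + 1 + t) \<le> W s + (\<Sum>u<t. \<epsilon> (s * B + 1 + u))" for s t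
  proof (induction t)
    case (Suc t)
    then show ?case using step[of "s * B + 1 + t"] by simp
  qed (simp add: W_def)
  have "(\<Sum>t<B. D (s * B + 1 + t)) \<le> B * (W s + E s)" for s
  proof -
    have "D (s * B + 1 + t) \<le> W s + E s" if "t < B" for t
    proof -
      have "(\<Sum>u<t. \<epsilon> (s * B + 1 + u)) \<le> E s"
        unfolding E_def using that nonneg by (intro sum_mono2) auto
      with inner[of s t] show ?thesis by linarith
    qed
    then show ?thesis using sum_bounded_above[of "{..<B}" "\<lambda>t. D (s * B + 1 + t)" "W s + E s"] by simp
  qed
  then have "(\<Sum>t=1..<Suc (S * B). D t) \<le> (\<Sum>s<S. B * (W s + E s))"
    unfolding sum_windows by (rule sum_mono)
  also have "\<dots> = B * ((\<Sum>s<S. W s) + (\<Sum>s<S. E s))"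
    by (simp add: sum_distrib_left sum.distrib algebra_simps)
  finally have 1: "(\<Sum>t=1..<Suc (S * B). D t) \<le> B * ((\<Sum>s<S. W s) + (\<Sum>s<S. E s))" .
  have W: "W (Suc s) \<le> \<beta> * W s + E s" for s
    using window[of s] unfolding W_def E_def by (simp add: algebra_simps)
  have "(1 - \<beta>) * (\<Sum>s<S. W s) + W S \<le> W 0 + (\<Sum>s<S. E s)" for S
  proof (induction S)
    case (Suc S)
    then show ?case using W[of S] by (simp add: algebra_simps)
  qed simp
  from this[of S] have 2: "(1 - \<beta>) * (\<Sum>s<S. W s) \<le> W 0 + (\<Sum>s<S. E s)"
    using nonneg(1)[of "S * B + 1"] unfolding W_def by simp
  have W0: "0 \<le> W 0" unfolding W_def by (rule nonneg)
  have "(1 - \<beta>) * (\<Sum>t=1..<Suc (S * B). D t) \<le> (1 - \<beta>) * (B * ((\<Sum>s<S. W s) + (\<Sum>s<S. E s)))"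
    using 1 \<beta> by (intro mult_left_mono) auto
  also have "\<dots> = B * ((1 - \<beta>) * (\<Sum>s<S. W s) + (1 - \<beta>) * (\<Sum>s<S. E s))" by (simp add: algebra_simps)
  \<comment> \<open>The nonnegative term \<open>(1 - \<beta>) * W 0\<close> is added so that initial
    value and errors share the factor \<open>2 - \<beta>\<close>.\<close>
  also have "\<dots> \<le> B * (W 0 + (\<Sum>s<S. E s) + (1 - \<beta>) * (\<Sum>s<S. E s) + (1 - \<beta>) * W 0)"
  proof (rule mult_left_mono)
    have "0 \<le> (1 - \<beta>) * W 0" using W0 \<beta> by simp
    with 2 show "(1 - \<beta>) * (\<Sum>s<S. W s) + (1 - \<beta>) * (\<Sum>s<S. E s)
        \<le> W 0 + (\<Sum>s<S. E s) + (1 - \<beta>) * (\<Sum>s<S. E s) + (1 - \<beta>) * W 0" by linarith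
  qed simp
  also have "\<dots> = B * (2 - \<beta>) * (W 0 + (\<Sum>s<S. E s))" by (simp add: algebra_simps)
  finally show ?thesis unfolding sum_windows[of \<epsilon>] W_def E_def by simp
qed

context mixing_network begin

lemma gamma_const: "0 < gamma_const CARD('v) \<theta> B" "gamma_const CARD('v) \<theta> B < 1"
  "gamma_const CARD('v) \<theta> B ^ B = \<beta>"
proof -
  let ?\<gamma> = "gamma_const CARD('v) \<theta> B"
  have g: "?\<gamma> = \<beta> powr (1 / B)" unfolding gamma_const_def \<beta>_def by simp
  show 0: "0 < ?\<gamma>" unfolding g using beta by simp
  show 1: "?\<gamma> ^ B = \<beta>" unfolding g using beta B_ge_1 by (simp add: powr_powr flip: powr_realpow)
  show "?\<gamma> < 1"
  proof (rule ccontr)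
    assume "\<not> ?\<gamma> < 1"
    then have "1 \<le> ?\<gamma> ^ B" by (intro one_le_power) simp
    then show False using 1 beta by simp
  qed
qed

lemma omega_const: "omega_const CARD('v) \<theta> = 1 / \<beta>\<^sup>2"
  unfolding omega_const_def \<beta>_def by (simp add: power_int_minus field_simps)

lemma mixing_const_nonneg: "0 \<le> mixing_const CARD('v) \<theta> B"
  unfolding mixing_const_def omega_const using gamma_const by simp

text \<open>The window constant against the per-step constant. Each of the \<open>B\<close> powers
  of \<gamma> in the geometric sum is at least \<open>\<gamma> ^ B = \<beta>\<close>, so
  \<open>(1 - \<gamma>) * B * \<beta> \<le> 1 - \<beta>\<close>. This uses up one factor \<beta> of
  the inverse of \<omega>; the other gives \<open>(2 - \<beta>) * \<beta> \<le> 1\<close>.\<close>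

lemma mixing_const_bound: "B * (2 - \<beta>) \<le> mixing_const CARD('v) \<theta> B * (1 - \<beta>)"
proof -
  let ?\<gamma> = "gamma_const CARD('v) \<theta> B"
  have "real B * \<beta> \<le> (\<Sum>i<B. ?\<gamma> ^ i)"
    using sum_bounded_below[of "{..<B}" \<beta> "\<lambda>i. ?\<gamma> ^ i"] gamma_const
      power_decreasing[of _ B ?\<gamma>] by (auto simp: less_imp_le)
  then have "(1 - ?\<gamma>) * (real B * \<beta>) \<le> (1 - ?\<gamma>) * (\<Sum>i<B. ?\<gamma> ^ i)"
    using gamma_const(2) by (intro mult_left_mono) auto
  also have "\<dots> = 1 - \<beta>" using one_diff_power_eq[of ?\<gamma> B] gamma_const(3) by simp
  finally have 1: "(1 - ?\<gamma>) * (real B * \<beta>) \<le> 1 - \<beta>" .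
  have "(2 - \<beta>) * \<beta> \<le> 1" using zero_le_power2[of "1 - \<beta>"] by (simp add: power2_eq_square algebra_simps)
  have "B * (2 - \<beta>) * (\<beta>\<^sup>2 * (1 - ?\<gamma>)) = ((2 - \<beta>) * \<beta>) * ((1 - ?\<gamma>) * (real B * \<beta>))"
    by (simp add: power2_eq_square)
  also have "\<dots> \<le> 1 * (1 - \<beta>)"
    using 1 \<open>(2 - \<beta>) * \<beta> \<le> 1\<close> beta gamma_const(2) by (intro mult_mono) auto
  finally show ?thesis
    unfolding mixing_const_def omega_const using gamma_const(2) beta by (simp add: field_simps)
qed

lemma sum_deviation_le:
  fixes Z E :: "nat \<Rightarrow> 'v \<Rightarrow> real^'n"
  assumes Z: "\<And>t i. Z (Suc t) i = mix (P t) (Z t) i + E t i" and T: "T \<ge> 1"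
  shows "(\<Sum>t=1..T. deviation (Z t))
    \<le> mixing_const CARD('v) \<theta> B * (deviation (Z 0) + (\<Sum>t<T. \<Sum>i\<in>UNIV. norm (E t i)))"
proof -
  \<comment> \<open>Deviations and errors are cut off at the horizon, which keeps both recursions
    valid and allows the sum to run over \<open>T\<close> whole windows; these cover all times from
    1 to \<open>T\<close>.\<close>
  define \<epsilon> where "\<epsilon> t = (if t < T then \<Sum>i\<in>UNIV. norm (E t i) else 0)" for t
  define D where "D t = (if t \<le> T then deviation (Z t) else 0)" for t
  have nonneg: "0 \<le> D t" "0 \<le> \<epsilon> t" for t
    unfolding D_def \<epsilon>_def by (auto intro!: sum_nonneg deviation_nonneg)
  have step: "D (Suc t) \<le> D t + \<epsilon> t" for t
    using deviation_step[of Z E, OF Z, of t] nonneg[of t] unfolding D_def \<epsilon>_def by auto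
  have window: "D (s * B + 1 + B) \<le> \<beta> * D (s * B + 1) + (\<Sum>t<B. \<epsilon> (s * B + 1 + t))" for s
  proof (cases "s * B + 1 + B \<le> T")
    case True
    then show ?thesis using deviation_window[of Z E, OF Z, of s] unfolding D_def \<epsilon>_def by simp
  next
    case False
    have "0 \<le> \<beta> * D (s * B + 1) + (\<Sum>t<B. \<epsilon> (s * B + 1 + t))"
      using nonneg beta by (intro add_nonneg_nonneg mult_nonneg_nonneg sum_nonneg) auto
    then show ?thesis using False unfolding D_def by simp
  qed
  have "T * 1 \<le> T * B" using B_ge_1 by (rule mult_le_mono2)
  then have sub: "{1..T} \<subseteq> {1..<Suc (T * B)}"
    unfolding subset_iff atLeastAtMost_iff atLeastLessThan_iff by linarith
  have "(\<Sum>t=1..T. deviation (Z t)) = (\<Sum>t=1..T. D t)" unfolding D_def by simp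
  also have "\<dots> \<le> (\<Sum>t=1..<Suc (T * B). D t)" using sub nonneg by (intro sum_mono2) auto
  finally have "(1 - \<beta>) * (\<Sum>t=1..T. deviation (Z t)) \<le> (1 - \<beta>) * (\<Sum>t=1..<Suc (T * B). D t)"
    using beta by (intro mult_left_mono) auto
  also have "\<dots> \<le> B * (2 - \<beta>) * (D 1 + (\<Sum>t=1..<Suc (T * B). \<epsilon> t))"
    using beta by (intro sum_windowed_contraction_le nonneg step window) auto
  also have "\<dots> \<le> (1 - \<beta>) * (mixing_const CARD('v) \<theta> B * (deviation (Z 0) + (\<Sum>t<T. \<Sum>i\<in>UNIV. norm (E t i))))"
  proof -
    have D0: "D 0 = deviation (Z 0)" unfolding D_def by simp
    have "(\<Sum>t=1..<Suc (T * B). \<epsilon> t) = (\<Sum>t=1..<T. \<epsilon> t)"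
    proof (rule sum.mono_neutral_right)
      show "{1..<T} \<subseteq> {1..<Suc (T * B)}" 
        by (rule order_trans[OF _ sub]) auto
    qed (auto simp: \<epsilon>_def)
    moreover have "D 1 \<le> deviation (Z 0) + \<epsilon> 0" using step[of 0] D0 by simp
    moreover have "(\<Sum>t<T. \<epsilon> t) = \<epsilon> 0 + (\<Sum>t=1..<T. \<epsilon> t)"
      using sum.atLeast_Suc_lessThan[of 0 T \<epsilon>] T by (simp add: lessThan_atLeast0)
    moreover have "(\<Sum>t<T. \<epsilon> t) = (\<Sum>t<T. \<Sum>i\<in>UNIV. norm (E t i))" unfolding \<epsilon>_def by simp
    ultimately
    have le: "D 1 + (\<Sum>t=1..<Suc (T * B). \<epsilon> t) \<le> deviation (Z 0) + (\<Sum>t<T. \<Sum>i\<in>UNIV. norm (E t i))"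
      by linarith
    have "0 \<le> D 1 + (\<Sum>t=1..<Suc (T * B). \<epsilon> t)" using nonneg by (intro add_nonneg_nonneg sum_nonneg) auto
    then have "B * (2 - \<beta>) * (D 1 + (\<Sum>t=1..<Suc (T * B). \<epsilon> t))
        \<le> mixing_const CARD('v) \<theta> B * (1 - \<beta>) * (deviation (Z 0) + (\<Sum>t<T. \<Sum>i\<in>UNIV. norm (E t i)))"
      using beta mixing_const_nonneg
      by (intro mult_mono[OF mixing_const_bound le]) (auto intro!: mult_nonneg_nonneg)
    then show ?thesis by (simp only: mult_ac)
  qed
  finally show ?thesis using beta by (simp only: mult_le_cancel_left_pos diff_gt_0_iff_gt)
qed

lemma sum_disagreement_le:
  fixes Z E :: "nat \<Rightarrow> 'v \<Rightarrow> real^'n"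
  assumes Z: "\<And>t i. Z (Suc t) i = mix (P t) (Z t) i + E t i" and T: "T \<ge> 1"
  shows "(\<Sum>t=1..T. \<Sum>j\<in>UNIV. norm (Z t l - Z t j))
    \<le> 2 * real CARD('v) * mixing_const CARD('v) \<theta> B * ((\<Sum>j\<in>UNIV. norm (Z 0 j)) + (\<Sum>t<T. \<Sum>i\<in>UNIV. norm (E t i)))"
proof -
  have "(\<Sum>j\<in>UNIV. norm (Z t l - Z t j)) \<le> 2 * real CARD('v) * deviation (Z t)" for t
  proof -
    have "norm (Z t l - Z t j) \<le> 2 * deviation (Z t)" for j
      using norm_triangle_ineq4[of "Z t l - mean (Z t)" "Z t j - mean (Z t)"]
        norm_diff_mean_le_deviation[of "Z t" l] norm_diff_mean_le_deviation[of "Z t" j] by simp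
    then show ?thesis using sum_bounded_above[of UNIV "\<lambda>j. norm (Z t l - Z t j)" "2 * deviation (Z t)"]
      by (simp add: mult_ac)
  qed
  then have "(\<Sum>t=1..T. \<Sum>j\<in>UNIV. norm (Z t l - Z t j)) \<le> 2 * real CARD('v) * (\<Sum>t=1..T. deviation (Z t))"
    by (simp add: sum_distrib_left sum_mono)
  also have "\<dots> \<le> 2 * real CARD('v) * (mixing_const CARD('v) \<theta> B * ((\<Sum>j\<in>UNIV. norm (Z 0 j)) + (\<Sum>t<T. \<Sum>i\<in>UNIV. norm (E t i))))"
  proof (rule mult_left_mono)
    have "mixing_const CARD('v) \<theta> B * (deviation (Z 0) + (\<Sum>t<T. \<Sum>i\<in>UNIV. norm (E t i)))
        \<le> mixing_const CARD('v) \<theta> B * ((\<Sum>j\<in>UNIV. norm (Z 0 j)) + (\<Sum>t<T. \<Sum>i\<in>UNIV. norm (E t i)))"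
      using deviation_le_sum_norm mixing_const_nonneg by (intro mult_left_mono add_right_mono) auto
    with sum_deviation_le[of Z E T, OF Z T]
    show "(\<Sum>t=1..T. deviation (Z t)) \<le> mixing_const CARD('v) \<theta> B * ((\<Sum>j\<in>UNIV. norm (Z 0 j)) + (\<Sum>t<T. \<Sum>i\<in>UNIV. norm (E t i)))"
      by linarith
  qed simp
  finally show ?thesis by (simp only: mult.assoc)
qed

end

section \<open>Azuma's inequality\<close>

text \<open>The right-hand side is the chord of the exponential over \<open>[- c, c]\<close>. It is
  affine in \<open>z\<close>, so only its constant term survives a vanishing conditional
  mean.\<close>

lemma convex_exp_bound:
  fixes c z s :: real
  assumes "c > 0" "\<bar>z\<bar> \<le> c"
  shows "exp (s * z) \<le> cosh (s * c) + sinh (s * c) / c * z"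
proof -
  define u where "u = (1 + z / c) / 2"
  have u: "0 \<le> u" "u \<le> 1" unfolding u_def using assms by (auto simp: field_simps abs_le_iff)
  have eq: "s * z = (1 - u) * (- (s * c)) + u * (s * c)" unfolding u_def using assms by (simp add: field_simps)
  have "convex_on UNIV (exp :: real \<Rightarrow> real)" by (rule convex_on_exp[of 1, simplified])
  from convex_onD[OF this u, of "- (s * c)" "s * c"]
  have "exp (s * z) \<le> (1 - u) * exp (- (s * c)) + u * exp (s * c)" unfolding eq by simp
  also have "\<dots> = cosh (s * c) + sinh (s * c) / c * z"
    unfolding u_def cosh_def sinh_def using assms by (simp add: field_simps)
  finally show ?thesis .
qed

text \<open>A termwise comparison of power series, resting on
  \<open>2 ^ n * fact n \<le> fact (2 * n)\<close>.\<close>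

lemma cosh_le_exp_square: "cosh (a :: real) \<le> exp (a\<^sup>2 / 2)"
proof -
  have c: "(\<lambda>n. if even n then a ^ n /\<^sub>R fact n else 0) sums cosh a" by (rule cosh_converges)
  let ?g = "\<lambda>n. if even n then a ^ n /\<^sub>R fact n else 0"
  have "(\<lambda>n. ?g (2 * n)) sums cosh a"
    using c by (subst sums_mono_reindex[of "\<lambda>n. 2 * n" ?g]) (auto simp: strict_mono_def elim!: evenE)
  then have c': "(\<lambda>n. a ^ (2 * n) / fact (2 * n)) sums cosh a"
    by (simp add: divide_inverse mult.commute)
  have e: "(\<lambda>n. (a\<^sup>2 / 2) ^ n /\<^sub>R fact n) sums exp (a\<^sup>2 / 2)" by (rule exp_converges)
  have "a ^ (2 * n) / fact (2 * n) \<le> (a\<^sup>2 / 2) ^ n /\<^sub>R fact n" for n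
  proof -
    have "(2::real) ^ n * fact n \<le> fact (2 * n)"
    proof (induction n)
      case (Suc n)
      have "(2::real) ^ Suc n * fact (Suc n) = 2 * (real n + 1) * (2 ^ n * fact n)" by simp
      also have "\<dots> \<le> 2 * (real n + 1) * fact (2 * n)" by (intro mult_left_mono Suc) auto
      also have "\<dots> \<le> (2 * real n + 1) * (2 * (real n + 1) * fact (2 * n))"
      proof -
        have "1 * (2 * (real n + 1) * fact (2 * n)) \<le> (2 * real n + 1) * (2 * (real n + 1) * fact (2 * n))"
          by (rule mult_right_mono) auto
        then show ?thesis by (simp only: mult_1)
      qed
      also have "\<dots> = fact (2 * Suc n)" by (simp add: algebra_simps)
      finally show ?case .
    qed simp
    then have "a ^ (2 * n) / fact (2 * n) \<le> a ^ (2 * n) / (2 ^ n * fact n)"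
      by (intro frac_le order_refl zero_le_even_power) auto
    also have "\<dots> = (a\<^sup>2 / 2) ^ n /\<^sub>R fact n"
      unfolding power_divide power_mult by (simp add: divide_inverse)
    finally show ?thesis .
  qed
  from sums_le[OF this c' e] show ?thesis .
qed

context prob_space begin

text \<open>The exponential of the earlier sum is \<open>H n\<close>-measurable, so the linear part
  of the chord bound for \<open>Z n\<close> integrates to zero against it, and each step costs only
  a factor \<open>cosh (s * c)\<close>.\<close>

lemma azuma_exp_moment:
  fixes Z :: "nat \<Rightarrow> 'a \<Rightarrow> real"
  assumes H: "\<And>t. subalgebra M (H t)" and c: "c > 0"
    and Z: "\<And>t. Z t \<in> borel_measurable M" "\<And>t. AE x in M. \<bar>Z t x\<bar> \<le> c"
    and adapted: "\<And>u t. u < t \<Longrightarrow> Z u \<in> borel_measurable (H t)"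
    and mart: "\<And>t. AE x in M. real_cond_exp M (H t) (Z t) x = 0"
  shows "integrable M (\<lambda>x. exp (s * (\<Sum>t<n. Z t x)))
    \<and> expectation (\<lambda>x. exp (s * (\<Sum>t<n. Z t x))) \<le> exp (real n * ((s * c)\<^sup>2 / 2))"
proof (induction n)
  case 0
  then show ?case by (simp add: prob_space)
next
  case (Suc n)
  let ?E = "\<lambda>x. exp (s * (\<Sum>t<n. Z t x))"
  interpret Hn: finite_measure_subalgebra M "H n"
    using H by (intro finite_measure_subalgebra.intro finite_measure_subalgebra_axioms.intro) unfold_locales
  have Em: "?E \<in> borel_measurable (H n)" using adapted by measurable
  have EM: "?E \<in> borel_measurable M" using Z(1) by measurable
  have bound: "AE x in M. \<forall>t\<in>{..n}. \<bar>Z t x\<bar> \<le> c" using Z(2) by (intro AE_finite_allI) auto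
  have int_suc: "integrable M (\<lambda>x. exp (s * (\<Sum>t<Suc n. Z t x)))"
  proof (rule integrable_const_bound[of _ "exp (\<bar>s\<bar> * (real (Suc n) * c))"])
    show "AE x in M. norm (exp (s * (\<Sum>t<Suc n. Z t x))) \<le> exp (\<bar>s\<bar> * (real (Suc n) * c))"
      using bound
    proof eventually_elim
      case (elim x)
      have "\<bar>\<Sum>t<Suc n. Z t x\<bar> \<le> (\<Sum>t<Suc n. \<bar>Z t x\<bar>)" by (rule sum_abs)
      also have "\<dots> \<le> real (card {..<Suc n}) * c" by (rule sum_bounded_above) (use elim in auto)
      finally have "\<bar>s\<bar> * \<bar>\<Sum>t<Suc n. Z t x\<bar> \<le> \<bar>s\<bar> * (real (Suc n) * c)" by (intro mult_left_mono) auto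
      then have "s * (\<Sum>t<Suc n. Z t x) \<le> \<bar>s\<bar> * (real (Suc n) * c)"
        using abs_ge_self[of "s * (\<Sum>t<Suc n. Z t x)"] unfolding abs_mult by linarith
      then show ?case by simp
    qed
  qed (use Z(1) in measurable)
  have int_EZ: "integrable M (\<lambda>x. ?E x * Z n x)"
  proof (rule Bochner_Integration.integrable_bound[of _ "\<lambda>x. c * ?E x"])
    show "integrable M (\<lambda>x. c * ?E x)" using Suc by simp
    show "AE x in M. norm (?E x * Z n x) \<le> norm (c * ?E x)"
      using Z(2)[of n] by eventually_elim (use c in \<open>simp add: abs_mult\<close>)
  qed (use EM Z(1) in measurable)
  have zero: "expectation (\<lambda>x. ?E x * Z n x) = 0"
  proof -
    have "expectation (\<lambda>x. ?E x * Z n x) = expectation (\<lambda>x. ?E x * real_cond_exp M (H n) (Z n) x)"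
      by (rule Hn.real_cond_exp_intg(2)[symmetric]) (use int_EZ Em Z(1) in auto)
    also have "\<dots> = expectation (\<lambda>x. 0)"
      by (rule integral_cong_AE) (use EM mart[of n] in auto)
    finally show ?thesis by simp
  qed
  have "expectation (\<lambda>x. exp (s * (\<Sum>t<Suc n. Z t x)))
      \<le> expectation (\<lambda>x. cosh (s * c) * ?E x + sinh (s * c) / c * (?E x * Z n x))"
  proof (rule integral_mono_AE)
    show "AE x in M. exp (s * (\<Sum>t<Suc n. Z t x)) \<le> cosh (s * c) * ?E x + sinh (s * c) / c * (?E x * Z n x)"
      using Z(2)[of n]
    proof eventually_elim
      case (elim x)
      have "exp (s * (\<Sum>t<Suc n. Z t x)) = ?E x * exp (s * Z n x)" by (simp add: distrib_left exp_add)
      also have "\<dots> \<le> ?E x * (cosh (s * c) + sinh (s * c) / c * Z n x)"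
        by (intro mult_left_mono convex_exp_bound c elim) auto
      finally show ?case by (simp add: algebra_simps)
    qed
  qed (use int_suc int_EZ Suc in auto)
  also have "\<dots> = cosh (s * c) * expectation ?E"
    using int_EZ Suc zero by simp
  also have "\<dots> \<le> exp ((s * c)\<^sup>2 / 2) * exp (real n * ((s * c)\<^sup>2 / 2))"
    using Suc by (intro mult_mono cosh_le_exp_square) auto
  also have "\<dots> = exp (real (Suc n) * ((s * c)\<^sup>2 / 2))" by (simp add: exp_add[symmetric] algebra_simps)
  finally show ?case using int_suc by blast
qed

lemma azuma:
  fixes Z :: "nat \<Rightarrow> 'a \<Rightarrow> real"
  assumes H: "\<And>t. subalgebra M (H t)" and c: "c \<ge> 0"
    and Z: "\<And>t. Z t \<in> borel_measurable M" "\<And>t. AE x in M. \<bar>Z t x\<bar> \<le> c"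
    and adapted: "\<And>u t. u < t \<Longrightarrow> Z u \<in> borel_measurable (H t)"
    and mart: "\<And>t. AE x in M. real_cond_exp M (H t) (Z t) x = 0"
    and \<delta>: "0 < \<delta>" "\<delta> < 1"
  shows "1 - \<delta> \<le> prob {x \<in> space M. (\<Sum>t<n. Z t x) \<le> c * sqrt (2 * real n * ln (1 / \<delta>))}"
\<comment> \<open>The optimal parameter divides by \<open>n * c\<^sup>2\<close>; in the excluded
  cases the sum vanishes almost surely.\<close>
proof (cases "c = 0 \<or> n = 0")
  case True
  have "AE x in M. \<forall>t\<in>{..<n}. \<bar>Z t x\<bar> \<le> c" using Z(2) by (intro AE_finite_allI) auto
  then have "AE x in M. (\<Sum>t<n. Z t x) \<le> c * sqrt (2 * real n * ln (1 / \<delta>))"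
    by eventually_elim (use True in auto)
  then have "prob {x \<in> space M. (\<Sum>t<n. Z t x) \<le> c * sqrt (2 * real n * ln (1 / \<delta>))} = 1"
    using Z(1) by (subst prob_Collect_eq_1) auto
  with \<delta> show ?thesis by simp
next
  case False
  with c have c: "c > 0" and n: "real n > 0" by auto
  define l where "l = ln (1 / \<delta>)"
  have l: "l > 0" unfolding l_def using \<delta> by simp
  define w where "w = c * sqrt (2 * real n * l)"
  have w: "w > 0" "w\<^sup>2 = 2 * real n * l * c\<^sup>2" unfolding w_def using c n l by (auto simp: power_mult_distrib)
  \<comment> \<open>The minimiser of the Chernoff exponent
    \<open>n * (s * c)\<^sup>2 / 2 - s * w\<close>; with it the exponent equals
    \<open>- ln (1 / \<delta>)\<close>.\<close>
  define s where "s = w / (real n * c\<^sup>2)"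
  have s: "s > 0" unfolding s_def using w n c by simp
  let ?S = "\<lambda>x. \<Sum>t<n. Z t x"
  have S[measurable]: "?S \<in> borel_measurable M" using Z(1) by measurable
  note ex = azuma_exp_moment[where H = H and Z = Z and n = n and s = s, OF H c Z adapted mart]
  have "prob {x \<in> space M. exp (s * w) \<le> exp (s * ?S x)} \<le> expectation (\<lambda>x. exp (s * ?S x)) / exp (s * w)"
    by (rule integral_Markov_inequality_measure[where A = "{}"]) (use ex in auto)
  also have "\<dots> \<le> exp (real n * ((s * c)\<^sup>2 / 2)) / exp (s * w)"
    using ex by (intro divide_right_mono) auto
  also have "\<dots> = exp (real n * ((s * c)\<^sup>2 / 2) - s * w)" by (simp add: exp_diff)
  also have "real n * ((s * c)\<^sup>2 / 2) - s * w = - w\<^sup>2 / (2 * real n * c\<^sup>2)"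
    unfolding s_def using n c by (simp add: field_simps power2_eq_square)
  also have "\<dots> = - l" unfolding w(2) using n c by simp
  also have "exp (- l) = \<delta>" unfolding l_def using \<delta> by (simp add: ln_div)
  finally have le: "prob {x \<in> space M. exp (s * w) \<le> exp (s * ?S x)} \<le> \<delta>" .
  have "1 - \<delta> \<le> 1 - prob {x \<in> space M. w \<le> ?S x}" using le s by simp
  also have "\<dots> = prob (space M - {x \<in> space M. w \<le> ?S x})" by (rule prob_compl[symmetric]) measurable
  also have "\<dots> \<le> prob {x \<in> space M. ?S x \<le> w}" by (rule finite_measure_mono) auto
  finally show ?thesis unfolding w_def l_def .
qed

end

section \<open>Stepsize sums and constants\<close>

lemma sum_inverse_sqrt_le: "(\<Sum>t<T. 1 / sqrt (real t + 1)) \<le> 2 * sqrt (real T)"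
proof (induction T)
  case (Suc T)
  let ?a = "sqrt (real T)" and ?b = "sqrt (real T + 1)"
  have b: "?b > 0" by simp
  have "?b * ?b - ?a * ?a = 1" by simp
  moreover have "0 \<le> (?b - ?a)\<^sup>2" by simp
  ultimately have "1 \<le> 2 * (?b - ?a) * ?b" by (simp add: power2_eq_square algebra_simps)
  then have "1 / ?b \<le> 2 * (?b - ?a)" using b by (simp add: divide_le_eq)
  with Suc show ?case by (simp add: add.commute)
qed simp

lemma sum_inverse_sqrt_le': "(\<Sum>t=1..T. 1 / sqrt (real t + 1)) \<le> 2 * sqrt (real T)"
proof -
  have "(\<Sum>t=1..T. 1 / sqrt (real t + 1)) \<le> (\<Sum>t=1..T. 1 / sqrt (real t))"
    by (intro sum_mono frac_le) auto
  also have "\<dots> = (\<Sum>t<T. 1 / sqrt (real t + 1))"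
    by (rule sum.reindex_bij_witness[of _ Suc "\<lambda>t. t - 1"]) (auto simp: add.commute)
  finally show ?thesis using sum_inverse_sqrt_le[of T] by linarith
qed

text \<open>The induction carries the stronger bound \<open>3 - 2 / sqrt T\<close> for
  \<open>T\<close> terms. The value 3 is the coefficient of \<open>C6\<close> in the final
  constant.\<close>

lemma sum_inverse_sqrt_cube_le: "(\<Sum>t<T. 1 / ((real t + 1) * sqrt (real t + 1))) \<le> 3"
proof -
  have "(\<Sum>t<Suc T. 1 / ((real t + 1) * sqrt (real t + 1))) \<le> 3 - 2 / sqrt (real (Suc T))" for T
  proof (induction T)
    case (Suc T)
    let ?a = "sqrt (real T + 1)" and ?b = "sqrt (real T + 2)"
    have ab: "?a > 0" "?b > 0" by simp_all
    have aa: "?a * ?a = real T + 1" "?b * ?b = real T + 2" by simp_all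
    have le: "?a \<le> ?b" by simp
    have one: "(?b - ?a) * (?b + ?a) = 1" using aa by (simp add: algebra_simps)
    have "(?b - ?a) * (?b + ?a) \<le> (?b - ?a) * (2 * ?b)" using le by (intro mult_left_mono) auto
    then have k: "1 \<le> (?b - ?a) * (2 * ?b)" unfolding one .
    have "1 * ?a \<le> (?b - ?a) * (2 * ?b) * ?b"
      by (rule mult_mono[OF k le]) (use k ab in linarith)+
    then have "?a \<le> 2 * (?b - ?a) * ?b * ?b" by (simp only: mult_1 mult_ac)
    then have "?a / (?a * (?b * ?b * ?b)) \<le> (2 * (?b - ?a) * ?b * ?b) / (?a * (?b * ?b * ?b))"
      by (rule divide_right_mono) simp
    also have "?a / (?a * (?b * ?b * ?b)) = 1 / (?b * ?b * ?b)" using ab by simp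
    also have "(2 * (?b - ?a) * ?b * ?b) / (?a * (?b * ?b * ?b)) = 2 / ?a - 2 / ?b"
      using ab by (simp add: divide_simps)
    finally have "1 / (?b * ?b * ?b) \<le> 2 / ?a - 2 / ?b" .
    then show ?case using Suc aa(2) by (simp add: algebra_simps)
  qed simp
  from this[of T] have "(\<Sum>t<Suc T. 1 / ((real t + 1) * sqrt (real t + 1))) \<le> 3"
    by (rule order_trans) simp
  then show ?thesis by (simp add: order_trans[rotated])
qed

text \<open>Cauchy-Schwarz on \<open>1 / (t + 1)\<close> written as the product of its powers 3/4
  and 1/4. The harmonic sum multiplies the noise in the displacement and enters squared after the
  arithmetic-geometric mean step, so growth like \<open>sqrt T\<close> is what has to be
  shown.\<close>

lemma harmonic_square_le: "(\<Sum>t<T. 1 / (real t + 1))\<^sup>2 \<le> 6 * sqrt (real T)"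
proof -
  define b where "b t = sqrt (1 / sqrt (real t + 1))" for t
  define a where "a t = sqrt (1 / ((real t + 1) * sqrt (real t + 1)))" for t
  have ab: "a t * b t = 1 / (real t + 1)" for t
    unfolding a_def b_def by (simp add: real_sqrt_mult[symmetric] real_sqrt_divide mult_ac)
  have "(\<Sum>t<T. a t * b t)\<^sup>2 \<le> (\<Sum>t<T. (a t)\<^sup>2) * (\<Sum>t<T. (b t)\<^sup>2)"
    by (rule Cauchy_Schwarz_ineq_sum)
  also have "\<dots> = (\<Sum>t<T. 1 / ((real t + 1) * sqrt (real t + 1))) * (\<Sum>t<T. 1 / sqrt (real t + 1))"
    unfolding a_def b_def by simp
  also have "\<dots> \<le> 3 * (2 * sqrt (real T))"
    by (intro mult_mono sum_inverse_sqrt_cube_le sum_inverse_sqrt_le sum_nonneg) auto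
  finally show ?thesis unfolding ab by simp
qed

text \<open>The weights are the inverse stepsizes. As they increase, the sum does not telescope, and
  the uniform bound \<open>C\<close> pays for each increment; the induction needs the extra boundary
  term \<open>a T * V (Suc T)\<close>.\<close>

lemma summation_by_parts_le:
  fixes a V :: "nat \<Rightarrow> real"
  assumes a: "\<And>t. a t \<le> a (Suc t)" "0 \<le> a 0" and V: "\<And>t. 0 \<le> V t" "\<And>t. V t \<le> C"
  shows "(\<Sum>t=1..T. a t * (V t - V (Suc t))) \<le> a T * C"
proof -
  have a0: "0 \<le> a t" for t by (induction t) (use a order_trans in blast)+
  have "(\<Sum>t=1..T. a t * (V t - V (Suc t))) + a T * V (Suc T) \<le> a T * C"
  proof (induction T)
    case 0
    show ?case using a(2) V(2)[of 1] by (auto intro: mult_left_mono)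
  next
    case (Suc T)
    have "(a (Suc T) - a T) * V (Suc T) \<le> (a (Suc T) - a T) * C"
      using a(1)[of T] V(2) by (intro mult_left_mono) auto
    with Suc show ?case by (simp add: algebra_simps)
  qed
  moreover have "0 \<le> a T * V (Suc T)" using a0 V(1) by simp
  ultimately show ?thesis by linarith
qed

text \<open>A budget with \<open>7 / 5 \<le> sqrt 2\<close>. Of the coefficient of
  \<open>c2\<close>, \<open>6 / 5\<close> goes to the Bregman sum and \<open>1 / 5\<close> to the
  boundary term of \<open>chi\<close>. The disagreement needs \<open>5 / 2\<close> of
  \<open>A\<close>, namely half of 4 from the stepsizes plus 1 from the noise, which fits into the
  \<open>14 / 5 \<le> 2 * sqrt 2\<close> available in \<open>c3\<close>. The remaining noise terms
  are covered by the generous factor 4 of \<open>c4\<close>.\<close>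

lemma regret_arithmetic:
  fixes N K H G Gf Gc \<sigma> L s X0 DP R h Mt S R1 Q c1 c2 c3 c4 c5 c6 :: real
  assumes N: "N \<ge> 1" and nn: "0 \<le> Gf" "0 \<le> Gc" "0 \<le> s" "0 \<le> X0" "0 \<le> DP" "0 \<le> K" "0 \<le> c6"
    and \<sigma>: "0 < \<sigma>" "\<sigma> \<le> L"
    and G: "G = Gf + Gc" and H: "H = (N + 1) * Gf + N * Gc"
    and R: "1 \<le> R" "R1 \<le> 6 / 5 * R" and h: "0 \<le> h" "h\<^sup>2 \<le> 6 * R" and Ls: "L * s \<le> G * R"
    and Q: "G * Q \<le> H / 2 * (K * (X0 + N * (4 * (G / \<sigma>) * R + sqrt (2 * L / \<sigma>) * s * h)))"
    and c1: "c1 = K * H * X0" and c2: "c2 = N * DP\<^sup>2"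
    and c3: "c3 = ((4 * N + N * K) * H + N * Gc) * (G / \<sigma>) + N * Gf\<^sup>2 / (2 * \<sigma>)"
    and c4: "c4 = (4 * N + N * K) * H * N * s + G * N\<^sup>2 * s"
    and c5: "0 \<le> c5"
    and S: "S \<le> G * Q + N * Gc * (sqrt (2 / \<sigma>) * DP) + 6 * N * Gf * s * R + c2 * R1 + 2 * c5 * R + 3 * c6
        + N * Gf\<^sup>2 / \<sigma> * R + Mt * R"
  shows "S \<le> R * ((c1 + 3 * c6) + 4 * c4 + (sqrt 2 * c2 + 2 * sqrt 2 * c3 + 2 * sqrt 2 * c5 + Mt))"
proof -
  have r2: "7 / 5 \<le> sqrt 2" by (rule real_le_rsqrt) (simp add: power2_eq_square)
  have G0: "0 \<le> G" unfolding G using nn by simp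
  have H0: "0 \<le> H" unfolding H using nn N by (intro add_nonneg_nonneg mult_nonneg_nonneg) auto
  have GfH: "Gf \<le> H"
  proof -
    have "0 \<le> N * Gf" "0 \<le> N * Gc" using nn N by auto
    then show ?thesis unfolding H by (simp add: algebra_simps)
  qed
  have q0: "0 \<le> G / \<sigma>" using G0 \<sigma> by simp
  have "sqrt (2 * L / \<sigma>) * h \<le> L / \<sigma> + h\<^sup>2 / 2"
  proof -
    have "0 \<le> (sqrt (2 * L / \<sigma>) - h)\<^sup>2" by simp
    moreover have "(sqrt (2 * L / \<sigma>))\<^sup>2 = 2 * L / \<sigma>" using \<sigma> by simp
    ultimately show ?thesis unfolding power2_diff by simp
  qed
  from mult_left_mono[OF this nn(3)]
  have "sqrt (2 * L / \<sigma>) * s * h \<le> L * s / \<sigma> + s * h\<^sup>2 / 2" by (simp add: algebra_simps)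
  also have "\<dots> \<le> G / \<sigma> * R + 3 * s * R"
  proof (rule add_mono)
    show "L * s / \<sigma> \<le> G / \<sigma> * R" using divide_right_mono[OF Ls, of \<sigma>] \<sigma> by simp
    show "s * h\<^sup>2 / 2 \<le> 3 * s * R" using mult_left_mono[OF h(2) nn(3)] by simp
  qed
  finally have noise: "sqrt (2 * L / \<sigma>) * s * h \<le> G / \<sigma> * R + 3 * s * R" .
  define A where "A = N * K * H * (G / \<sigma>) * R"
  define E where "E = N * K * H * s * R"
  have AE: "0 \<le> A" "0 \<le> E"
    unfolding A_def E_def by (intro mult_nonneg_nonneg q0 H0 nn; use N R in linarith)+
  have "H / 2 * (K * (X0 + N * (4 * (G / \<sigma>) * R + sqrt (2 * L / \<sigma>) * s * h)))
      \<le> H / 2 * (K * (X0 + N * (4 * (G / \<sigma>) * R + (G / \<sigma> * R + 3 * s * R))))"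
    using N nn H0 noise by (intro mult_left_mono add_left_mono) auto
  also have "\<dots> = c1 / 2 + 5 / 2 * A + 3 / 2 * E"
    unfolding c1 A_def E_def by (simp add: field_simps)
  finally have GQ: "G * Q \<le> c1 / 2 + 5 / 2 * A + 3 / 2 * E" using Q by linarith
  have C1R: "c1 / 2 \<le> R * c1" and C6R: "3 * c6 \<le> R * (3 * c6)"
  proof -
    have "0 \<le> c1" unfolding c1 using nn H0 by simp
    then show "c1 / 2 \<le> R * c1" using mult_right_mono[OF R(1), of c1] by simp
    show "3 * c6 \<le> R * (3 * c6)" using mult_right_mono[OF R(1), of "3 * c6"] nn by simp
  qed
  have C2R: "c2 * R1 \<le> R * (6 / 5 * c2)"
    using mult_left_mono[OF R(2), of c2] N unfolding c2 by (simp add: mult_ac)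
  have cross: "N * Gc * (sqrt (2 / \<sigma>) * DP) \<le> R * (c2 / 5 + 14 / 5 * (N * Gc * (G / \<sigma>)))"
  proof -
    define w where "w = Gc * sqrt (2 / \<sigma>)"
    have w2: "w\<^sup>2 = 2 * Gc\<^sup>2 / \<sigma>" unfolding w_def using \<sigma> by (simp add: power_mult_distrib)
    have "0 \<le> DP\<^sup>2" by simp
    \<comment> \<open>The weights leave exactly \<open>1 / 5\<close> for \<open>DP\<^sup>2\<close>
      and, since \<open>w\<^sup>2 = 2 * Gc\<^sup>2 / \<sigma>\<close>, the coefficient
      \<open>14 / 5\<close> for \<open>c3\<close>.\<close>
    have "w * DP \<le> 7 / 5 * w\<^sup>2 + DP\<^sup>2 / 5"
    proof -
      have "0 \<le> (7 * w - 5 / 2 * DP)\<^sup>2" by simp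
      then have "35 * (w * DP) \<le> 49 * w\<^sup>2 + 25 / 4 * DP\<^sup>2" unfolding power2_diff by (simp add: power_mult_distrib power_divide mult_ac)
      with \<open>0 \<le> DP\<^sup>2\<close> show ?thesis by linarith
    qed
    also have "7 / 5 * w\<^sup>2 = 14 / 5 * (Gc * Gc / \<sigma>)" unfolding w2 by (simp add: power2_eq_square)
    also have "Gc * Gc / \<sigma> \<le> Gc * (G / \<sigma>)"
      using nn \<sigma> unfolding G by (simp add: field_simps)
    finally have "w * DP \<le> 14 / 5 * (Gc * (G / \<sigma>)) + DP\<^sup>2 / 5" by simp
    then have "N * (w * DP) \<le> N * (14 / 5 * (Gc * (G / \<sigma>)) + DP\<^sup>2 / 5)" using N by (intro mult_left_mono) auto
    then have 1: "N * Gc * (sqrt (2 / \<sigma>) * DP) \<le> c2 / 5 + 14 / 5 * (N * Gc * (G / \<sigma>))"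
      unfolding w_def c2 by (simp add: algebra_simps)
    have "0 \<le> c2 / 5 + 14 / 5 * (N * Gc * (G / \<sigma>))"
      unfolding c2 using N nn q0 by (intro add_nonneg_nonneg mult_nonneg_nonneg) auto
    from order_trans[OF 1 mult_right_mono[OF R(1) this, unfolded mult_1]] show ?thesis .
  qed
  have C4R: "4 * E + 6 * N * Gf * s * R \<le> R * (4 * c4)"
  proof -
    have "E * 1 \<le> E * N" using AE N by (intro mult_left_mono) auto
    moreover have "N * Gf * s * R * 1 \<le> N * H * s * R * N"
      using N nn H0 R GfH by (intro mult_mono) (auto intro!: mult_nonneg_nonneg)
    moreover have "0 \<le> N * H * s * R * N" "0 \<le> G * N\<^sup>2 * s * R"
      using N nn H0 G0 R by (auto intro!: mult_nonneg_nonneg)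
    moreover have "R * (4 * c4) = 16 * (N * H * s * R * N) + 4 * (E * N) + 4 * (G * N\<^sup>2 * s * R)"
      unfolding c4 E_def by (simp add: algebra_simps)
    ultimately show ?thesis by linarith
  qed
  have C3R: "14 / 5 * A + R * (14 / 5 * (N * Gc * (G / \<sigma>))) + N * Gf\<^sup>2 / \<sigma> * R \<le> R * (2 * sqrt 2 * c3)"
  proof -
    define Y where "Y = N * Gf\<^sup>2 / (2 * \<sigma>)"
    have Y: "0 \<le> Y" "N * Gf\<^sup>2 / \<sigma> = 2 * Y" unfolding Y_def using N \<sigma> by auto
    have nnH: "0 \<le> N * H * (G / \<sigma>)" "0 \<le> N * Gc * (G / \<sigma>)" "0 \<le> N * K * H * (G / \<sigma>)"
      by (intro mult_nonneg_nonneg q0 H0 nn; use N in linarith)+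
    have c3': "c3 = 4 * (N * H * (G / \<sigma>)) + N * K * H * (G / \<sigma>) + N * Gc * (G / \<sigma>) + Y"
      unfolding c3 Y_def by (simp add: algebra_simps)
    then have C3_0: "0 \<le> c3" using nnH Y by linarith
    have "14 / 5 * b + 14 / 5 * d + 2 * Y \<le> 14 / 5 * c3" if "c3 = 4 * a + b + d + Y" "0 \<le> a" for a b d
      using that Y(1) by linarith
    from this[OF c3' nnH(1)]
    have "14 / 5 * (N * K * H * (G / \<sigma>)) + 14 / 5 * (N * Gc * (G / \<sigma>)) + 2 * Y \<le> 14 / 5 * c3" .
    also have "\<dots> \<le> 2 * sqrt 2 * c3" using r2 C3_0 by (intro mult_right_mono) auto
    finally have "R * (14 / 5 * (N * K * H * (G / \<sigma>)) + 14 / 5 * (N * Gc * (G / \<sigma>)) + 2 * Y) \<le> R * (2 * sqrt 2 * c3)"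
      using R by (intro mult_left_mono) auto
    then show ?thesis unfolding A_def Y(2) by (simp add: algebra_simps)
  qed
  have C5R: "2 * c5 * R \<le> R * (2 * sqrt 2 * c5)"
  proof -
    have "1 * c5 \<le> sqrt 2 * c5" using c5 r2 by (intro mult_right_mono) auto
    then have "R * (2 * c5) \<le> R * (2 * (sqrt 2 * c5))" using R by (intro mult_left_mono) auto
    then show ?thesis by (simp add: mult_ac)
  qed
  have C2R': "R * (6 / 5 * c2) + R * (c2 / 5) \<le> R * (sqrt 2 * c2)"
  proof -
    have "7 / 5 * c2 \<le> sqrt 2 * c2" using r2 N unfolding c2 by (intro mult_right_mono) auto
    then have "R * (7 / 5 * c2) \<le> R * (sqrt 2 * c2)" using R by (intro mult_left_mono) auto
    then show ?thesis by (simp add: algebra_simps)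
  qed
  have "R * ((c1 + 3 * c6) + 4 * c4 + (sqrt 2 * c2 + 2 * sqrt 2 * c3 + 2 * sqrt 2 * c5 + Mt))
      = R * c1 + R * (3 * c6) + R * (4 * c4) + R * (sqrt 2 * c2) + R * (2 * sqrt 2 * c3)
        + R * (2 * sqrt 2 * c5) + Mt * R"
    by (simp add: algebra_simps)
  moreover have "R * (c2 / 5 + 14 / 5 * (N * Gc * (G / \<sigma>))) = R * (c2 / 5) + R * (14 / 5 * (N * Gc * (G / \<sigma>)))"
    by (rule distrib_left)
  ultimately show ?thesis
    using S GQ C1R C6R C2R cross C4R C3R C5R C2R' AE by linarith
qed

section \<open>Pathwise regret\<close>

text \<open>A single sample path: \<open>a\<close> are the sampled subgradients and \<open>m\<close>
  their conditional means given the past and the current noises. The mean \<open>m\<close> is a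
  subgradient of \<open>f\<close> at the query point, possibly outside \<open>X\<close>; accordingly
  \<open>f_Lipschitz\<close> leaves \<open>z\<close> unrestricted.\<close>

locale dscmd_path =
  smooth_mirror_map \<Phi> grad \<sigma> L + mixing_network P B \<theta>
  for \<Phi> :: "real^'n \<Rightarrow> real" and grad :: "real^'n \<Rightarrow> real^'n" and \<sigma> L :: real
    and P :: "nat \<Rightarrow> real^'v^'v::finite" and B :: nat and \<theta> :: real +
  fixes X :: "(real^'n) set" and f chi :: "'v \<Rightarrow> real^'n \<Rightarrow> real" and Gf \<nu> :: real
    and a m x y :: "'v \<Rightarrow> nat \<Rightarrow> real^'n" and \<xi> :: "'v \<Rightarrow> 'v \<Rightarrow> nat \<Rightarrow> real^'n"
  assumes X: "X \<noteq> {}" "convex X" "compact X"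
    and convex_f: "\<And>i. convex_on UNIV (f i)" and convex_chi: "\<And>i. convex_on UNIV (chi i)"
    and f_Lipschitz: "\<And>i u z. u \<in> X \<Longrightarrow> f i u - f i z \<le> Gf * norm (u - z)"
    and bregman_convex: "\<And>u (b :: 'v \<Rightarrow> real^'n) w. (\<And>i. 0 \<le> w i) \<Longrightarrow> (\<And>i. w i \<le> 1) \<Longrightarrow>
      (\<Sum>i\<in>UNIV. w i) = 1 \<Longrightarrow>
      bregman \<Phi> grad u (\<Sum>i\<in>UNIV. w i *\<^sub>R b i) \<le> (\<Sum>i\<in>UNIV. w i * bregman \<Phi> grad u (b i))"
    and x_0: "\<And>i. x i 0 \<in> X"
    and y_eq: "\<And>i t. y i t = (\<Sum>j\<in>UNIV. (P t $ i $ j) *\<^sub>R (x j t + (1 / (real t + 1)) *\<^sub>R \<xi> i j t))"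
    and x_Suc: "\<And>i t. is_prox_step X (chi i) (1 / sqrt (real t + 1)) (a i t) (y i t) (x i (Suc t))"
    and a_bound: "\<And>i t. norm (a i t) \<le> Gf"
    and xi_bound: "\<And>i j t. (norm (\<xi> i j t))\<^sup>2 \<le> \<nu>"
    and m_subgradient: "\<And>i t. m i t \<in> subdifferential (f i) (y i t)"
    and m_bound: "\<And>i t. norm (m i t) \<le> Gf"
begin

abbreviation "Gc \<equiv> subgradient_bound X chi"
abbreviation "DP \<equiv> bregman_diameter \<Phi> grad X"

definition "p i t = mix (P t) (\<lambda>j. x j t) i"

lemma x_in_X: "x i t \<in> X"
  using x_0 x_Suc unfolding is_prox_step_def is_arg_min_def by (cases t) auto

lemma p_in_X: "p i t \<in> X"
  unfolding p_def mix_def by (rule convex_sum) (use X x_in_X P_nonneg P_row in auto)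

lemma Gf_nonneg: "0 \<le> Gf"
  using a_bound norm_ge_zero order_trans by blast

lemma Gc_nonneg: "0 \<le> Gc"
  using subgradient_bound_Lipschitz(2)[where h = chi, OF convex_chi X(3)] X(1) by blast

lemma chi_Lipschitz: "u \<in> X \<Longrightarrow> chi i u - chi i z \<le> Gc * norm (u - z)"
  by (rule subgradient_bound_Lipschitz(1)[where h = chi, OF convex_chi X(3)])

lemma xi_norm: "norm (\<xi> i j t) \<le> sqrt \<nu>"
  using xi_bound by (rule real_le_rsqrt)

lemma nu_nonneg: "0 \<le> \<nu>"
  using xi_bound zero_le_power2 order_trans by blast

lemma DP_nonneg: "0 \<le> DP"
  using bregman_diameter_bound(2)[OF X(3)] X(1) by blast

lemma norm_diff_le: "u \<in> X \<Longrightarrow> v \<in> X \<Longrightarrow> norm (u - v) \<le> sqrt (2 / \<sigma>) * DP"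
  by (rule norm_le_bregman_diameter[OF X(3)])

lemma query_error: "norm (y i t - p i t) \<le> 1 / (real t + 1) * sqrt \<nu>"
proof -
  have "y i t - p i t = (\<Sum>j\<in>UNIV. (P t $ i $ j) *\<^sub>R ((1 / (real t + 1)) *\<^sub>R \<xi> i j t))"
    unfolding y_eq p_def mix_def by (simp add: sum_subtractf[symmetric] algebra_simps)
  also have "norm \<dots> \<le> (\<Sum>j\<in>UNIV. P t $ i $ j * (1 / (real t + 1) * sqrt \<nu>))"
    using P_nonneg xi_norm by (intro sum_norm_le) (auto intro!: mult_left_mono divide_right_mono)
  also have "\<dots> = 1 / (real t + 1) * sqrt \<nu>"
    unfolding sum_distrib_right[symmetric] P_row by (rule mult_1)
  finally show ?thesis .
qed

lemma displacement:
  "norm (x i (Suc t) - p i t)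
    \<le> 2 * (Gf + Gc) / \<sigma> * (1 / sqrt (real t + 1)) + sqrt (2 * L / \<sigma>) * sqrt \<nu> * (1 / (real t + 1))"
proof -
  have "norm (x i (Suc t) - p i t) \<le> 2 * (1 / sqrt (real t + 1)) * (Gf + Gc) / \<sigma>
      + sqrt (2 * L / \<sigma>) * norm (y i t - p i t)"
    by (rule prox_displacement[OF X(2,3) convex_chi _ x_Suc p_in_X a_bound])
      (use chi_Lipschitz p_in_X Gf_nonneg Gc_nonneg in auto)
  also have "\<dots> \<le> 2 * (1 / sqrt (real t + 1)) * (Gf + Gc) / \<sigma>
      + sqrt (2 * L / \<sigma>) * (1 / (real t + 1) * sqrt \<nu>)"
    using query_error[of i t] sigma_pos sigma_le_L by (intro add_left_mono mult_left_mono) auto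
  finally show ?thesis by (simp add: mult_ac)
qed

text \<open>The factor 3 is 1 for replacing \<open>f (p i t)\<close> by \<open>f (y i t)\<close> and
  2 for moving the sample error \<open>m - a\<close> from \<open>y i t - u\<close> to the
  predictable \<open>p i t - u\<close>. The proximal inequality yields \<open>chi\<close> only at
  the new state.\<close>

lemma agent_regret:
  assumes u: "u \<in> X"
  shows "f i (p i t) - f i u + chi i (x i (Suc t)) - chi i u
    \<le> 3 * Gf * sqrt \<nu> * (1 / (real t + 1)) + (m i t - a i t) \<bullet> (p i t - u)
      + sqrt (real t + 1) * (D u (y i t) - D u (x i (Suc t))) + 1 / sqrt (real t + 1) * Gf\<^sup>2 / (2 * \<sigma>)"
proof -
  let ?w = "norm (y i t - p i t)"
  have "f i (p i t) - f i (y i t) \<le> Gf * ?w"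
    using f_Lipschitz[OF p_in_X[of i t], of i "y i t"] by (simp add: norm_minus_commute)
  moreover have "f i (y i t) - f i u \<le> m i t \<bullet> (y i t - u)"
  proof -
    have "f i (y i t) + m i t \<bullet> (u - y i t) \<le> f i u"
      using m_subgradient[of i t] unfolding subdifferential_def by simp
    then show ?thesis by (simp add: inner_diff_right)
  qed
  moreover have "m i t \<bullet> (y i t - u)
      = a i t \<bullet> (y i t - u) + (m i t - a i t) \<bullet> (p i t - u) + (m i t - a i t) \<bullet> (y i t - p i t)"
    by (simp add: algebra_simps inner_diff_left inner_diff_right)
  moreover have "(m i t - a i t) \<bullet> (y i t - p i t) \<le> 2 * Gf * ?w"
  proof -
    have "norm (m i t - a i t) \<le> 2 * Gf"
      using norm_triangle_ineq4[of "m i t" "a i t"] m_bound[of i t] a_bound[of i t] by linarith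
    then show ?thesis
      by (rule order_trans[OF norm_cauchy_schwarz mult_right_mono]) simp
  qed
  moreover have "a i t \<bullet> (y i t - u) + chi i (x i (Suc t)) - chi i u
      \<le> sqrt (real t + 1) * (D u (y i t) - D u (x i (Suc t))) + 1 / sqrt (real t + 1) * Gf\<^sup>2 / (2 * \<sigma>)"
  proof -
    have "(norm (a i t))\<^sup>2 \<le> Gf\<^sup>2" using a_bound by (intro power_mono) auto
    then have "1 / sqrt (real t + 1) * (norm (a i t))\<^sup>2 / (2 * \<sigma>) \<le> 1 / sqrt (real t + 1) * Gf\<^sup>2 / (2 * \<sigma>)"
      using sigma_pos by (intro divide_right_mono mult_left_mono) auto
    with prox_regret[OF X(2,3) convex_chi _ x_Suc u, of t i] show ?thesis by simp
  qed
  moreover have "3 * Gf * ?w \<le> 3 * Gf * sqrt \<nu> * (1 / (real t + 1))"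
    using mult_left_mono[OF query_error[of i t], of "3 * Gf"] Gf_nonneg by (simp add: mult_ac)
  ultimately show ?thesis by linarith
qed

text \<open>Convexity of the divergence in its second argument moves the average outside, and unit
  column sums then return the total over the states. The noise costs \<open>bregman_perturb\<close>
  for each summand, with \<open>norm (x j t - u)\<close> bounded through the Bregman
  diameter.\<close>

lemma sum_bregman_query_le:
  assumes u: "u \<in> X"
  shows "(\<Sum>i\<in>UNIV. D u (y i t)) \<le> (\<Sum>j\<in>UNIV. D u (x j t))
    + C5 CARD('v) DP L \<sigma> \<nu> * (1 / (real t + 1)) + C6 CARD('v) L \<nu> * (1 / (real t + 1))\<^sup>2"
proof -
  let ?r = "1 / (real t + 1)"
  let ?e = "L * (?r * sqrt \<nu>) * (sqrt (2 / \<sigma>) * DP) + L * (?r\<^sup>2 * \<nu>)"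
  have L0: "0 \<le> L" using sigma_pos sigma_le_L by simp
  have pt: "D u (x j t + ?r *\<^sub>R \<xi> i j t) \<le> D u (x j t) + ?e" for i j
  proof -
    have n: "norm (?r *\<^sub>R \<xi> i j t) \<le> ?r * sqrt \<nu>" using xi_norm[of i j t] by (simp add: divide_right_mono)
    have "L * norm (?r *\<^sub>R \<xi> i j t) * norm (x j t - u) \<le> L * (?r * sqrt \<nu>) * (sqrt (2 / \<sigma>) * DP)"
      using L0 n nu_nonneg by (intro mult_mono mult_left_mono norm_diff_le x_in_X u) auto
    moreover have "L * (norm (?r *\<^sub>R \<xi> i j t))\<^sup>2 \<le> L * (?r * sqrt \<nu>)\<^sup>2"
      using L0 n by (intro mult_left_mono power_mono) auto
    moreover have "(?r * sqrt \<nu>)\<^sup>2 = ?r\<^sup>2 * \<nu>" using nu_nonneg by (simp only: power_mult_distrib real_sqrt_pow2)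
    ultimately have "D u (x j t) + L * norm (?r *\<^sub>R \<xi> i j t) * norm (x j t - u) + L * (norm (?r *\<^sub>R \<xi> i j t))\<^sup>2
        \<le> D u (x j t) + L * (?r * sqrt \<nu>) * (sqrt (2 / \<sigma>) * DP) + L * (?r\<^sup>2 * \<nu>)"
      by (intro add_mono order_refl) simp_all
    from order_trans[OF bregman_perturb this] show ?thesis by (simp only: add.assoc)
  qed
  have "D u (y i t) \<le> (\<Sum>j\<in>UNIV. P t $ i $ j * (D u (x j t) + ?e))" for i
  proof -
    have "D u (y i t) \<le> (\<Sum>j\<in>UNIV. P t $ i $ j * D u (x j t + ?r *\<^sub>R \<xi> i j t))"
      unfolding y_eq by (rule bregman_convex) (use P_nonneg P_le_1 P_row in auto)
    also have "\<dots> \<le> (\<Sum>j\<in>UNIV. P t $ i $ j * (D u (x j t) + ?e))"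
      using pt P_nonneg by (intro sum_mono mult_left_mono) auto
    finally show ?thesis .
  qed
  then have "(\<Sum>i\<in>UNIV. D u (y i t)) \<le> (\<Sum>i\<in>UNIV. \<Sum>j\<in>UNIV. P t $ i $ j * (D u (x j t) + ?e))"
    by (rule sum_mono)
  also have "\<dots> = (\<Sum>j\<in>UNIV. (\<Sum>i\<in>UNIV. P t $ i $ j) * (D u (x j t) + ?e))"
    by (subst sum.swap) (simp only: sum_distrib_right)
  also have "\<dots> = (\<Sum>j\<in>UNIV. D u (x j t)) + real CARD('v) * ?e"
    unfolding P_col by (simp only: mult_1 sum.distrib sum_constant distrib_left)
  also have "real CARD('v) * ?e = C5 CARD('v) DP L \<sigma> \<nu> * ?r + C6 CARD('v) L \<nu> * ?r\<^sup>2"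
    unfolding C5_def C6_def by (simp only: distrib_left mult_ac)
  finally show ?thesis by simp
qed

definition "F_gap l u t = objective f chi (x l t) - objective f chi u"
definition "mart u t = (\<Sum>i\<in>UNIV. (m i t - a i t) \<bullet> (p i t - u))"

text \<open>The gap needs \<open>chi i\<close> at \<open>x i t\<close>, whereas
  \<open>agent_regret\<close> has it at \<open>x i (Suc t)\<close>; the difference is kept separate
  because it telescopes over time.\<close>

lemma step_regret:
  assumes u: "u \<in> X"
  shows "F_gap l u t \<le> (Gf + Gc) * (\<Sum>j\<in>UNIV. norm (x l t - x j t))
    + ((\<Sum>i\<in>UNIV. chi i (x i t)) - (\<Sum>i\<in>UNIV. chi i (x i (Suc t))))
    + 3 * real CARD('v) * Gf * sqrt \<nu> * (1 / (real t + 1)) + mart u t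
    + sqrt (real t + 1) * ((\<Sum>i\<in>UNIV. D u (x i t)) - (\<Sum>i\<in>UNIV. D u (x i (Suc t))))
    + C5 CARD('v) DP L \<sigma> \<nu> * (1 / sqrt (real t + 1))
    + C6 CARD('v) L \<nu> * (1 / ((real t + 1) * sqrt (real t + 1)))
    + real CARD('v) * Gf\<^sup>2 / (2 * \<sigma>) * (1 / sqrt (real t + 1))"
proof -
  let ?r = "1 / (real t + 1)" and ?q = "sqrt (real t + 1)"
  have q: "?q > 0" "?q * ?q = real t + 1" by simp_all
  have "F_gap l u t = (\<Sum>i\<in>UNIV. f i (x l t) + chi i (x l t) - f i u - chi i u)"
    unfolding F_gap_def objective_def by (simp add: sum_subtractf sum.distrib)
  also have "\<dots> \<le> (\<Sum>i\<in>UNIV. Gf * norm (x l t - p i t) + Gc * norm (x l t - x i t)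
      + (chi i (x i t) - chi i (x i (Suc t)))
      + (3 * Gf * sqrt \<nu> * ?r + (m i t - a i t) \<bullet> (p i t - u)
        + ?q * (D u (y i t) - D u (x i (Suc t))) + 1 / ?q * Gf\<^sup>2 / (2 * \<sigma>)))"
  proof (rule sum_mono)
    fix i
    show "f i (x l t) + chi i (x l t) - f i u - chi i u \<le> Gf * norm (x l t - p i t) + Gc * norm (x l t - x i t)
      + (chi i (x i t) - chi i (x i (Suc t)))
      + (3 * Gf * sqrt \<nu> * ?r + (m i t - a i t) \<bullet> (p i t - u)
        + ?q * (D u (y i t) - D u (x i (Suc t))) + 1 / ?q * Gf\<^sup>2 / (2 * \<sigma>))"
      using agent_regret[OF u, of i t] f_Lipschitz[OF x_in_X[of l t], of i "p i t"]
        chi_Lipschitz[OF x_in_X[of l t], of i "x i t"] by linarith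
  qed
  also have "\<dots> = Gf * (\<Sum>i\<in>UNIV. norm (x l t - p i t)) + Gc * (\<Sum>i\<in>UNIV. norm (x l t - x i t))
      + ((\<Sum>i\<in>UNIV. chi i (x i t)) - (\<Sum>i\<in>UNIV. chi i (x i (Suc t))))
      + (real CARD('v) * (3 * Gf * sqrt \<nu> * ?r) + mart u t
        + ?q * ((\<Sum>i\<in>UNIV. D u (y i t)) - (\<Sum>i\<in>UNIV. D u (x i (Suc t))))
        + real CARD('v) * (1 / ?q * Gf\<^sup>2 / (2 * \<sigma>)))"
    unfolding mart_def
    by (simp only: sum.distrib sum_subtractf sum_distrib_left[symmetric] sum_constant) (simp only: mult_ac)
  finally have gap: "F_gap l u t \<le> Gf * (\<Sum>i\<in>UNIV. norm (x l t - p i t)) + Gc * (\<Sum>i\<in>UNIV. norm (x l t - x i t))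
      + ((\<Sum>i\<in>UNIV. chi i (x i t)) - (\<Sum>i\<in>UNIV. chi i (x i (Suc t))))
      + (real CARD('v) * (3 * Gf * sqrt \<nu> * ?r) + mart u t
        + ?q * ((\<Sum>i\<in>UNIV. D u (y i t)) - (\<Sum>i\<in>UNIV. D u (x i (Suc t))))
        + real CARD('v) * (1 / ?q * Gf\<^sup>2 / (2 * \<sigma>)))" .
  have pw: "(\<Sum>i\<in>UNIV. norm (x l t - p i t)) \<le> (\<Sum>j\<in>UNIV. norm (x l t - x j t))"
  proof -
    have "norm (x l t - p i t) \<le> (\<Sum>j\<in>UNIV. P t $ i $ j * norm (x l t - x j t))" for i
    proof -
      have "x l t - p i t = (\<Sum>j\<in>UNIV. (P t $ i $ j) *\<^sub>R x l t) - p i t"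
        using P_row[of t i] by (simp add: scaleR_sum_left[symmetric])
      also have "\<dots> = (\<Sum>j\<in>UNIV. (P t $ i $ j) *\<^sub>R (x l t - x j t))"
        unfolding p_def mix_def by (simp add: sum_subtractf scaleR_diff_right)
      also have "norm \<dots> \<le> (\<Sum>j\<in>UNIV. P t $ i $ j * norm (x l t - x j t))"
        using P_nonneg by (intro sum_norm_le) auto
      finally show ?thesis .
    qed
    then have "(\<Sum>i\<in>UNIV. norm (x l t - p i t)) \<le> (\<Sum>i\<in>UNIV. \<Sum>j\<in>UNIV. P t $ i $ j * norm (x l t - x j t))"
      by (rule sum_mono)
    also have "\<dots> = (\<Sum>j\<in>UNIV. norm (x l t - x j t))"
      by (subst sum.swap) (simp add: sum_distrib_right[symmetric] P_col)
    finally show ?thesis .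
  qed
  have "?q * ((\<Sum>i\<in>UNIV. D u (y i t)) - (\<Sum>i\<in>UNIV. D u (x i (Suc t))))
      \<le> ?q * ((\<Sum>i\<in>UNIV. D u (x i t)) + C5 CARD('v) DP L \<sigma> \<nu> * ?r + C6 CARD('v) L \<nu> * ?r\<^sup>2
          - (\<Sum>i\<in>UNIV. D u (x i (Suc t))))"
    using sum_bregman_query_le[OF u, of t] by (intro mult_left_mono) auto
  also have "\<dots> = ?q * ((\<Sum>i\<in>UNIV. D u (x i t)) - (\<Sum>i\<in>UNIV. D u (x i (Suc t))))
      + C5 CARD('v) DP L \<sigma> \<nu> * (?q * ?r) + C6 CARD('v) L \<nu> * (?q * ?r\<^sup>2)"
    by (simp only: distrib_left right_diff_distrib mult_ac add_ac)
  also have "?q * ?r = 1 / ?q" using q by (simp add: field_simps)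
  also have "?q * ?r\<^sup>2 = 1 / ((real t + 1) * ?q)"
  proof -
    have "z * (1 / (z * z))\<^sup>2 = 1 / ((z * z) * z)" if "z > 0" for z :: real
      using that by (simp add: field_simps power2_eq_square)
    from this[OF q(1)] show ?thesis unfolding q(2) .
  qed
  finally show ?thesis using gap mult_left_mono[OF pw Gf_nonneg] by (simp add: algebra_simps)
qed

lemma total_regret:
  assumes u: "u \<in> X" and T: "T \<ge> 3"
  shows "(\<Sum>t=1..T. F_gap l u t) \<le> (Gf + Gc) * (\<Sum>t=1..T. \<Sum>j\<in>UNIV. norm (x l t - x j t))
    + real CARD('v) * Gc * (sqrt (2 / \<sigma>) * DP) + 6 * real CARD('v) * Gf * sqrt \<nu> * sqrt (real T)
    + C2 CARD('v) DP * sqrt (real T + 1) + 2 * C5 CARD('v) DP L \<sigma> \<nu> * sqrt (real T)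
    + 3 * C6 CARD('v) L \<nu> + real CARD('v) * Gf\<^sup>2 / \<sigma> * sqrt (real T) + (\<Sum>t=1..T. mart u t)"
proof -
  let ?N = "real CARD('v)"
  let ?V = "\<lambda>t. \<Sum>i\<in>UNIV. D u (x i t)" and ?W = "\<lambda>t. \<Sum>i\<in>UNIV. chi i (x i t)"
  let ?a = "\<lambda>t. 1 / sqrt (real t + 1)"
  have "(\<Sum>t=1..T. F_gap l u t) \<le> (\<Sum>t=1..T. (Gf + Gc) * (\<Sum>j\<in>UNIV. norm (x l t - x j t))
      + (?W t - ?W (Suc t)) + 3 * ?N * Gf * sqrt \<nu> * (1 / (real t + 1)) + mart u t
      + sqrt (real t + 1) * (?V t - ?V (Suc t)) + C5 CARD('v) DP L \<sigma> \<nu> * ?a t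
      + C6 CARD('v) L \<nu> * (1 / ((real t + 1) * sqrt (real t + 1))) + ?N * Gf\<^sup>2 / (2 * \<sigma>) * ?a t)"
    by (intro sum_mono step_regret u)
  also have "\<dots> = (Gf + Gc) * (\<Sum>t=1..T. \<Sum>j\<in>UNIV. norm (x l t - x j t))
      + (\<Sum>t=1..T. ?W t - ?W (Suc t)) + 3 * ?N * Gf * sqrt \<nu> * (\<Sum>t=1..T. 1 / (real t + 1))
      + (\<Sum>t=1..T. mart u t) + (\<Sum>t=1..T. sqrt (real t + 1) * (?V t - ?V (Suc t)))
      + C5 CARD('v) DP L \<sigma> \<nu> * (\<Sum>t=1..T. ?a t)
      + C6 CARD('v) L \<nu> * (\<Sum>t=1..T. 1 / ((real t + 1) * sqrt (real t + 1)))
      + ?N * Gf\<^sup>2 / (2 * \<sigma>) * (\<Sum>t=1..T. ?a t)"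
    by (simp only: sum.distrib sum_distrib_left)
  finally have main: "(\<Sum>t=1..T. F_gap l u t) \<le> (Gf + Gc) * (\<Sum>t=1..T. \<Sum>j\<in>UNIV. norm (x l t - x j t))
      + (\<Sum>t=1..T. ?W t - ?W (Suc t)) + 3 * ?N * Gf * sqrt \<nu> * (\<Sum>t=1..T. 1 / (real t + 1))
      + (\<Sum>t=1..T. mart u t) + (\<Sum>t=1..T. sqrt (real t + 1) * (?V t - ?V (Suc t)))
      + C5 CARD('v) DP L \<sigma> \<nu> * (\<Sum>t=1..T. ?a t)
      + C6 CARD('v) L \<nu> * (\<Sum>t=1..T. 1 / ((real t + 1) * sqrt (real t + 1)))
      + ?N * Gf\<^sup>2 / (2 * \<sigma>) * (\<Sum>t=1..T. ?a t)" .
  have W: "(\<Sum>t=1..T. ?W t - ?W (Suc t)) \<le> ?N * Gc * (sqrt (2 / \<sigma>) * DP)"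
  proof -
    have "(\<Sum>t=1..T. ?W t - ?W (Suc t)) = ?W 1 - ?W (Suc T)"
      by (induction T) auto
    also have "\<dots> = (\<Sum>i\<in>UNIV. chi i (x i 1) - chi i (x i (Suc T)))" by (simp add: sum_subtractf)
    also have "\<dots> \<le> (\<Sum>i\<in>(UNIV :: 'v set). Gc * (sqrt (2 / \<sigma>) * DP))"
    proof (rule sum_mono)
      fix i
      show "chi i (x i 1) - chi i (x i (Suc T)) \<le> Gc * (sqrt (2 / \<sigma>) * DP)"
        using chi_Lipschitz[OF x_in_X[of i 1], of i "x i (Suc T)"]
          mult_left_mono[OF norm_diff_le[OF x_in_X[of i 1] x_in_X[of i "Suc T"]] Gc_nonneg] by linarith
    qed
    finally show ?thesis by (simp add: mult_ac)
  qed
  have V: "(\<Sum>t=1..T. sqrt (real t + 1) * (?V t - ?V (Suc t))) \<le> C2 CARD('v) DP * sqrt (real T + 1)"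
  proof -
    have "?V t \<le> C2 CARD('v) DP" for t
      using sum_bounded_above[of UNIV "\<lambda>i. D u (x i t)" "DP\<^sup>2"]
        bregman_diameter_bound(1)[OF X(3) u x_in_X] unfolding C2_def by simp
    then have "(\<Sum>t=1..T. sqrt (real t + 1) * (?V t - ?V (Suc t))) \<le> sqrt (real T + 1) * C2 CARD('v) DP"
      by (intro summation_by_parts_le) (auto intro!: sum_nonneg bregman_nonneg)
    then show ?thesis by (simp only: mult.commute)
  qed
  have r: "(\<Sum>t=1..T. 1 / (real t + 1)) \<le> 2 * sqrt (real T)"
  proof -
    have "sqrt (real t + 1) \<le> real t + 1" for t :: nat
      by (rule real_le_lsqrt) (auto simp: power2_eq_square algebra_simps)
    then have "(\<Sum>t=1..T. 1 / (real t + 1)) \<le> (\<Sum>t=1..T. ?a t)"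
      by (intro sum_mono frac_le) auto
    with sum_inverse_sqrt_le'[of T] show ?thesis by linarith
  qed
  have c: "(\<Sum>t=1..T. 1 / ((real t + 1) * sqrt (real t + 1))) \<le> 3"
  proof -
    have "(\<Sum>t=1..T. 1 / ((real t + 1) * sqrt (real t + 1))) \<le> (\<Sum>t<Suc T. 1 / ((real t + 1) * sqrt (real t + 1)))"
      by (intro sum_mono2) auto
    with sum_inverse_sqrt_cube_le[of "Suc T"] show ?thesis by linarith
  qed
  have nn: "0 \<le> 3 * ?N * Gf * sqrt \<nu>" "0 \<le> C5 CARD('v) DP L \<sigma> \<nu>" "0 \<le> C6 CARD('v) L \<nu>" "0 \<le> ?N * Gf\<^sup>2 / (2 * \<sigma>)"
    unfolding C5_def C6_def using Gf_nonneg nu_nonneg DP_nonneg sigma_pos sigma_le_L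
    by (auto intro!: mult_nonneg_nonneg)
  have half: "?N * Gf\<^sup>2 / (2 * \<sigma>) * (2 * sqrt (real T)) = ?N * Gf\<^sup>2 / \<sigma> * sqrt (real T)" by simp
  have six: "3 * ?N * Gf * sqrt \<nu> * (2 * sqrt (real T)) = 6 * ?N * Gf * sqrt \<nu> * sqrt (real T)" by simp
  have "(\<Sum>t=1..T. F_gap l u t) \<le> (Gf + Gc) * (\<Sum>t=1..T. \<Sum>j\<in>UNIV. norm (x l t - x j t))
      + ?N * Gc * (sqrt (2 / \<sigma>) * DP) + 3 * ?N * Gf * sqrt \<nu> * (2 * sqrt (real T))
      + (\<Sum>t=1..T. mart u t) + C2 CARD('v) DP * sqrt (real T + 1)
      + C5 CARD('v) DP L \<sigma> \<nu> * (2 * sqrt (real T)) + C6 CARD('v) L \<nu> * 3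
      + ?N * Gf\<^sup>2 / (2 * \<sigma>) * (2 * sqrt (real T))"
    by (rule order_trans[OF main])
      (intro add_mono order_refl W V mult_left_mono r c sum_inverse_sqrt_le' nn)
  then show ?thesis unfolding six half by (simp only: mult_ac add_ac)
qed

lemma disagreement_bound:
  defines "N \<equiv> real CARD('v)" and "G \<equiv> Gf + Gc"
  assumes T: "T \<ge> 1"
  shows "G * (\<Sum>t=1..T. \<Sum>j\<in>UNIV. norm (x l t - x j t))
    \<le> ((N + 1) * Gf + N * Gc) / 2 * (2 * N * mixing_const CARD('v) \<theta> B *
        ((\<Sum>j\<in>UNIV. norm (x j 0)) + N * (4 * (G / \<sigma>) * sqrt (real T)
          + sqrt (2 * L / \<sigma>) * sqrt \<nu> * (\<Sum>t<T. 1 / (real t + 1)))))"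
proof -
  let ?Q = "\<Sum>t=1..T. \<Sum>j\<in>UNIV. norm (x l t - x j t)"
  let ?H = "(N + 1) * Gf + N * Gc" and ?h = "\<Sum>t<T. 1 / (real t + 1)"
  let ?X0 = "\<Sum>j\<in>UNIV. norm (x j 0)"
  let ?K = "2 * N * mixing_const CARD('v) \<theta> B"
  let ?R = "?K * (?X0 + N * (4 * (G / \<sigma>) * sqrt (real T) + sqrt (2 * L / \<sigma>) * sqrt \<nu> * ?h))"
  define E where "E t i = x i (Suc t) - p i t" for t i
  have N1: "1 \<le> N" unfolding N_def by (rule N_pos)
  have G0: "0 \<le> G" unfolding G_def using Gf_nonneg Gc_nonneg by simp
  have K0: "0 \<le> ?K" using N1 mixing_const_nonneg by simp
  have L0: "0 \<le> sqrt (2 * L / \<sigma>) * sqrt \<nu>" using sigma_pos sigma_le_L nu_nonneg by simp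
  have "?Q \<le> ?K * (?X0 + (\<Sum>t<T. \<Sum>i\<in>UNIV. norm (E t i)))"
    unfolding N_def
    by (rule sum_disagreement_le[of "\<lambda>t i. x i t" E, OF _ T]) (simp add: E_def p_def)
  also have "\<dots> \<le> ?R"
  proof (intro mult_left_mono add_left_mono)
    have "(\<Sum>i\<in>UNIV. norm (E t i)) \<le> N * (2 * G / \<sigma> * (1 / sqrt (real t + 1))
        + sqrt (2 * L / \<sigma>) * sqrt \<nu> * (1 / (real t + 1)))" for t
      unfolding N_def G_def E_def using sum_bounded_above[of UNIV "\<lambda>i. norm (x i (Suc t) - p i t)"] displacement by simp
    then have "(\<Sum>t<T. \<Sum>i\<in>UNIV. norm (E t i)) \<le> (\<Sum>t<T. N * (2 * G / \<sigma> * (1 / sqrt (real t + 1))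
        + sqrt (2 * L / \<sigma>) * sqrt \<nu> * (1 / (real t + 1))))"
      by (rule sum_mono)
    also have "\<dots> = N * (2 * G / \<sigma> * (\<Sum>t<T. 1 / sqrt (real t + 1)) + sqrt (2 * L / \<sigma>) * sqrt \<nu> * ?h)"
      by (simp only: sum.distrib sum_distrib_left distrib_left)
    also have "\<dots> \<le> N * (2 * G / \<sigma> * (2 * sqrt (real T)) + sqrt (2 * L / \<sigma>) * sqrt \<nu> * ?h)"
      using N1 G0 sigma_pos by (intro mult_left_mono add_right_mono sum_inverse_sqrt_le) auto
    also have "2 * G / \<sigma> * (2 * sqrt (real T)) = 4 * (G / \<sigma>) * sqrt (real T)" by simp
    finally show "(\<Sum>t<T. \<Sum>i\<in>UNIV. norm (E t i))
        \<le> N * (4 * (G / \<sigma>) * sqrt (real T) + sqrt (2 * L / \<sigma>) * sqrt \<nu> * ?h)" .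
  qed (rule K0)
  finally have Q: "?Q \<le> ?R" .
  have Q0: "0 \<le> ?Q" by (intro sum_nonneg) auto
  \<comment> \<open>From two agents on, \<open>G \<le> ?H / 2\<close>; a single agent has no
    disagreement at all. The half is needed later: without it the disagreement would exceed the
    budget of \<open>C3\<close>.\<close>
  have "G * ?Q \<le> ?H / 2 * ?Q"
  proof (cases "CARD('v) = 1")
    case True
    then have "j = l" for j using card_le_Suc0_iff_eq[of "UNIV :: 'v set"] by simp
    then have "norm (x l t - x j t) = 0" for j t by (metis diff_self norm_zero)
    then have "?Q = 0" by (intro sum.neutral ballI)
    then show ?thesis by (simp only: mult_zero_right)
  next
    case False
    then have "2 \<le> N" unfolding N_def using N_pos by linarith
    then have "2 * Gf \<le> N * Gf" "2 * Gc \<le> N * Gc" using Gf_nonneg Gc_nonneg by (auto intro: mult_right_mono)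
    then have "G \<le> ?H / 2" unfolding G_def using Gf_nonneg by (simp add: algebra_simps)
    then show ?thesis using Q0 by (rule mult_right_mono)
  qed
  also have "\<dots> \<le> ?H / 2 * ?R"
    using Q N1 Gf_nonneg Gc_nonneg by (intro mult_left_mono) auto
  finally show ?thesis .
qed

lemma F_gap_le: "u \<in> X \<Longrightarrow> F_gap l u t \<le> real CARD('v) * ((Gf + Gc) * (sqrt (2 / \<sigma>) * DP))"
proof -
  assume u: "u \<in> X"
  have "F_gap l u t = (\<Sum>i\<in>UNIV. f i (x l t) - f i u + (chi i (x l t) - chi i u))"
    unfolding F_gap_def objective_def by (simp add: sum_subtractf sum.distrib)
  also have "\<dots> \<le> (\<Sum>i\<in>(UNIV :: 'v set). (Gf + Gc) * (sqrt (2 / \<sigma>) * DP))"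
  proof (rule sum_mono)
    fix i
    have "f i (x l t) - f i u + (chi i (x l t) - chi i u) \<le> (Gf + Gc) * norm (x l t - u)"
      using f_Lipschitz[OF x_in_X[of l t], of i u] chi_Lipschitz[OF x_in_X[of l t], of i u]
      by (simp add: distrib_right)
    also have "\<dots> \<le> (Gf + Gc) * (sqrt (2 / \<sigma>) * DP)"
      using norm_diff_le[OF x_in_X[of l t] u] Gf_nonneg Gc_nonneg by (intro mult_left_mono) auto
    finally show "f i (x l t) - f i u + (chi i (x l t) - chi i u) \<le> (Gf + Gc) * (sqrt (2 / \<sigma>) * DP)" .
  qed
  finally show ?thesis by simp
qed

lemma objective_average_le:
  assumes T: "T \<ge> 1"
  shows "objective f chi ((1 / real T) *\<^sub>R (\<Sum>t=1..T. x l t)) - objective f chi u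
    \<le> (\<Sum>t=1..T. F_gap l u t) / real T"
proof -
  have "convex_on UNIV (objective f chi)"
  proof -
    have "convex_on UNIV (\<lambda>u. \<Sum>i\<in>A. f i u + chi i u)" if "finite A" for A
      using that by induction (simp_all add: convex_on_add convex_f convex_chi convex_on_const)
    moreover have "objective f chi = (\<lambda>u. \<Sum>i\<in>UNIV. f i u + chi i u)" unfolding objective_def by auto
    ultimately show ?thesis by simp
  qed
  then have "objective f chi (\<Sum>t=1..T. (1 / real T) *\<^sub>R x l t) \<le> (\<Sum>t=1..T. 1 / real T * objective f chi (x l t))"
    by (intro convex_on_sum) (use T in auto)
  also have "\<dots> = (\<Sum>t=1..T. F_gap l u t) / real T + objective f chi u"
    unfolding F_gap_def using T by (simp add: sum_subtractf sum_distrib_left[symmetric] field_simps sum_divide_distrib[symmetric])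
  finally show ?thesis by (simp add: scaleR_sum_right)
qed

text \<open>Chance enters only through the hypothesis \<open>mart\<close>, which is Azuma's bound
  for increments of size \<open>2 * Gf * diameter X * N\<close>; splitting off \<open>sqrt T\<close>
  from it leaves the last term of \<open>C_delta\<close>.\<close>

theorem objective_gap_bound:
  assumes u: "u \<in> X" and T: "T \<ge> 3" and \<delta>: "0 < \<delta>" "\<delta> < 1"
    and mart: "(\<Sum>t=1..T. mart u t) \<le> 2 * Gf * diameter X * real CARD('v) * sqrt (2 * real T * ln (1 / \<delta>))"
  shows "objective f chi ((1 / real T) *\<^sub>R (\<Sum>t=1..T. x l t)) - objective f chi u
    \<le> 3 * C_delta CARD('v) \<theta> B Gf Gc \<sigma> L \<nu> DP (diameter X) (\<lambda>i. x i 0) \<delta> / sqrt (real T)"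
proof -
  define N where "N = real CARD('v)"
  define G where "G = Gf + Gc"
  define H where "H = (N + 1) * Gf + N * Gc"
  define K where "K = 2 * N * mixing_const CARD('v) \<theta> B"
  define X0 where "X0 = (\<Sum>j\<in>UNIV. norm (x j 0))"
  define R where "R = sqrt (real T)"
  define s where "s = sqrt \<nu>"
  define h where "h = (\<Sum>t<T. 1 / (real t + 1))"
  define Mt where "Mt = 2 * sqrt 2 * Gf * diameter X * N * sqrt (ln (1 / \<delta>))"
  define S where "S = (\<Sum>t=1..T. F_gap l u t)"
  define Q where "Q = (\<Sum>t=1..T. \<Sum>j\<in>UNIV. norm (x l t - x j t))"
  define c1 where "c1 = C1 CARD('v) \<theta> B Gf Gc (\<lambda>i. x i 0)"
  define c2 where "c2 = C2 CARD('v) DP"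
  define c3 where "c3 = C3 CARD('v) \<theta> B Gf Gc \<sigma>"
  define c4 where "c4 = C4 CARD('v) \<theta> B Gf Gc \<nu>"
  define c5 where "c5 = C5 CARD('v) DP L \<sigma> \<nu>"
  define c6 where "c6 = C6 CARD('v) L \<nu>"
  define cd where "cd = C_delta CARD('v) \<theta> B Gf Gc \<sigma> L \<nu> DP (diameter X) (\<lambda>i. x i 0) \<delta>"
  have N1: "1 \<le> N" unfolding N_def by (rule N_pos)
  have G0: "0 \<le> G" unfolding G_def using Gf_nonneg Gc_nonneg by simp
  have K0: "0 \<le> K" unfolding K_def using N1 mixing_const_nonneg by simp
  have L0: "0 \<le> L" using sigma_pos sigma_le_L by simp
  have R1: "1 \<le> R" and RR: "R * R = real T" unfolding R_def using T by auto
  \<comment> \<open>After squaring this is \<open>T + 1 \<le> 36 / 25 * T\<close>, which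
    \<open>T \<ge> 3\<close> provides.\<close>
  have R2: "sqrt (real T + 1) \<le> 6 / 5 * R"
  proof (rule real_le_lsqrt)
    have "(6 / 5 * R)\<^sup>2 = 36 / 25 * real T" using RR by (simp add: power2_eq_square)
    then show "real T + 1 \<le> (6 / 5 * R)\<^sup>2" using T by simp
  qed (use R1 in auto)
  have l0: "0 \<le> ln (1 / \<delta>)" using \<delta> by simp
  have Mt: "(\<Sum>t=1..T. mart u t) \<le> Mt * R"
  proof -
    have "2 * Gf * diameter X * real CARD('v) * sqrt (2 * real T * ln (1 / \<delta>)) = Mt * R"
      unfolding Mt_def R_def N_def by (simp only: real_sqrt_mult mult_ac)
    with mart show ?thesis by simp
  qed
  have nn: "0 \<le> c1" "0 \<le> c2" "0 \<le> c3" "0 \<le> c5" "0 \<le> c6" "0 \<le> Mt" "0 \<le> c4"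
  proof -
    have q: "0 \<le> omega_const CARD('v) \<theta> / (1 - gamma_const CARD('v) \<theta> B)"
      using mixing_const_nonneg unfolding mixing_const_def .
    have q1: "0 \<le> 2 * real CARD('v) * omega_const CARD('v) \<theta> / (1 - gamma_const CARD('v) \<theta> B)"
      "0 \<le> 2 * (real CARD('v))\<^sup>2 * omega_const CARD('v) \<theta> / (1 - gamma_const CARD('v) \<theta> B)"
      using mult_nonneg_nonneg[OF _ q, of "2 * real CARD('v)"] mult_nonneg_nonneg[OF _ q, of "2 * (real CARD('v))\<^sup>2"]
      by simp_all
    have H0: "0 \<le> (real CARD('v) + 1) * Gf + real CARD('v) * Gc" using Gf_nonneg Gc_nonneg by simp
    show "0 \<le> c1" unfolding c1_def C1_def by (intro mult_nonneg_nonneg q1 H0 sum_nonneg) auto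
    show "0 \<le> c2" unfolding c2_def C2_def by simp
    show "0 \<le> c3" unfolding c3_def C3_def
      by (intro add_nonneg_nonneg mult_nonneg_nonneg q1 H0 divide_nonneg_nonneg) (use Gf_nonneg Gc_nonneg sigma_pos in auto)
    show "0 \<le> c4" unfolding c4_def C4_def
      by (intro add_nonneg_nonneg mult_nonneg_nonneg q1 H0) (use Gf_nonneg Gc_nonneg nu_nonneg in auto)
    show "0 \<le> c5" unfolding c5_def C5_def using DP_nonneg L0 nu_nonneg sigma_pos by simp
    show "0 \<le> c6" unfolding c6_def C6_def using L0 nu_nonneg by simp
    show "0 \<le> Mt" unfolding Mt_def
      by (intro mult_nonneg_nonneg) (use Gf_nonneg N1 l0 diameter_ge_0[OF compact_imp_bounded[OF X(3)]] in auto)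
  qed
  have cd: "c1 + 3 * c6 \<le> cd" "4 * c4 \<le> cd"
    "sqrt 2 * c2 + 2 * sqrt 2 * c3 + 2 * sqrt 2 * c5 + Mt \<le> cd"
    unfolding cd_def C_delta_def c1_def c2_def c3_def c4_def c5_def c6_def Mt_def N_def by (intro Max_ge; simp)+
  \<comment> \<open>In the first case the noise is so large that the Lipschitz bound for the objective suffices.\<close>
  have S: "S \<le> R * (3 * cd)"
  proof (cases "G * R \<le> L * s")
    case True
    have "S \<le> real T * (N * (G * (sqrt (2 / \<sigma>) * DP)))"
      unfolding S_def N_def G_def
      using sum_bounded_above[of "{1..T}" "F_gap l u"] F_gap_le[OF u, of l] by simp
    also have "\<dots> = R * (N * ((G * R) * (sqrt (2 / \<sigma>) * DP)))" unfolding RR[symmetric] by (simp only: mult_ac)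
    also have "\<dots> \<le> R * (N * ((L * s) * (sqrt (2 / \<sigma>) * DP)))"
      using True R1 N1 DP_nonneg sigma_pos by (intro mult_left_mono mult_right_mono) auto
    also have "\<dots> = R * c5" unfolding c5_def C5_def s_def N_def by (simp only: mult_ac)
    also have "\<dots> \<le> R * (3 * cd)"
    proof (rule mult_left_mono)
      have "1 \<le> sqrt (2 :: real)" by simp
      then have "1 \<le> 2 * sqrt (2 :: real)" by linarith
      then have "1 * c5 \<le> 2 * sqrt 2 * c5" using nn(4) by (rule mult_right_mono)
      moreover have "0 \<le> sqrt 2 * c2" "0 \<le> 2 * sqrt 2 * c3" using nn by auto
      ultimately show "c5 \<le> 3 * cd" using cd(3) nn by linarith
    qed (use R1 in simp)
    finally show ?thesis .
  next
    case False
    have "S \<le> R * ((c1 + 3 * c6) + 4 * c4 + (sqrt 2 * c2 + 2 * sqrt 2 * c3 + 2 * sqrt 2 * c5 + Mt))"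
    proof (rule regret_arithmetic[where N = N and K = K and H = H and G = G and Gf = Gf and Gc = Gc and \<sigma> = \<sigma>
          and L = L and s = s and ?X0.0 = X0 and DP = DP and R = R and h = h and ?R1.0 = "sqrt (real T + 1)" and Q = Q])
      show "h\<^sup>2 \<le> 6 * R" unfolding h_def R_def by (rule harmonic_square_le)
      show "G * Q \<le> H / 2 * (K * (X0 + N * (4 * (G / \<sigma>) * R + sqrt (2 * L / \<sigma>) * s * h)))"
        unfolding G_def Q_def H_def K_def X0_def N_def R_def s_def h_def
        using disagreement_bound[of T l] T by simp
      show "c1 = K * H * X0"
        unfolding c1_def C1_def K_def H_def X0_def N_def mixing_const_def by simp
      show "c3 = ((4 * N + N * K) * H + N * Gc) * (G / \<sigma>) + N * Gf\<^sup>2 / (2 * \<sigma>)"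
        unfolding c3_def C3_def K_def H_def N_def G_def mixing_const_def by (simp add: power2_eq_square mult_ac)
      show "c4 = (4 * N + N * K) * H * N * s + G * N\<^sup>2 * s"
        unfolding c4_def C4_def K_def H_def N_def G_def s_def mixing_const_def by (simp add: power2_eq_square mult_ac)
      show "S \<le> G * Q + N * Gc * (sqrt (2 / \<sigma>) * DP) + 6 * N * Gf * s * R + c2 * sqrt (real T + 1)
          + 2 * c5 * R + 3 * c6 + N * Gf\<^sup>2 / \<sigma> * R + Mt * R"
        using total_regret[OF u T, of l] Mt
        unfolding S_def G_def Q_def N_def s_def R_def c2_def c5_def c6_def by linarith
    qed (use N1 K0 R1 R2 False nn Gf_nonneg Gc_nonneg nu_nonneg DP_nonneg sigma_pos sigma_le_L in
        \<open>auto simp: s_def X0_def h_def G_def H_def c2_def C2_def N_def intro!: sum_nonneg\<close>)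
    \<comment> \<open>The three groups are the three entries of the maximum, hence the factor 3 of
      the final bound.\<close>
    also have "\<dots> \<le> R * (3 * cd)" using cd R1 by (intro mult_left_mono) auto
    finally show ?thesis .
  qed
  have "objective f chi ((1 / real T) *\<^sub>R (\<Sum>t=1..T. x l t)) - objective f chi u \<le> S / real T"
    unfolding S_def using objective_average_le[of T l u] T by simp
  also have "\<dots> \<le> R * (3 * cd) / real T" using S by (intro divide_right_mono) auto
  also have "\<dots> = 3 * cd / R" unfolding RR[symmetric] using R1 by simp
  finally show ?thesis unfolding cd_def R_def .
qed

end

section \<open>Conditional expectations\<close>

lemma borel_measurable_vec_nth [measurable (raw)]:
  fixes f :: "'w \<Rightarrow> real^'n"
  assumes "f \<in> borel_measurable N"
  shows "(\<lambda>\<omega>. f \<omega> $ k) \<in> borel_measurable N"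
  unfolding cart_eq_inner_axis using assms by measurable

lemma borel_measurable_vecI:
  fixes f :: "'w \<Rightarrow> real^'n"
  assumes "\<And>k. (\<lambda>\<omega>. f \<omega> $ k) \<in> borel_measurable N"
  shows "f \<in> borel_measurable N"
  using assms by (subst borel_measurable_euclidean_space, auto simp: Basis_vec_def cart_eq_inner_axis[symmetric])

text \<open>Pairing with the direction \<open>h = sgn m\<close>, which is
  \<open>H\<close>-measurable and can be pulled out, reduces the vector bound to a scalar one:
  \<open>norm m\<close> is the conditional mean of \<open>h \<bullet> S\<close>, at most
  \<open>c\<close>.\<close>

lemma AE_norm_cond_exp_le:
  fixes S m :: "'w \<Rightarrow> real^'n"
  assumes M: "prob_space M" and H: "subalgebra M H"
    and S: "S \<in> borel_measurable M" "AE \<omega> in M. norm (S \<omega>) \<le> c"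
    and m: "\<And>\<omega>. m \<omega> = (\<chi> k. real_cond_exp M H (\<lambda>\<omega>. S \<omega> $ k) \<omega>)"
  shows "AE \<omega> in M. norm (m \<omega>) \<le> c"
proof -
  interpret prob_space M by (rule M)
  interpret finite_measure_subalgebra M H using H by unfold_locales
  have m_meas: "m \<in> borel_measurable H"
    by (rule borel_measurable_vecI) (simp add: m)
  define h where "h \<omega> = sgn (m \<omega>)" for \<omega>
  have h: "(\<lambda>\<omega>. h \<omega> $ k) \<in> borel_measurable H" for k
    unfolding h_def sgn_div_norm using m_meas by measurable
  have hM: "(\<lambda>\<omega>. h \<omega> $ k) \<in> borel_measurable M" and SM: "(\<lambda>\<omega>. S \<omega> $ k) \<in> borel_measurable M" for k
    using measurable_from_subalg[OF H h] S(1) by measurable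
  have h1: "\<bar>h \<omega> $ k\<bar> \<le> 1" for \<omega> k
    using component_le_norm_cart[of "h \<omega>" k] unfolding h_def norm_sgn by (auto split: if_splits)
  have int: "integrable M (\<lambda>\<omega>. h \<omega> $ k * S \<omega> $ k)" for k
  proof (rule integrable_const_bound[of _ c])
    show "AE \<omega> in M. norm (h \<omega> $ k * S \<omega> $ k) \<le> c"
      using S(2)
    proof eventually_elim
      case (elim \<omega>)
      have "\<bar>h \<omega> $ k\<bar> * \<bar>S \<omega> $ k\<bar> \<le> 1 * c"
        using h1 component_le_norm_cart[of "S \<omega>" k] elim by (intro mult_mono) auto
      then show ?case by (simp add: abs_mult)
    qed
  qed (use hM SM in measurable)
  have "AE \<omega> in M. \<forall>k\<in>UNIV. real_cond_exp M H (\<lambda>\<omega>. h \<omega> $ k * S \<omega> $ k) \<omega>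
      = h \<omega> $ k * real_cond_exp M H (\<lambda>\<omega>. S \<omega> $ k) \<omega>"
    by (intro AE_finite_allI real_cond_exp_mult h SM int) simp
  moreover have "AE \<omega> in M. real_cond_exp M H (\<lambda>\<omega>. \<Sum>k\<in>UNIV. h \<omega> $ k * S \<omega> $ k) \<omega>
      = (\<Sum>k\<in>UNIV. real_cond_exp M H (\<lambda>\<omega>. h \<omega> $ k * S \<omega> $ k) \<omega>)"
    by (rule real_cond_exp_sum) (rule int)
  moreover have "AE \<omega> in M. real_cond_exp M H (\<lambda>\<omega>. \<Sum>k\<in>UNIV. h \<omega> $ k * S \<omega> $ k) \<omega> \<le> c"
  proof (rule real_cond_exp_le_c)
    show "AE \<omega> in M. (\<Sum>k\<in>UNIV. h \<omega> $ k * S \<omega> $ k) \<le> c"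
      using S(2)
    proof eventually_elim
      case (elim \<omega>)
      have "(\<Sum>k\<in>UNIV. h \<omega> $ k * S \<omega> $ k) = h \<omega> \<bullet> S \<omega>" unfolding inner_vec_def by simp
      also have "\<dots> \<le> norm (h \<omega>) * norm (S \<omega>)" by (rule norm_cauchy_schwarz)
      also have "\<dots> \<le> 1 * norm (S \<omega>)" unfolding h_def norm_sgn by (intro mult_right_mono) auto
      finally show ?case using elim by simp
    qed
  qed (use int in auto)
  ultimately show ?thesis
  proof eventually_elim
    case (elim \<omega>)
    have "norm (m \<omega>) = h \<omega> \<bullet> m \<omega>"
      unfolding h_def by (cases "m \<omega> = 0") (simp_all add: sgn_div_norm power2_norm_eq_inner[symmetric] power2_eq_square)
    also have "\<dots> = (\<Sum>k\<in>UNIV. h \<omega> $ k * real_cond_exp M H (\<lambda>\<omega>. S \<omega> $ k) \<omega>)"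
      unfolding inner_vec_def by (simp add: m)
    finally show ?case using elim by simp
  qed
qed

text \<open>Coordinatewise, \<open>q\<close> is known to \<open>H\<close> and can be pulled out, and
  what remains is the centred coordinate of \<open>S\<close>. These are the martingale
  differences.\<close>

lemma cond_exp_predictable_inner:
  fixes S m q :: "'w \<Rightarrow> real^'n"
  assumes M: "prob_space M" and H: "subalgebra M H"
    and S: "S \<in> borel_measurable M" "AE \<omega> in M. norm (S \<omega>) \<le> c"
    and m: "\<And>\<omega>. m \<omega> = (\<chi> k. real_cond_exp M H (\<lambda>\<omega>. S \<omega> $ k) \<omega>)"
    and q: "q \<in> borel_measurable H" "\<And>\<omega>. \<omega> \<in> space M \<Longrightarrow> norm (q \<omega>) \<le> d"
  shows "integrable M (\<lambda>\<omega>. (m \<omega> - S \<omega>) \<bullet> q \<omega>)"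
    and "AE \<omega> in M. real_cond_exp M H (\<lambda>\<omega>. (m \<omega> - S \<omega>) \<bullet> q \<omega>) \<omega> = 0"
proof -
  interpret prob_space M by (rule M)
  interpret finite_measure_subalgebra M H using H by unfold_locales
  define mk where "mk k = real_cond_exp M H (\<lambda>\<omega>. S \<omega> $ k)" for k
  have Sk: "(\<lambda>\<omega>. S \<omega> $ k) \<in> borel_measurable M" for k using S(1) by measurable
  have iS: "integrable M (\<lambda>\<omega>. S \<omega> $ k)" for k
    by (rule integrable_const_bound[of _ c])
      (use S(2) Sk in \<open>auto elim!: eventually_mono intro: order_trans[OF component_le_norm_cart]\<close>)
  have im: "integrable M (mk k)" for k unfolding mk_def by (rule real_cond_exp_int(1)[OF iS])
  have mH: "mk k \<in> borel_measurable H" for k unfolding mk_def by simp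
  have qk: "(\<lambda>\<omega>. q \<omega> $ k) \<in> borel_measurable H" for k using q(1) by measurable
  have qM: "(\<lambda>\<omega>. q \<omega> $ k) \<in> borel_measurable M" for k by (rule measurable_from_subalg[OF H qk])
  have idiff: "integrable M (\<lambda>\<omega>. mk k \<omega> - S \<omega> $ k)" for k using im iS by simp
  have int: "integrable M (\<lambda>\<omega>. q \<omega> $ k * (mk k \<omega> - S \<omega> $ k))" for k
  proof (rule Bochner_Integration.integrable_bound[of _ "\<lambda>\<omega>. d * (mk k \<omega> - S \<omega> $ k)"])
    show "integrable M (\<lambda>\<omega>. d * (mk k \<omega> - S \<omega> $ k))" using idiff by simp
    show "AE \<omega> in M. norm (q \<omega> $ k * (mk k \<omega> - S \<omega> $ k)) \<le> norm (d * (mk k \<omega> - S \<omega> $ k))"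
    proof (rule AE_I2)
      fix \<omega> assume "\<omega> \<in> space M"
      then have "\<bar>q \<omega> $ k\<bar> \<le> \<bar>d\<bar>"
        using q(2)[of \<omega>] component_le_norm_cart[of "q \<omega>" k] by linarith
      then show "norm (q \<omega> $ k * (mk k \<omega> - S \<omega> $ k)) \<le> norm (d * (mk k \<omega> - S \<omega> $ k))"
        by (auto simp: abs_mult intro!: mult_right_mono)
    qed
  qed (use qM borel_measurable_integrable[OF idiff[of k]] in measurable)
  have eq: "(m \<omega> - S \<omega>) \<bullet> q \<omega> = (\<Sum>k\<in>UNIV. q \<omega> $ k * (mk k \<omega> - S \<omega> $ k))" for \<omega>
    unfolding inner_vec_def by (simp add: m mk_def mult.commute)
  show "integrable M (\<lambda>\<omega>. (m \<omega> - S \<omega>) \<bullet> q \<omega>)" unfolding eq using int by simp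
  have "AE \<omega> in M. \<forall>k\<in>UNIV. real_cond_exp M H (\<lambda>\<omega>. q \<omega> $ k * (mk k \<omega> - S \<omega> $ k)) \<omega> = 0"
  proof (rule AE_finite_allI)
    fix k
    have "AE \<omega> in M. real_cond_exp M H (\<lambda>\<omega>. q \<omega> $ k * (mk k \<omega> - S \<omega> $ k)) \<omega>
        = q \<omega> $ k * real_cond_exp M H (\<lambda>\<omega>. mk k \<omega> - S \<omega> $ k) \<omega>"
      by (rule real_cond_exp_mult[OF qk borel_measurable_integrable[OF idiff] int])
    moreover have "AE \<omega> in M. real_cond_exp M H (\<lambda>\<omega>. mk k \<omega> - S \<omega> $ k) \<omega>
        = real_cond_exp M H (mk k) \<omega> - real_cond_exp M H (\<lambda>\<omega>. S \<omega> $ k) \<omega>"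
      by (rule real_cond_exp_diff[OF im iS])
    moreover have "AE \<omega> in M. real_cond_exp M H (mk k) \<omega> = mk k \<omega>"
      by (rule real_cond_exp_F_meas[OF im mH])
    ultimately show "AE \<omega> in M. real_cond_exp M H (\<lambda>\<omega>. q \<omega> $ k * (mk k \<omega> - S \<omega> $ k)) \<omega> = 0"
      by eventually_elim (simp add: mk_def)
  qed simp
  moreover have "AE \<omega> in M. real_cond_exp M H (\<lambda>\<omega>. \<Sum>k\<in>UNIV. q \<omega> $ k * (mk k \<omega> - S \<omega> $ k)) \<omega>
      = (\<Sum>k\<in>UNIV. real_cond_exp M H (\<lambda>\<omega>. q \<omega> $ k * (mk k \<omega> - S \<omega> $ k)) \<omega>)"
    by (rule real_cond_exp_sum) (rule int)
  ultimately show "AE \<omega> in M. real_cond_exp M H (\<lambda>\<omega>. (m \<omega> - S \<omega>) \<bullet> q \<omega>) \<omega> = 0"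
    unfolding eq by eventually_elim simp
qed

text \<open>The conditional mean is a constant \<open>v\<close>, so expanding
  \<open>0 \<le> E[norm (S - v) ^ 2]\<close> leaves \<open>norm v ^ 2\<close> below the second
  moment. This serves the fixed points of \<open>X\<close>, where only a moment bound is given; the
  almost sure bound concerns the samples at query points.\<close>

lemma norm_mean_le_second_moment:
  fixes S :: "'w \<Rightarrow> real^'n"
  assumes M: "prob_space M" and H: "subalgebra M H" and S: "S \<in> borel_measurable M" and c: "0 \<le> c"
    and mean: "AE \<omega> in M. \<forall>k. real_cond_exp M H (\<lambda>\<omega>. S \<omega> $ k) \<omega> = v $ k"
    and second: "AE \<omega> in M. nn_cond_exp M H (\<lambda>\<omega>. ennreal ((norm (S \<omega>))\<^sup>2)) \<omega> \<le> ennreal (c\<^sup>2)"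
  shows "norm v \<le> c"
proof -
  interpret prob_space M by (rule M)
  interpret finite_measure_subalgebra M H using H by unfold_locales
  have [measurable]: "S \<in> borel_measurable M" by (rule S)
  have "(\<integral>\<^sup>+\<omega>. ennreal ((norm (S \<omega>))\<^sup>2) \<partial>M)
      = (\<integral>\<^sup>+\<omega>. nn_cond_exp M H (\<lambda>\<omega>. ennreal ((norm (S \<omega>))\<^sup>2)) \<omega> \<partial>M)"
    using nn_cond_exp_intg[of "\<lambda>_. 1" "\<lambda>\<omega>. ennreal ((norm (S \<omega>))\<^sup>2)"] by simp
  also have "\<dots> \<le> (\<integral>\<^sup>+\<omega>. ennreal (c\<^sup>2) \<partial>M)" using second by (rule nn_integral_mono_AE)
  also have "\<dots> = ennreal (c\<^sup>2)" by (simp add: emeasure_space_1)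
  finally have nn: "(\<integral>\<^sup>+\<omega>. ennreal ((norm (S \<omega>))\<^sup>2) \<partial>M) \<le> ennreal (c\<^sup>2)" .
  have i2: "integrable M (\<lambda>\<omega>. (norm (S \<omega>))\<^sup>2)"
    by (rule integrableI_bounded) (use nn in \<open>auto simp: le_less_trans[OF nn]\<close>)
  have e2: "expectation (\<lambda>\<omega>. (norm (S \<omega>))\<^sup>2) \<le> c\<^sup>2"
    using nn unfolding nn_integral_eq_integral[OF i2, simplified] by (simp add: ennreal_le_iff)
  have iS: "integrable M (\<lambda>\<omega>. S \<omega> $ k)" for k
  proof (rule Bochner_Integration.integrable_bound[of _ "\<lambda>\<omega>. 1 + (norm (S \<omega>))\<^sup>2"])
    show "AE \<omega> in M. norm (S \<omega> $ k) \<le> norm (1 + (norm (S \<omega>))\<^sup>2)"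
    proof (rule AE_I2)
      fix \<omega>
      have "0 \<le> (norm (S \<omega>) - 1)\<^sup>2" by simp
      then have "2 * norm (S \<omega>) \<le> 1 + (norm (S \<omega>))\<^sup>2" unfolding power2_diff by simp
      then have "norm (S \<omega>) \<le> 1 + (norm (S \<omega>))\<^sup>2" using norm_ge_zero[of "S \<omega>"] by linarith
      then show "norm (S \<omega> $ k) \<le> norm (1 + (norm (S \<omega>))\<^sup>2)"
        using component_le_norm_cart[of "S \<omega>" k] by simp
    qed
  qed (use i2 in auto)
  have ek: "expectation (\<lambda>\<omega>. S \<omega> $ k) = v $ k" for k
  proof -
    have "expectation (\<lambda>\<omega>. S \<omega> $ k) = expectation (real_cond_exp M H (\<lambda>\<omega>. S \<omega> $ k))"
      by (rule real_cond_exp_int(2)[OF iS, symmetric])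
    also have "\<dots> = expectation (\<lambda>_. v $ k)"
      by (rule integral_cong_AE) (use mean in \<open>auto elim!: eventually_mono\<close>)
    finally show ?thesis by (simp add: prob_space)
  qed
  have eq: "(norm (S \<omega> - v))\<^sup>2 = (norm (S \<omega>))\<^sup>2 - 2 * (\<Sum>k\<in>UNIV. v $ k * S \<omega> $ k) + (norm v)\<^sup>2" for \<omega>
    unfolding power2_norm_eq_inner by (simp add: inner_diff_left inner_diff_right inner_commute inner_vec_def[of v "S \<omega>"])
  have "0 \<le> expectation (\<lambda>\<omega>. (norm (S \<omega> - v))\<^sup>2)" by simp
  also have "\<dots> = expectation (\<lambda>\<omega>. (norm (S \<omega>))\<^sup>2) - 2 * (\<Sum>k\<in>UNIV. v $ k * v $ k) + (norm v)\<^sup>2"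
    unfolding eq using i2 iS by (simp add: ek prob_space)
  also have "(\<Sum>k\<in>UNIV. v $ k * v $ k) = (norm v)\<^sup>2" unfolding power2_norm_eq_inner inner_vec_def by simp
  finally have "(norm v)\<^sup>2 \<le> c\<^sup>2" using e2 by simp
  then show ?thesis using c by (rule power2_le_imp_le)
qed

text \<open>The \<sigma>-algebra on which the samples are conditioned sits between the past, where
  \<open>p i t\<close> is measurable, and \<open>F t\<close>, where the sample itself is.\<close>

lemma past_and_noise_subalgebra:
  assumes "\<And>t. subalgebra M (F t)" and "\<And>i j t. \<xi> i j t \<in> borel_measurable (F t)"
    and "filtration (space M) F"
  shows "subalgebra M (past F (space M) t)"
    and "subalgebra M (past_and_noise F \<xi> (space M) t)"
    and "subalgebra (past_and_noise F \<xi> (space M) t) (past F (space M) t)"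
    and "subalgebra (F t) (past_and_noise F \<xi> (space M) t)"
proof -
  let ?G = "sets (past F (space M) t) \<union> {\<xi> i j t -` A \<inter> space M | i j A. A \<in> sets borel}"
  have F: "space (F t) = space M" "sets (F t) \<subseteq> sets M" for t
    using assms(1) unfolding subalgebra_def by auto
  show past: "subalgebra M (past F (space M) t)"
    by (cases t) (auto simp: past_def subalgebra_def F sigma_sets_empty_eq dest: set_mp[OF F(2)])
  have G: "?G \<subseteq> sets M"
  proof -
    have "\<xi> i j t -` A \<inter> space M \<in> sets M" if "A \<in> sets borel" for i j A
      using measurable_sets[OF assms(2)[of i j t] that] F by auto
    then show ?thesis using past unfolding subalgebra_def by auto
  qed
  then have Pow: "?G \<subseteq> Pow (space M)" using sets.sets_into_space by blast
  have sp: "space (past_and_noise F \<xi> (space M) t) = space M"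
    and se: "sets (past_and_noise F \<xi> (space M) t) = sigma_sets (space M) ?G"
    unfolding past_and_noise_def using Pow by (simp_all add: space_measure_of sets_measure_of)
  show "subalgebra M (past_and_noise F \<xi> (space M) t)"
    unfolding subalgebra_def sp se using sets.sigma_sets_subset[OF G] by simp
  show "subalgebra (past_and_noise F \<xi> (space M) t) (past F (space M) t)"
    unfolding subalgebra_def sp se using past by (auto simp: subalgebra_def)
  have "sets (past F (space M) t) \<subseteq> sets (F t)"
  proof (cases t)
    case 0
    have "space M \<in> sets (F t)" using sets.top[of "F t"] unfolding F(1) .
    then show ?thesis unfolding \<open>t = 0\<close> by (auto simp: past_def sigma_sets_empty_eq)
  next
    case (Suc s)
    then show ?thesis using filtration.sets_F_mono[OF assms(3), of s t] by (simp add: past_def)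
  qed
  moreover have "\<xi> i j t -` A \<inter> space M \<in> sets (F t)" if "A \<in> sets borel" for i j A
    using measurable_sets[OF assms(2)[of i j t] that] F by simp
  ultimately have "?G \<subseteq> sets (F t)" by auto
  then show "subalgebra (F t) (past_and_noise F \<xi> (space M) t)"
    unfolding subalgebra_def sp se using sets.sigma_sets_subset[of ?G "F t"] F by simp
qed

section \<open>From sample paths to probability: conditional means, predictability and
  concentration\<close>

theorem corollary3:
  fixes M :: "'w measure" and F :: "nat \<Rightarrow> 'w measure"
    and X :: "(real^'n) set"
    and f chi :: "'v::finite \<Rightarrow> real^'n \<Rightarrow> real"
    and \<Phi> :: "real^'n \<Rightarrow> real" and grad\<Phi> :: "real^'n \<Rightarrow> real^'n"
    and P :: "nat \<Rightarrow> real^'v^'v"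
    and \<alpha> r :: "nat \<Rightarrow> real"
    and g :: "'v \<Rightarrow> real^'n \<Rightarrow> real^'n"
    and gt :: "'v \<Rightarrow> nat \<Rightarrow> real^'n \<Rightarrow> 'w \<Rightarrow> real^'n"
    and \<xi> :: "'v \<Rightarrow> 'v \<Rightarrow> nat \<Rightarrow> 'w \<Rightarrow> real^'n"
    and x0 :: "'v \<Rightarrow> real^'n"
    and x y :: "'v \<Rightarrow> nat \<Rightarrow> 'w \<Rightarrow> real^'n"
    and xstar :: "real^'n"
    and B T :: nat and \<theta> \<sigma> L Gf \<nu> \<delta> :: real and l :: 'v
  assumes "prob_space M"
    and "X \<noteq> {}" "convex X" "compact X"
    and "\<And>i. convex_on UNIV (f i)" "\<And>i. convex_on UNIV (chi i)"
    and "is_arg_min (objective f chi) (\<lambda>u. u \<in> X) xstar"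
    and "mirror_map \<Phi> grad\<Phi> \<sigma>"
    and "\<And>t. \<alpha> t = 1 / sqrt (real t + 1)" "\<And>t. r t = 1 / (real t + 1)"
    and "dscmd_n (space M) X chi \<Phi> grad\<Phi> P \<alpha> r gt \<xi> x0 x y"
    and "information_structure M F X gt \<xi> x y"
    and "network_assumption P B \<theta>"
    and "stochastic_subgradient_assumption M F X f g gt \<xi> y Gf"
    and "noise_assumption M F \<xi> \<nu>"
    and "mirror_map_assumption \<Phi> grad\<Phi> L TYPE('v)"
    and "\<And>i t. AE \<omega> in M. norm (sample gt y i t \<omega>) \<le> Gf"
    and "\<And>i j t. AE \<omega> in M. (norm (\<xi> i j t \<omega>))\<^sup>2 \<le> \<nu>"
    and "T \<ge> 3" and "0 < \<delta>" "\<delta> < 1"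
  shows "measure M {\<omega> \<in> space M.
           objective f chi (time_average x l T \<omega>) - objective f chi xstar
           \<le> 3 * C_delta CARD('v) \<theta> B Gf (subgradient_bound X chi) \<sigma> L \<nu>
                   (bregman_diameter \<Phi> grad\<Phi> X) (diameter X) x0 \<delta> / sqrt (real T)}
         \<ge> 1 - \<delta>"
proof -
  interpret prob_space M by (rule assms(1))
  note dscmd = assms(11)[unfolded dscmd_n_def assms(9,10)]
  have x_0: "\<And>i \<omega>. \<omega> \<in> space M \<Longrightarrow> x i 0 \<omega> = x0 i" and x0: "\<And>i. x0 i \<in> X"
    and y_eq: "\<And>i t \<omega>. \<omega> \<in> space M \<Longrightarrow>
      y i t \<omega> = (\<Sum>j\<in>UNIV. (P t $ i $ j) *\<^sub>R (x j t \<omega> + (1 / (real t + 1)) *\<^sub>R \<xi> i j t \<omega>))"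
    using dscmd by auto
  interpret smooth_mirror_map \<Phi> grad\<Phi> \<sigma> L
    using assms(8,16) by unfold_locales (auto simp: mirror_map_assumption_def)
  interpret mixing_network P B \<theta>
    using assms(13) by unfold_locales
  define S where "S i t = sample gt y i t" for i t
  have prox: "is_prox_step X (chi i) (1 / sqrt (real t + 1)) (S i t \<omega>) (y i t \<omega>) (x i (Suc t) \<omega>)"
    if "\<omega> \<in> space M" for i t \<omega>
    using dscmd that unfolding is_prox_step_def S_def by blast
  have x_in: "x i t \<omega> \<in> X" if "\<omega> \<in> space M" for i t \<omega>
    using x_0[OF that] x0 prox[OF that] unfolding is_prox_step_def is_arg_min_def by (cases t) auto
  have filt: "filtration (space M) F" and sub_F: "\<And>t. subalgebra M (F t)"
    and xi_meas: "\<And>i j t. \<xi> i j t \<in> borel_measurable (F t)"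
    and gt_meas: "\<And>i t u. u \<in> X \<Longrightarrow> gt i t u \<in> borel_measurable (F t)"
    and S_meas: "\<And>i t. S i t \<in> borel_measurable (F t)"
    and x_meas: "\<And>i t. x i t \<in> borel_measurable (F t)"
    and y_meas: "\<And>i t. y i t \<in> borel_measurable (F t)"
    using assms(12) unfolding information_structure_def S_def by auto
  note sub = past_and_noise_subalgebra[of M F \<xi>, OF sub_F xi_meas filt]
  let ?H = "past_and_noise F \<xi> (space M)"
  have SM: "S i t \<in> borel_measurable M" for i t by (rule measurable_from_subalg[OF sub_F S_meas])
  have S_bound: "AE \<omega> in M. norm (S i t \<omega>) \<le> Gf" for i t unfolding S_def by (rule assms(17))
  \<comment> \<open>A fixed version of the conditional mean instead of \<open>g i (y i t)\<close>:
    it is measurable by construction, although \<open>g\<close> comes without measurability, and it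
    agrees with \<open>g i (y i t)\<close> almost surely.\<close>
  define m where "m i t \<omega> = (\<chi> k. real_cond_exp M (?H t) (\<lambda>\<omega>. S i t \<omega> $ k) \<omega>)" for i t \<omega>
  have m_bound: "AE \<omega> in M. norm (m i t \<omega>) \<le> Gf" for i t
    by (rule AE_norm_cond_exp_le[OF assms(1) sub(2) SM S_bound]) (simp add: m_def)
  have m_meas: "m i t \<in> borel_measurable (?H t)" for i t
    by (rule borel_measurable_vecI) (simp add: m_def)
  note ssa = assms(14)[unfolded stochastic_subgradient_assumption_def]
  have Gf: "0 \<le> Gf" using ssa by blast
  have g_norm: "norm (g i u) \<le> Gf" if "u \<in> X" for i u
  proof -
    have "AE \<omega> in M. (\<forall>k. real_cond_exp M (past F (space M) 0) (\<lambda>\<omega>. gt i 0 u \<omega> $ k) \<omega> = g i u $ k) \<and>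
        nn_cond_exp M (past F (space M) 0) (\<lambda>\<omega>. ennreal ((norm (gt i 0 u \<omega>))\<^sup>2)) \<omega> \<le> ennreal (Gf\<^sup>2)"
      using ssa that by blast
    then show ?thesis
      by (intro norm_mean_le_second_moment[OF assms(1) sub(1)[of 0] measurable_from_subalg[OF sub_F gt_meas[OF that, of i 0]] Gf])
        (auto elim: eventually_mono)
  qed
  have f_Lip: "f i u - f i z \<le> Gf * norm (u - z)" if "u \<in> X" for i u z
  proof -
    have "g i u \<in> subdifferential (f i) u" using ssa that by blast
    then have "f i u + g i u \<bullet> (z - u) \<le> f i z" unfolding subdifferential_def by blast
    then have "f i u - f i z \<le> g i u \<bullet> (u - z)" by (simp add: inner_diff_right)
    also have "\<dots> \<le> norm (g i u) * norm (u - z)" by (rule norm_cauchy_schwarz)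
    also have "\<dots> \<le> Gf * norm (u - z)" using g_norm[OF that] by (intro mult_right_mono) auto
    finally show ?thesis .
  qed
  have m_sub: "AE \<omega> in M. m i t \<omega> \<in> subdifferential (f i) (y i t \<omega>)" for i t
  proof -
    have "AE \<omega> in M. g i (y i t \<omega>) \<in> subdifferential (f i) (y i t \<omega>) \<and>
        (\<forall>k. real_cond_exp M (?H t) (\<lambda>\<omega>. S i t \<omega> $ k) \<omega> = g i (y i t \<omega>) $ k)"
      using ssa unfolding S_def by (blast intro: eventually_mono)
    then show ?thesis
    proof eventually_elim
      case (elim \<omega>)
      then have "m i t \<omega> = g i (y i t \<omega>)" unfolding m_def by (simp add: vec_eq_iff)
      with elim show ?case by simp
    qed
  qed
  \<comment> \<open>Agents and times are countably many, so outside one null set all almost sure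
    hypotheses hold together and the pathwise theory applies.\<close>
  have path: "AE \<omega> in M. dscmd_path \<Phi> grad\<Phi> \<sigma> L P B \<theta> X f chi Gf \<nu>
      (\<lambda>i t. S i t \<omega>) (\<lambda>i t. m i t \<omega>) (\<lambda>i t. x i t \<omega>) (\<lambda>i t. y i t \<omega>) (\<lambda>i j t. \<xi> i j t \<omega>)"
  proof -
    have "AE \<omega> in M. \<forall>i t. norm (S i t \<omega>) \<le> Gf \<and> norm (m i t \<omega>) \<le> Gf
        \<and> m i t \<omega> \<in> subdifferential (f i) (y i t \<omega>)"
      unfolding AE_all_countable using S_bound m_bound m_sub by auto
    moreover have "AE \<omega> in M. \<forall>i j t. (norm (\<xi> i j t \<omega>))\<^sup>2 \<le> \<nu>"
      unfolding AE_all_countable using assms(18) by auto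
    ultimately show ?thesis
      using AE_space
    proof eventually_elim
      case (elim \<omega>)
      show ?case
      proof unfold_locales
        show "D u (\<Sum>i\<in>UNIV. w i *\<^sub>R b i) \<le> (\<Sum>i\<in>UNIV. w i * D u (b i))"
          if "\<And>i. 0 \<le> w i" "\<And>i. w i \<le> 1" "(\<Sum>i\<in>UNIV. w i) = 1" for u and b :: "'v \<Rightarrow> real^'n" and w
          using assms(16) that unfolding mirror_map_assumption_def by blast
        show "x i 0 \<omega> \<in> X" for i using x_in elim by blast
        show "y i t \<omega> = (\<Sum>j\<in>UNIV. (P t $ i $ j) *\<^sub>R (x j t \<omega> + (1 / (real t + 1)) *\<^sub>R \<xi> i j t \<omega>))" for i t
          using y_eq elim by blast
      qed (use assms(2-6) f_Lip prox elim in auto)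
    qed
  qed
  have xstar: "xstar \<in> X" using assms(7) unfolding is_arg_min_def by simp
  \<comment> \<open>Adaptedness only gives measurability at time \<open>t\<close>. The past has it
    because the initial state is deterministic and later states are proximal steps of data from the
    preceding time.\<close>
  have x_past: "x i t \<in> borel_measurable (past F (space M) t)" for i t
  proof (cases t)
    case 0
    have "(\<lambda>_. x0 i) \<in> borel_measurable (past F (space M) 0)" by simp
    moreover have "space (past F (space M) 0) = space M" using sub(1)[of 0] unfolding subalgebra_def by simp
    ultimately show ?thesis
      unfolding 0 using measurable_cong[of "past F (space M) 0" "x i 0" "\<lambda>_. x0 i" borel] x_0 by simp
  next
    case (Suc s)
    have "space (F s) = space M" using sub_F unfolding subalgebra_def by simp
    then have "x i (Suc s) \<in> borel_measurable (F s)"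
      by (intro prox_measurable[OF assms(3,4) assms(6) _ assms(2) S_meas y_meas]) (use prox in auto)
    then show ?thesis unfolding Suc by (simp add: past_def)
  qed
  define q where "q i t \<omega> = mix (P t) (\<lambda>j. x j t \<omega>) i - xstar" for i t \<omega>
  have q_past: "q i t \<in> borel_measurable (past F (space M) t)" for i t
    unfolding q_def mix_def using x_past by measurable
  have q_meas: "q i t \<in> borel_measurable (?H t)" for i t
    by (rule measurable_from_subalg[OF sub(3) q_past])
  have q_bound: "norm (q i t \<omega>) \<le> diameter X" if "\<omega> \<in> space M" for i t \<omega>
  proof -
    have "mix (P t) (\<lambda>j. x j t \<omega>) i \<in> X"
      unfolding mix_def by (rule convex_sum) (use assms(3) x_in[OF that] P_nonneg P_row in auto)
    from diameter_bounded_bound[OF compact_imp_bounded[OF assms(4)] this xstar]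
    show ?thesis unfolding q_def by (simp add: dist_norm)
  qed
  \<comment> \<open>Shifted by one: the average runs over times 1 to \<open>T\<close>, Azuma's
    inequality over indices from 0.\<close>
  define Z where "Z t \<omega> = (\<Sum>i\<in>UNIV. (m i (Suc t) \<omega> - S i (Suc t) \<omega>) \<bullet> q i (Suc t) \<omega>)" for t \<omega>
  define c where "c = 2 * Gf * diameter X * real CARD('v)"
  have D0: "0 \<le> diameter X" by (rule diameter_ge_0[OF compact_imp_bounded[OF assms(4)]])
  have Z_F: "Z t \<in> borel_measurable (F (Suc t))" for t
    unfolding Z_def
    using measurable_from_subalg[OF sub(4) m_meas] measurable_from_subalg[OF sub(4) q_meas] S_meas by measurable
  have conc: "1 - \<delta> \<le> prob {\<omega> \<in> space M. (\<Sum>t<T. Z t \<omega>) \<le> c * sqrt (2 * real T * ln (1 / \<delta>))}"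
  proof (rule azuma[where H = "\<lambda>t. ?H (Suc t)"])
    show "subalgebra M (?H (Suc t))" for t by (rule sub(2))
    show "0 \<le> c" unfolding c_def using Gf D0 by simp
    show "Z t \<in> borel_measurable M" for t by (rule measurable_from_subalg[OF sub_F Z_F])
    show "AE \<omega> in M. \<bar>Z t \<omega>\<bar> \<le> c" for t
    proof -
      have "AE \<omega> in M. \<forall>i. norm (S i (Suc t) \<omega>) \<le> Gf \<and> norm (m i (Suc t) \<omega>) \<le> Gf"
        unfolding AE_all_countable using S_bound m_bound by auto
      then show ?thesis
        using AE_space
      proof eventually_elim
        case (elim \<omega>)
        have "\<bar>(m i (Suc t) \<omega> - S i (Suc t) \<omega>) \<bullet> q i (Suc t) \<omega>\<bar> \<le> 2 * Gf * diameter X" for i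
        proof -
          have "norm (m i (Suc t) \<omega> - S i (Suc t) \<omega>) \<le> 2 * Gf"
            using norm_triangle_ineq4[of "m i (Suc t) \<omega>" "S i (Suc t) \<omega>"] elim(1)[rule_format, of i] by linarith
          then show ?thesis
            using q_bound[OF elim(2), of i "Suc t"] Gf
            by (intro order_trans[OF Cauchy_Schwarz_ineq2] mult_mono) auto
        qed
        then have "(\<Sum>i\<in>UNIV. \<bar>(m i (Suc t) \<omega> - S i (Suc t) \<omega>) \<bullet> q i (Suc t) \<omega>\<bar>) \<le> c"
          using sum_bounded_above[of "UNIV :: 'v set" "\<lambda>i. \<bar>(m i (Suc t) \<omega> - S i (Suc t) \<omega>) \<bullet> q i (Suc t) \<omega>\<bar>"
              "2 * Gf * diameter X"]
          unfolding c_def by (simp add: mult_ac)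
        then show ?case unfolding Z_def by (rule order_trans[OF sum_abs])
      qed
    qed
    \<comment> \<open>\<open>Z u\<close> is known at time \<open>Suc u \<le> t\<close>, and
      \<open>F t\<close> is the past of time \<open>Suc t\<close>.\<close>
    show "Z u \<in> borel_measurable (?H (Suc t))" if "u < t" for u t
    proof -
      have "subalgebra (F t) (F (Suc u))"
        using filtration.sets_F_mono[OF filt, of "Suc u" t] filtration.space_F[OF filt] that
        unfolding subalgebra_def by auto
      then have "Z u \<in> borel_measurable (past F (space M) (Suc t))"
        unfolding past_def using measurable_from_subalg[OF _ Z_F] by simp
      then show ?thesis by (rule measurable_from_subalg[OF sub(3)])
    qed
    show "AE \<omega> in M. real_cond_exp M (?H (Suc t)) (Z t) \<omega> = 0" for t
    proof -
      interpret finite_measure_subalgebra M "?H (Suc t)" using sub(2) by unfold_locales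
      note ce = cond_exp_predictable_inner[OF assms(1) sub(2) SM S_bound, where q = "q i (Suc t)" and m = "m i (Suc t)" for i, OF m_def q_meas q_bound]
      have "AE \<omega> in M. real_cond_exp M (?H (Suc t)) (Z t) \<omega>
          = (\<Sum>i\<in>UNIV. real_cond_exp M (?H (Suc t)) (\<lambda>\<omega>. (m i (Suc t) \<omega> - S i (Suc t) \<omega>) \<bullet> q i (Suc t) \<omega>) \<omega>)"
        unfolding Z_def by (rule real_cond_exp_sum) (rule ce(1))
      moreover have "AE \<omega> in M. \<forall>i\<in>UNIV. real_cond_exp M (?H (Suc t)) (\<lambda>\<omega>. (m i (Suc t) \<omega> - S i (Suc t) \<omega>) \<bullet> q i (Suc t) \<omega>) \<omega> = 0"
        by (intro AE_finite_allI ce(2)) simp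
      ultimately show ?thesis by eventually_elim simp
    qed
  qed (use assms(20,21) in auto)
  let ?A = "{\<omega> \<in> space M.
           objective f chi (time_average x l T \<omega>) - objective f chi xstar
           \<le> 3 * C_delta CARD('v) \<theta> B Gf (subgradient_bound X chi) \<sigma> L \<nu>
                   (bregman_diameter \<Phi> grad\<Phi> X) (diameter X) x0 \<delta> / sqrt (real T)}"
  \<comment> \<open>The concentration event is contained in \<open>?A\<close> only up to a null set,
    and comparing probabilities under such an inclusion requires \<open>?A\<close> to be
    measurable.\<close>
  have "?A \<in> sets M"
  proof -
    have "continuous_on UNIV (objective f chi)"
      unfolding objective_def by (intro continuous_intros convex_on_UNIV_continuous assms(5,6))
    then have [measurable]: "objective f chi \<in> borel_measurable borel" by (rule borel_measurable_continuous_onI)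
    have [measurable]: "x i t \<in> borel_measurable M" for i t by (rule measurable_from_subalg[OF sub_F x_meas])
    show ?thesis unfolding time_average_def by measurable
  qed
  moreover have "AE \<omega> in M. \<omega> \<in> {\<omega> \<in> space M. (\<Sum>t<T. Z t \<omega>) \<le> c * sqrt (2 * real T * ln (1 / \<delta>))} \<longrightarrow> \<omega> \<in> ?A"
    using path AE_space
  proof eventually_elim
    case (elim \<omega>)
    interpret path: dscmd_path \<Phi> grad\<Phi> \<sigma> L P B \<theta> X f chi Gf \<nu>
      "\<lambda>i t. S i t \<omega>" "\<lambda>i t. m i t \<omega>" "\<lambda>i t. x i t \<omega>" "\<lambda>i t. y i t \<omega>" "\<lambda>i j t. \<xi> i j t \<omega>"
      by (rule elim(1))
    have mart: "(\<Sum>t=1..T. path.mart xstar t) = (\<Sum>t<T. Z t \<omega>)"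
      unfolding path.mart_def path.p_def Z_def q_def
      by (rule sum.reindex_bij_witness[of _ Suc "\<lambda>t. t - 1"]) auto
    have x0_eq: "(\<lambda>i. x i 0 \<omega>) = x0" using x_0[OF elim(2)] by auto
    show ?case
      using path.objective_gap_bound[OF xstar assms(19,20,21), of l] elim(2)
      unfolding mart x0_eq time_average_def c_def by simp
  qed
  ultimately have "prob {\<omega> \<in> space M. (\<Sum>t<T. Z t \<omega>) \<le> c * sqrt (2 * real T * ln (1 / \<delta>))} \<le> prob ?A"
    by (intro finite_measure_mono_AE)
  with conc show ?thesis by linarith
qed

end
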